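(* Let $m>1$ be an integer, let $\ell$ be an odd integer, and let $J$ be the finite $2$-group with generators $A,B$ defined in the context. For every $x,y\in Z_2(J)$ the assignment $A\mapsto Ax$, $B\mapsto By$ extends to a 2-central automorphism $\Psi_{(x,y)}$ of $J$ that fixes $Z_1(J)$ and $Z_2(J)/Z_1(J)$ pointwise. Thus, $|\mathrm{Aut}_2(J)|=2^{4m}$ and the map $g:Z_2(J)\times Z_2(J)\to\mathrm{Aut}_2(J)/\mathrm{Aut}_1(J)$, given by $(x,y)\mapsto\Psi_{(x,y)}\mathrm{Aut}_1(J)$, is a group epimorphism with kernel $Z_1(J)^2$, so that $\mathrm{Aut}_2(J)/\mathrm{Aut}_1(J)\cong(Z_2(J)/Z_1(J))^2$.
   Context: Notation: $[a,b]=a^{-1}b^{-1}ab$, $b^a=a^{-1}ba$, $\alpha=1+2^m\ell$. The group is $$J=\langle A,B\mid A^{[A,B]}=A^{\alpha},\ B^{[B,A]}=B^{\alpha},\ A^{2^{3m-1}}=B^{2^{3m-1}}=1\rangle.$$ For a group $T$, $Z_0(T)=1, Z_1(T),Z_2(T),\dots$ denotes the upper central series, $T^n$ denotes the direct product of $n$ copies of $T$, and $\mathrm{Aut}_i(T)$ is the kernel of the canonical map $\mathrm{Aut}(T)\to\mathrm{Aut}(T/Z_i(T))$. An automorphism of $T$ is $i$-central if it belongs to $\mathrm{Aut}_i(T)$. *)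

theory Defs
  imports "HOL-Algebra.Coset" "HOL-Algebra.Bij"
begin

section \<open>Group presentations\<close>

text \<open>
  A word over a generating set is a list of letters; the letter \<open>(g, True)\<close> stands for the
  generator \<open>g\<close> and \<open>(g, False)\<close> for its formal inverse.
\<close>

type_synonym 'g word = "('g \<times> bool) list"

definition word_inv :: "'g word \<Rightarrow> 'g word" where
  "word_inv w = rev (map (\<lambda>(g, b). (g, \<not> b)) w)"

definition word_pow :: "'g word \<Rightarrow> int \<Rightarrow> 'g word" where
  "word_pow w k =
     (if 0 \<le> k then concat (replicate (nat k) w)
      else concat (replicate (nat (- k)) (word_inv w)))"

definition word_comm :: "'g word \<Rightarrow> 'g word \<Rightarrow> 'g word" where
  "word_comm a b = word_inv a @ word_inv b @ a @ b"

text \<open>\<open>word_conj b a\<close> is the word for \<open>b\<^sup>a = a\<^sup>-\<^sup>1 b a\<close>.\<close>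

definition word_conj :: "'g word \<Rightarrow> 'g word \<Rightarrow> 'g word" where
  "word_conj b a = word_inv a @ b @ a"

text \<open>
  The congruence on words generated by free cancellation and by the relations \<open>u = v\<close>
  for \<open>(u, v) \<in> R\<close>.
\<close>

inductive pres_eq :: "('g word \<times> 'g word) set \<Rightarrow> 'g word \<Rightarrow> 'g word \<Rightarrow> bool"
  for R :: "('g word \<times> 'g word) set" where
  pres_refl: "pres_eq R u u"
| pres_sym: "pres_eq R u v \<Longrightarrow> pres_eq R v u"
| pres_trans: "pres_eq R u v \<Longrightarrow> pres_eq R v w \<Longrightarrow> pres_eq R u w"
| pres_append: "pres_eq R u v \<Longrightarrow> pres_eq R u' v' \<Longrightarrow> pres_eq R (u @ u') (v @ v')"
| pres_cancel: "pres_eq R [(g, b), (g, \<not> b)] []"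
| pres_rel: "(u, v) \<in> R \<Longrightarrow> pres_eq R u v"

definition pres_class :: "('g word \<times> 'g word) set \<Rightarrow> 'g word \<Rightarrow> 'g word set" where
  "pres_class R u = {v. pres_eq R u v}"

text \<open>
  The group presented by all elements of the type \<open>'g\<close> as generators and the relations \<open>R\<close>.
\<close>

definition presented_group :: "('g word \<times> 'g word) set \<Rightarrow> 'g word set monoid" where
  "presented_group R =
     \<lparr>carrier = range (pres_class R),
      mult = (\<lambda>S T. {w. \<exists>u\<in>S. \<exists>v\<in>T. pres_eq R (u @ v) w}),
      one = pres_class R []\<rparr>"

lemma pres_class_eq_iff: "pres_class R u = pres_class R v \<longleftrightarrow> pres_eq R u v"
  unfolding pres_class_def by (auto intro: pres_eq.intros)

lemma pres_class_mult:
  "pres_class R u \<otimes>\<^bsub>presented_group R\<^esub> pres_class R v = pres_class R (u @ v)"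
  unfolding presented_group_def pres_class_def
  by (auto intro: pres_refl) (meson pres_append pres_trans)

lemma pres_inv_left: "pres_eq R (word_inv w @ w) []"
proof (induction w)
  case Nil
  show ?case by (simp add: word_inv_def pres_refl)
next
  case (Cons x w)
  obtain g b where x: "x = (g, b)" by force
  have "pres_eq R ([(g, \<not> b), (g, b)]) []"
    using pres_cancel[of R g "\<not> b"] by simp
  then have "pres_eq R (word_inv w @ ([(g, \<not> b), (g, b)] @ w)) (word_inv w @ ([] @ w))"
    by (intro pres_append pres_refl)
  then have "pres_eq R (word_inv w @ ([(g, \<not> b), (g, b)] @ w)) []"
    using Cons.IH by (auto intro: pres_trans)
  then show ?case by (simp add: x word_inv_def)
qed

lemma group_presented_group: "group (presented_group R)"
proof (rule groupI)
  fix x assume "x \<in> carrier (presented_group R)"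
  then obtain u where u: "x = pres_class R u" by (auto simp: presented_group_def)
  have "pres_class R (word_inv u) \<in> carrier (presented_group R)"
    by (simp add: presented_group_def)
  moreover have "pres_class R (word_inv u) \<otimes>\<^bsub>presented_group R\<^esub> x = \<one>\<^bsub>presented_group R\<^esub>"
    by (simp add: u pres_class_mult) (simp add: presented_group_def pres_class_eq_iff pres_inv_left)
  ultimately show "\<exists>y\<in>carrier (presented_group R). y \<otimes>\<^bsub>presented_group R\<^esub> x = \<one>\<^bsub>presented_group R\<^esub>"
    by blast
next
  fix x assume "x \<in> carrier (presented_group R)"
  then obtain u where u: "x = pres_class R u" by (auto simp: presented_group_def)
  have "\<one>\<^bsub>presented_group R\<^esub> = pres_class R []" by (simp add: presented_group_def)
  then show "\<one>\<^bsub>presented_group R\<^esub> \<otimes>\<^bsub>presented_group R\<^esub> x = x"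
    by (simp add: u pres_class_mult)
next
  fix x y assume "x \<in> carrier (presented_group R)" "y \<in> carrier (presented_group R)"
  then obtain u v where "x = pres_class R u" "y = pres_class R v"
    by (auto simp: presented_group_def)
  then show "x \<otimes>\<^bsub>presented_group R\<^esub> y \<in> carrier (presented_group R)"
    by (simp add: pres_class_mult) (simp add: presented_group_def)
next
  fix x y z
  assume "x \<in> carrier (presented_group R)" "y \<in> carrier (presented_group R)"
    "z \<in> carrier (presented_group R)"
  then obtain u v w where "x = pres_class R u" "y = pres_class R v" "z = pres_class R w"
    by (auto simp: presented_group_def)
  then show "x \<otimes>\<^bsub>presented_group R\<^esub> y \<otimes>\<^bsub>presented_group R\<^esub> z =
      x \<otimes>\<^bsub>presented_group R\<^esub> (y \<otimes>\<^bsub>presented_group R\<^esub> z)"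
    by (simp add: pres_class_mult)
qed (simp add: presented_group_def)

text \<open>Evaluation of a word in a group, and the universal property of the presentation.\<close>

definition word_eval :: "('a, 'b) monoid_scheme \<Rightarrow> ('g \<Rightarrow> 'a) \<Rightarrow> 'g word \<Rightarrow> 'a" where
  "word_eval G f w =
     foldr (\<lambda>(g, b) x. (if b then f g else inv\<^bsub>G\<^esub> (f g)) \<otimes>\<^bsub>G\<^esub> x) w \<one>\<^bsub>G\<^esub>"

lemma presented_group_universal:
  assumes G: "group G" and f: "\<And>g. f g \<in> carrier G"
    and R: "\<And>u v. (u, v) \<in> R \<Longrightarrow> word_eval G f u = word_eval G f v"
  shows "\<exists>h \<in> hom (presented_group R) G. \<forall>g. h (pres_class R [(g, True)]) = f g"
proof -
  interpret group G by (rule G)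
  have cl: "word_eval G f w \<in> carrier G" for w
    by (induction w) (auto simp: word_eval_def f)
  have app: "word_eval G f (u @ v) = word_eval G f u \<otimes>\<^bsub>G\<^esub> word_eval G f v" for u v
  proof (induction u)
    case Nil
    show ?case using cl[of v] by (simp add: word_eval_def)
  next
    case (Cons x u)
    have "word_eval G f (x # w) =
        (if snd x then f (fst x) else inv\<^bsub>G\<^esub> (f (fst x))) \<otimes>\<^bsub>G\<^esub> word_eval G f w" for w
      by (simp add: word_eval_def split: prod.splits)
    then show ?case using Cons.IH cl f by (simp add: m_assoc)
  qed
  have eq: "pres_eq R u v \<Longrightarrow> word_eval G f u = word_eval G f v" for u v
  proof (induction rule: pres_eq.induct)
    case (pres_cancel g b)
    then show ?case using f by (cases b) (auto simp: word_eval_def)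
  qed (auto simp: app R)
  define h where "h S = word_eval G f (SOME u. u \<in> S)" for S
  have h: "h (pres_class R u) = word_eval G f u" for u
  proof -
    have "u \<in> pres_class R u" by (simp add: pres_class_def pres_refl)
    then have "(SOME v. v \<in> pres_class R u) \<in> pres_class R u" by (rule someI)
    then show ?thesis using eq by (simp add: h_def pres_class_def)
  qed
  have "h \<in> hom (presented_group R) G"
  proof (rule homI)
    fix x assume "x \<in> carrier (presented_group R)"
    then obtain u where "x = pres_class R u" by (auto simp: presented_group_def)
    then show "h x \<in> carrier G" by (simp add: h cl)
  next
    fix x y assume "x \<in> carrier (presented_group R)" "y \<in> carrier (presented_group R)"
    then obtain u v where "x = pres_class R u" "y = pres_class R v"
      by (auto simp: presented_group_def)
    then show "h (x \<otimes>\<^bsub>presented_group R\<^esub> y) = h x \<otimes>\<^bsub>G\<^esub> h y"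
      by (simp add: pres_class_mult h app)
  qed
  moreover have "h (pres_class R [(g, True)]) = f g" for g
    using f by (simp add: h word_eval_def)
  ultimately show ?thesis by blast
qed


section \<open>Upper central series and central automorphisms\<close>

definition center :: "('a, 'b) monoid_scheme \<Rightarrow> 'a set" where
  "center G = {z \<in> carrier G. \<forall>x\<in>carrier G. z \<otimes>\<^bsub>G\<^esub> x = x \<otimes>\<^bsub>G\<^esub> z}"

fun upper_central :: "('a, 'b) monoid_scheme \<Rightarrow> nat \<Rightarrow> 'a set" where
  "upper_central G 0 = {\<one>\<^bsub>G\<^esub>}"
| "upper_central G (Suc i) =
     {x \<in> carrier G. upper_central G i #>\<^bsub>G\<^esub> x \<in> center (G Mod upper_central G i)}"

text \<open>
  The canonical map from the automorphism group of \<open>G\<close> to that of \<open>G Mod N\<close>, for a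
  characteristic subgroup \<open>N\<close>: the coset \<open>N x\<close> is sent to its image, the coset \<open>N (\<phi> x)\<close>.
\<close>

definition induced_auto :: "('a, 'b) monoid_scheme \<Rightarrow> 'a set \<Rightarrow> ('a \<Rightarrow> 'a) \<Rightarrow> 'a set \<Rightarrow> 'a set" where
  "induced_auto G N \<phi> = (\<lambda>C\<in>carrier (G Mod N). \<phi> ` C)"

definition central_auto :: "('a, 'b) monoid_scheme \<Rightarrow> nat \<Rightarrow> ('a \<Rightarrow> 'a) set" where
  "central_auto G i =
     kernel (AutoGroup G) (AutoGroup (G Mod upper_central G i))
       (induced_auto G (upper_central G i))"

definition central_auto_group :: "('a, 'b) monoid_scheme \<Rightarrow> nat \<Rightarrow> ('a \<Rightarrow> 'a) monoid" where
  "central_auto_group G i = (AutoGroup G)\<lparr>carrier := central_auto G i\<rparr>"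

definition upper_central_group :: "('a, 'b) monoid_scheme \<Rightarrow> nat \<Rightarrow> ('a, 'b) monoid_scheme" where
  "upper_central_group G i = G\<lparr>carrier := upper_central G i\<rparr>"


section \<open>The group J\<close>

datatype J_gen = GenA | GenB

definition J_rels :: "nat \<Rightarrow> int \<Rightarrow> (J_gen word \<times> J_gen word) set" where
  "J_rels m l =
     (let a = [(GenA, True)]; b = [(GenB, True)]; \<alpha> = 1 + 2 ^ m * l in
      {(word_conj a (word_comm a b), word_pow a \<alpha>),
       (word_conj b (word_comm b a), word_pow b \<alpha>),
       (word_pow a (2 ^ (3 * m - 1)), []),
       (word_pow b (2 ^ (3 * m - 1)), [])})"

definition J :: "nat \<Rightarrow> int \<Rightarrow> J_gen word set monoid" where
  "J m l = presented_group (J_rels m l)"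

definition J_A :: "nat \<Rightarrow> int \<Rightarrow> J_gen word set" where
  "J_A m l = pres_class (J_rels m l) [(GenA, True)]"

definition J_B :: "nat \<Rightarrow> int \<Rightarrow> J_gen word set" where
  "J_B m l = pres_class (J_rels m l) [(GenB, True)]"

text \<open>
  The automorphism extending \<open>A \<mapsto> A x\<close>, \<open>B \<mapsto> B y\<close>. It is unique when it exists, because
  \<open>A\<close> and \<open>B\<close> generate the group and elements of \<open>auto\<close> are undefined off the carrier;
  existence is not built into the definition.
\<close>

definition Psi ::
  "nat \<Rightarrow> int \<Rightarrow> J_gen word set \<Rightarrow> J_gen word set \<Rightarrow> J_gen word set \<Rightarrow> J_gen word set" where
  "Psi m l x y =
     (THE \<phi>. \<phi> \<in> auto (J m l) \<and>
        \<phi> (J_A m l) = J_A m l \<otimes>\<^bsub>J m l\<^esub> x \<and> \<phi> (J_B m l) = J_B m l \<otimes>\<^bsub>J m l\<^esub> y)"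

end

theory Submission
  imports Defs "HOL-Algebra.Generated_Groups" "HOL-Number_Theory.Cong"
begin

text \<open>
  Put \<open>\<lambda> = \<alpha> - 1 = 2\<^sup>m l\<close>, \<open>e = 2\<^bsup>m-1\<^esup>\<close>, \<open>h = 2\<^bsup>2m-1\<^esup> = 2 e\<^sup>2\<close>, \<open>M = 2\<^bsup>3m-1\<^esup> = 4 e\<^sup>3\<close> and
  \<open>C = [A, B]\<close>. Everything follows from a normal form for the elements of \<open>J\<close>.

  The relations say that conjugation by \<open>C\<close> raises \<open>A\<close> to the power \<open>\<alpha>\<close> and \<open>B\<close> to the power
  \<open>\<alpha>\<^sup>-\<^sup>1\<close>. Conjugating \<open>A\<close> repeatedly by \<open>B\<close> then gives \<open>[A, B\<^sup>n] = B\<^bsup>s(n)\<^esup> C\<^sup>n\<close> with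
  \<open>s(n) = \<lambda> (1 \<alpha> + 2 \<alpha>\<^sup>2 + \<dots> + (n - 1) \<alpha>\<^bsup>n-1\<^esup>)\<close> (lemma \<open>a_b_pow\<close>). Transforming \<open>C = [A, B]\<close> by \<open>C\<close>
  yields the hidden relation \<open>A\<^sup>h B\<^sup>h = 1\<close>, so that \<open>A\<^sup>h\<close> is central, and the formula for
  \<open>[A, B\<^sup>h]\<close> yields \<open>C\<^sup>h = A\<^bsup>M/2\<^esup>\<close> (\<open>a_h_eq_b\<close>, \<open>c_h_eq_a\<close>). Hence every element is
  \<open>B\<^sup>j A\<^sup>i C\<^sup>t\<close>, and left multiplication by \<open>A\<close>, \<open>B\<close>, \<open>C\<close> is given by explicit formulas on the
  exponents (\<open>a_N\<close>, \<open>b_N\<close>).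

  Conversely, the same formulas define permutations of the exponent triples modulo the
  identifications forced by \<open>B\<^sup>h = A\<^bsup>-h\<^esup>\<close> and \<open>C\<^sup>h = A\<^bsup>M/2\<^esup>\<close>, and these permutations satisfy
  the defining relations (\<open>model_relations\<close>). The only laborious relation is \<open>A C = C A\<^sup>\<alpha>\<close>,
  which needs a closed form for the powers of the permutation belonging to \<open>A\<close>
  (\<open>step_a_iterate\<close>); since \<open>\<lambda>\<^sup>3\<close> vanishes modulo \<open>M\<close>, that closed form is polynomial. So no
  further identifications hold in \<open>J\<close> (\<open>N_inj\<close>).

  With the normal form, \<open>Z\<^sub>1(J) = \<langle>A\<^sup>h\<rangle>\<close> has order \<open>2\<^sup>m\<close> and \<open>Z\<^sub>2(J) = \<langle>A\<^sup>h, C\<^sup>e\<rangle>\<close> is abelian of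
  order \<open>2\<^bsup>2m\<^esup>\<close>: an element that commutes with \<open>A\<close> modulo \<open>\<langle>A\<^sup>h\<rangle>\<close> has an exponent of \<open>B\<close>
  divisible by \<open>h\<close>, and the automorphism interchanging \<open>A\<close> and \<open>B\<close> treats the exponent of \<open>A\<close>
  likewise (\<open>commute_mod_Z1\<close>).

  For \<open>x, y\<close> in \<open>Z\<^sub>2(J)\<close> the pair \<open>A x, B y\<close> satisfies the relations of \<open>J\<close>: the commutator
  \<open>[A x, B y]\<close> differs from \<open>C\<close> by a central factor, and in \<open>(A x)\<^sup>\<alpha>\<close> the two deviations from
  \<open>A\<^sup>\<alpha> x\<close>, namely \<open>x\<^sup>\<lambda>\<close> and a power of \<open>[x, A]\<close>, are the same element of order at most \<open>2\<close>
  (\<open>a_Z2_pow_alpha\<close>). This gives \<open>\<Psi>\<^bsub>(x,y)\<^esub>\<close>. It fixes \<open>A\<^sup>h\<close>, moves \<open>C\<^sup>e\<close> by a central element, and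
  is therefore injective; conversely any \<open>2\<close>-central automorphism multiplies \<open>A\<close> and \<open>B\<close> by
  elements of \<open>Z\<^sub>2(J)\<close>. Comparing two automorphisms modulo \<open>Z\<^sub>1(J)\<close> on the two generators shows that
  \<open>(x, y) \<mapsto> \<Psi>\<^bsub>(x,y)\<^esub>\<close> is multiplicative modulo \<open>Aut\<^sub>1(J)\<close> (\<open>Psi_mult\<close>) and that its kernel there
  is \<open>Z\<^sub>1(J)\<^sup>2\<close> (\<open>Psi_near_id_Z1\<close>).
\<close>

section \<open>Triangular, tetrahedral and pyramidal numbers\<close>

text \<open>
  Binomial coefficients \<open>n\<close> over \<open>2\<close> and \<open>n\<close> over \<open>3\<close>, and the sum of the squares below \<open>n\<close>,
  continued to negative arguments; they are the coefficients of the exponents below.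
\<close>

definition tri :: "int \<Rightarrow> int" where "tri n = n * (n - 1) div 2"
definition tet :: "int \<Rightarrow> int" where "tet n = n * (n - 1) * (n - 2) div 6"
definition pyr :: "int \<Rightarrow> int" where "pyr n = 2 * tet n + tri n"

lemma tri_double: "2 * tri n = n * (n - 1)"
  unfolding tri_def by (rule dvd_mult_div_cancel) simp

lemma tet_sextuple: "6 * tet n = n * (n - 1) * (n - 2)"
proof -
  have 2: "2 dvd n * (n - 1) * (n - 2)" by simp
  obtain q r where n: "n = 3 * q + r" and r: "r = 0 \<or> r = 1 \<or> r = 2"
  proof
    show "n = 3 * (n div 3) + n mod 3" by simp
    show "n mod 3 = 0 \<or> n mod 3 = 1 \<or> n mod 3 = 2" by presburger
  qed
  have 3: "3 dvd n * (n - 1) * (n - 2)"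
  proof -
    have "3 dvd n \<or> 3 dvd n - 1 \<or> 3 dvd n - 2" using n r by auto
    then show ?thesis by auto
  qed
  have "coprime (2::int) 3" by simp
  from divides_mult[OF 2 3 this] have "6 dvd n * (n - 1) * (n - 2)" by simp
  then show ?thesis unfolding tet_def by (rule dvd_mult_div_cancel)
qed

lemma pyr_sextuple: "6 * pyr n = n * (n - 1) * (2 * n - 1)"
  using tri_double[of n] tet_sextuple[of n] unfolding pyr_def by (simp add: algebra_simps)

lemma tri_add: "tri (x + y) = tri x + tri y + x * y"
  using tri_double[of x] tri_double[of y] tri_double[of "x + y"] by (simp add: algebra_simps)

lemma pyr_add: "pyr (x + y) = pyr x + pyr y + x\<^sup>2 * y + 2 * x * tri y"
proof -
  have "6 * pyr (x + y) = 6 * (pyr x + pyr y + x\<^sup>2 * y + 2 * x * tri y)"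
    using pyr_sextuple[of x] pyr_sextuple[of y] pyr_sextuple[of "x + y"] tri_double[of y] by algebra
  then show ?thesis by simp
qed

lemma tri_0 [simp]: "tri 0 = 0" and tri_1 [simp]: "tri 1 = 0"
  and pyr_0 [simp]: "pyr 0 = 0" and pyr_1 [simp]: "pyr 1 = 0"
  and tet_0 [simp]: "tet 0 = 0" and tet_1 [simp]: "tet 1 = 0"
  by (simp_all add: tri_def pyr_def tet_def)

lemma tri_Suc: "tri (n + 1) = tri n + n"
  by (simp add: tri_add)

lemma pyr_Suc: "pyr (n + 1) = pyr n + n\<^sup>2"
  by (simp add: pyr_add)

lemma tet_Suc: "tet (n + 1) = tet n + tri n"
  using tet_sextuple[of n] tet_sextuple[of "n + 1"] tri_double[of n] by (simp add: algebra_simps)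

lemma cong_witness: "x = y + q * k \<Longrightarrow> [x = y] (mod q)" for x y q :: int
  by (simp add: cong_iff_dvd_diff)

section \<open>Exponent arithmetic\<close>

text \<open>
  For \<open>m = k + 1\<close> the constants are \<open>e = 2\<^bsup>m-1\<^esup>\<close>, \<open>\<lambda> = 2 e l\<close>, \<open>h = 2\<^bsup>2m-1\<^esup>\<close> and \<open>M = 2\<^bsup>3m-1\<^esup>\<close>. The
  hypothesis \<open>m > 1\<close> enters as the evenness of \<open>e\<close>: terms that are multiples of \<open>2 e\<^sup>4\<close> vanish
  modulo \<open>M = 4 e\<^sup>3\<close> for this reason.
\<close>

locale dyadic =
  fixes k :: nat and e l :: int
  assumes e_def: "e = 2 ^ k" and k_pos: "k \<ge> 1" and odd_l: "odd l"
begin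

abbreviation "\<alpha> \<equiv> 1 + 2 * e * l"
abbreviation "h \<equiv> 2 * e\<^sup>2"
abbreviation "M \<equiv> 4 * e ^ 3"

text \<open>
  \<open>E t\<close> is the binomial series of \<open>\<alpha>\<^bsup>-t\<^esup>\<close>; it stops after the quadratic term because \<open>M\<close>
  divides \<open>\<lambda>\<^sup>3\<close>. So \<open>C\<^sup>t A C\<^bsup>-t\<^esup> = A\<^bsup>E t\<^esup>\<close>. Likewise \<open>s n\<close> is the
  exponent of \<open>B\<close> in \<open>[A, B\<^sup>n] = B\<^bsup>s n\<^esup> C\<^sup>n\<close>.
\<close>

definition E :: "int \<Rightarrow> int" where
  "E t = 1 - 2 * e * l * t + 2 * e\<^sup>2 * l\<^sup>2 * (t * (t + 1))"

definition s :: "int \<Rightarrow> int" where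
  "s n = 2 * e * l * tri n + 4 * e\<^sup>2 * l\<^sup>2 * pyr n"

lemma e_pos: "e > 0" by (simp add: e_def)

lemma even_e: "even e" using k_pos by (simp add: e_def)

lemma power2_dvd_odd_mult: "odd u \<Longrightarrow> 2 ^ n dvd u * x \<longleftrightarrow> 2 ^ n dvd x" for u x :: int
  by (rule coprime_dvd_mult_right_iff) simp

text \<open>
  Of the denominator \<open>6\<close> of the pyramidal numbers only the factor \<open>2\<close> matters, as \<open>3\<close> is
  invertible modulo powers of \<open>2\<close>.
\<close>

lemma pyr_multiple: "e dvd x \<Longrightarrow> e dvd pyr (2 * x)"
proof -
  assume "e dvd x"
  have "6 * pyr (2 * x) = 2 * (x * (2 * x - 1) * (4 * x - 1))"
    unfolding pyr_sextuple by (simp add: algebra_simps)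
  then have "3 * pyr (2 * x) = x * (2 * x - 1) * (4 * x - 1)" by simp
  then have "e dvd 3 * pyr (2 * x)" using \<open>e dvd x\<close> by simp
  then show ?thesis unfolding e_def by (subst (asm) power2_dvd_odd_mult) auto
qed

lemma E_add: "[E x * E y = E (x + y)] (mod M)"
  by (rule cong_witness[where k = "-(l^3*x*y*(x+y+2)) + e*l^4*x*y*(x+1)*(y+1)"])
     (simp add: E_def algebra_simps power_numeral_reduce)

lemma E_0 [simp]: "E 0 = 1" by (simp add: E_def)

lemma E_period: "[E (t + h * u) = E t] (mod M)"
  by (rule cong_witness[where k = "- l*u + e*l^2*u*(2*t+1) + 2*e^3*l^2*u^2"])
     (simp add: E_def algebra_simps power_numeral_reduce)

lemma E_minus_1 [simp]: "E (- 1) = \<alpha>" by (simp add: E_def)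

text \<open>
  The recursion for \<open>s\<close> comes from \<open>[A, B\<^bsup>n+1\<^esup>] = [A, B\<^sup>n] (B\<^bsup>-n\<^esup> C B\<^sup>n)\<close>, where \<open>B\<^bsup>-n\<^esup> C B\<^sup>n = B\<^bsup>\<lambda>n\<^esup> C\<close>
  has to be moved past \<open>C\<^sup>n\<close>.
\<close>

lemma s_Suc: "[s (n + 1) = s n + E (- n) * (2 * e * l * n)] (mod M)"
  by (rule cong_witness[where k = "-(l^3*n^2*(n-1))"])
     (simp only: E_def s_def tri_Suc pyr_Suc, simp add: algebra_simps power_numeral_reduce)

text \<open>
  Moving \<open>A\<close> past \<open>B\<^bsup>s j\<^esup>\<close> produces a further power of \<open>B\<close> that lies in \<open>\<langle>B\<^sup>h\<rangle>\<close>, hence is central: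
  the process of moving \<open>A\<close> to the right stops after two rounds.
\<close>

lemma s_of_s: "[s (s j) = - h * l\<^sup>2 * tri j] (mod M)"
proof -
  define y where "y = tri j + 2 * e * l * pyr j"
  have sj: "s j = 2 * (e * l * y)" by (simp add: s_def y_def algebra_simps power_numeral_reduce)
  have "e dvd e * l * y" by simp
  then obtain \<tau> where \<tau>: "pyr (2 * (e * l * y)) = e * \<tau>" using pyr_multiple by blast
  have "2 * tri (2 * (e * l * y)) = 2 * (e * l * y * (2 * (e * l * y) - 1))"
    unfolding tri_double by (simp add: algebra_simps)
  then have t: "tri (2 * (e * l * y)) = e * l * y * (2 * (e * l * y) - 1)" by simp
  show ?thesis
    by (rule cong_witness[where k = "l^3*y^2 - l^3 * pyr j + l\<^sup>2 * \<tau>"])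
       (simp add: sj s_def[of "2 * (e * l * y)"] t \<tau>, simp add: y_def algebra_simps power_numeral_reduce)
qed

lemma e_twice: obtains f where "e = 2 * f"
  using even_e by blast

lemma tri_multiple: "tri (2 * x) = x * (2 * x - 1)"
  using tri_double[of "2 * x"] by simp

text \<open>
  A first order Taylor expansion: for a displacement by a multiple of \<open>2 e\<close> the higher terms
  carry a factor \<open>4 e\<^sup>3\<close>.
\<close>

lemma s_shift:
  "[s (j + 2 * e * d) = s j + 2 * e\<^sup>2 * l * (2 * j - 1) * d] (mod M)"
proof -
  have "e dvd e * d" by simp
  then obtain \<tau> where \<tau>: "pyr (2 * (e * d)) = e * \<tau>" using pyr_multiple by blast
  have sh: "j + 2 * e * d = j + 2 * (e * d)" by simp
  show ?thesis
    unfolding sh cong_iff_dvd_diff s_def tri_add pyr_add tri_multiple \<tau>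
    by algebra
qed

lemma s_mod_h: "[s (j + h * u) = s j + 2 * e ^ 3 * u] (mod M)"
proof -
  obtain g where g: "l = 2 * g + 1" using odd_l by (rule oddE)
  have "[s (j + 2 * e * (e * u)) = s j + 2 * e\<^sup>2 * l * (2 * j - 1) * (e * u)] (mod M)"
    by (rule s_shift)
  also have "[s j + 2 * e\<^sup>2 * l * (2 * j - 1) * (e * u) = s j + 2 * e ^ 3 * u] (mod M)"
    unfolding cong_iff_dvd_diff unfolding g by algebra
  finally show ?thesis by (simp add: power2_eq_square mult.assoc)
qed

lemma h_tri_shift:
  "[h * l\<^sup>2 * tri (j + 2 * e * d) = h * l\<^sup>2 * tri j - 2 * e ^ 3 * l\<^sup>2 * d] (mod M)"
proof -
  have sh: "j + 2 * e * d = j + 2 * (e * d)" by simp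
  show ?thesis unfolding sh cong_iff_dvd_diff tri_add tri_multiple by algebra
qed

lemma h_tri_mod_h: "[h * l\<^sup>2 * tri (j + h * u) = h * l\<^sup>2 * tri j] (mod M)"
proof -
  obtain f where f: "e = 2 * f" by (rule e_twice)
  have "[h * l\<^sup>2 * tri (j + 2 * e * (e * u)) = h * l\<^sup>2 * tri j - 2 * e ^ 3 * l\<^sup>2 * (e * u)] (mod M)"
    by (rule h_tri_shift)
  also have "[h * l\<^sup>2 * tri j - 2 * e ^ 3 * l\<^sup>2 * (e * u) = h * l\<^sup>2 * tri j] (mod M)"
    unfolding cong_iff_dvd_diff unfolding f by algebra
  finally show ?thesis by (simp add: power2_eq_square mult.assoc)
qed

lemma E_cong_h: "[t = t'] (mod h) \<Longrightarrow> [E t = E t'] (mod M)"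
  using E_period by (metis cong_iff_lin cong_sym)

lemma E_h: "[E t * (h * u) = h * u] (mod M)"
  unfolding cong_iff_dvd_diff E_def by algebra

section \<open>Closed forms for iterated left multiplication by A\<close>

text \<open>
  Left multiplication by \<open>A\<^sup>n\<close> turns \<open>B\<^sup>j\<close> into \<open>B\<^bsup>iter_j j n\<^esup> A\<^bsup>iter_i j n\<^esup> C\<^bsup>iter_t j n\<^esup>\<close>. The formulas
  result from summing the recursions below; they are meant modulo \<open>M\<close>, \<open>M\<close> and \<open>2 h\<close>. The terms
  with \<open>2 e\<^sup>3 = M / 2\<close> record parities only.
\<close>

definition iter_j :: "int \<Rightarrow> int \<Rightarrow> int" where
  "iter_j j n = j + 2 * e * l * tri j * n
     + 2 * e\<^sup>2 * l\<^sup>2 * (2 * pyr j * n + (2 * j - 1) * tri j * tri n)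
     - 2 * e ^ 3 * l ^ 3 * ((2 * j - 1) * tri j * tet n)"

definition iter_i :: "int \<Rightarrow> int \<Rightarrow> int" where
  "iter_i j n = n - 2 * e * l * j * tri n
     + 2 * e\<^sup>2 * l\<^sup>2 * (j\<^sup>2 * pyr n + j * tri n + tri j * n - 2 * tri j * (pyr n + tri n))
     - 2 * e ^ 3 * l ^ 3 * (tri j * tri n)"

definition iter_t :: "int \<Rightarrow> int \<Rightarrow> int" where
  "iter_t j n = j * n + 2 * e * l * tri j * tri (n + 1)
     + 2 * e\<^sup>2 * l\<^sup>2 * ((2 * j - 1) * tri j * tet (n + 1))"

lemma iter_j_step: "[iter_j j n + s (iter_j j n) = iter_j j (n + 1)] (mod M)"
proof -
  obtain f where f: "e = 2 * f" by (rule e_twice)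
  define D where "D = l * tri j * n
     + e * l\<^sup>2 * (2 * pyr j * n + (2 * j - 1) * tri j * tri n)
     - e\<^sup>2 * l ^ 3 * ((2 * j - 1) * tri j * tet n)"
  have iter_j: "iter_j j n = j + 2 * e * D" unfolding iter_j_def D_def by algebra
  have "[iter_j j n + s (iter_j j n) = iter_j j n + (s j + 2 * e\<^sup>2 * l * (2 * j - 1) * D)] (mod M)"
    unfolding iter_j by (intro cong_add cong_refl s_shift)
  also have "[iter_j j n + (s j + 2 * e\<^sup>2 * l * (2 * j - 1) * D) = iter_j j (n + 1)] (mod M)"
    unfolding cong_iff_dvd_diff iter_j_def D_def s_def tri_Suc tet_Suc unfolding f by algebra
  finally show ?thesis .
qed

lemma iter_t_step: "[iter_t j n + iter_j j (n + 1) = iter_t j (n + 1)] (mod 2 * h)"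
proof -
  obtain f where f: "e = 2 * f" by (rule e_twice)
  show ?thesis
    unfolding cong_iff_dvd_diff iter_j_def iter_t_def tri_Suc tet_Suc unfolding f by algebra
qed

text \<open>
  The recursion for the exponent of \<open>A\<close>: the old value is moved past \<open>C\<^bsup>w\<^esup>\<close> with
  \<open>w = iter_j j (n + 1)\<close>, where \<open>w\<close> matters only modulo \<open>h\<close>.
\<close>

lemma iter_i_step: "[1 + h * l\<^sup>2 * tri (iter_j j n) + E (iter_j j (n + 1)) * iter_i j n = iter_i j (n + 1)] (mod M)"
proof -
  obtain f where f: "e = 2 * f" by (rule e_twice)
  define D where "D = l * tri j * n
     + e * l\<^sup>2 * (2 * pyr j * n + (2 * j - 1) * tri j * tri n)
     - e\<^sup>2 * l ^ 3 * ((2 * j - 1) * tri j * tet n)"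
  have iter_j: "iter_j j n = j + 2 * e * D" unfolding iter_j_def D_def by algebra
  have E: "[E (iter_j j (n + 1)) = E (j + 2 * e * l * tri j * (n + 1))] (mod M)"
  proof (rule E_cong_h)
    show "[iter_j j (n + 1) = j + 2 * e * l * tri j * (n + 1)] (mod h)"
      unfolding cong_iff_dvd_diff iter_j_def by algebra
  qed
  have 1: "[h * l\<^sup>2 * tri (iter_j j n) = h * l\<^sup>2 * tri j - 2 * e ^ 3 * l\<^sup>2 * D] (mod M)"
    unfolding iter_j by (rule h_tri_shift)
  have 2: "[h * l\<^sup>2 * tri j - 2 * e ^ 3 * l\<^sup>2 * D = h * l\<^sup>2 * tri j - 2 * e ^ 3 * l ^ 3 * tri j * n] (mod M)"
    unfolding cong_iff_dvd_diff D_def unfolding f by algebra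
  define A where "A = l\<^sup>2 * (j\<^sup>2 * pyr n + j * tri n + tri j * n - 2 * tri j * (pyr n + tri n))
     - e * l ^ 3 * (tri j * tri n)"
  define B where "B = l\<^sup>2 * (j\<^sup>2 + j) - 2 * l\<^sup>2 * tri j * (n + 1)"
  have iter_i: "iter_i j n = n - 2 * e * l * j * tri n + 2 * e\<^sup>2 * A"
    unfolding iter_i_def A_def by algebra
  have n: "n + 2 * tri n - n\<^sup>2 = 0" unfolding tri_double by algebra
  have "[1 + h * l\<^sup>2 * tri (iter_j j n) + E (iter_j j (n + 1)) * iter_i j n
      = 1 + (h * l\<^sup>2 * tri j - 2 * e ^ 3 * l ^ 3 * tri j * n)
        + E (j + 2 * e * l * tri j * (n + 1)) * iter_i j n] (mod M)"
    by (intro cong_add cong_mult cong_refl E cong_trans[OF 1 2])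
  also have "[1 + (h * l\<^sup>2 * tri j - 2 * e ^ 3 * l ^ 3 * tri j * n)
        + E (j + 2 * e * l * tri j * (n + 1)) * iter_i j n = 1 + (h * l\<^sup>2 * tri j - 2 * e ^ 3 * l ^ 3 * tri j * n)
        + (n - 2 * e * l * j * tri n + 2 * e\<^sup>2 * A - 2 * e * l * j * n
           + 4 * e\<^sup>2 * l\<^sup>2 * j\<^sup>2 * tri n + 2 * e\<^sup>2 * B * n)] (mod M)"
  proof (intro cong_add cong_refl)
    have "[E (j + 2 * e * l * tri j * (n + 1)) = 1 - 2 * e * l * j + 2 * e\<^sup>2 * B] (mod M)"
      unfolding cong_iff_dvd_diff E_def B_def by algebra
    then have "[E (j + 2 * e * l * tri j * (n + 1)) * iter_i j n
        = (1 - 2 * e * l * j + 2 * e\<^sup>2 * B) * (n - 2 * e * l * j * tri n + 2 * e\<^sup>2 * A)] (mod M)"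
      unfolding iter_i by (intro cong_mult cong_refl)
    also have "[(1 - 2 * e * l * j + 2 * e\<^sup>2 * B) * (n - 2 * e * l * j * tri n + 2 * e\<^sup>2 * A)
      = n - 2 * e * l * j * tri n + 2 * e\<^sup>2 * A - 2 * e * l * j * n
           + 4 * e\<^sup>2 * l\<^sup>2 * j\<^sup>2 * tri n + 2 * e\<^sup>2 * B * n] (mod M)"
      unfolding cong_iff_dvd_diff by algebra
    finally show "[E (j + 2 * e * l * tri j * (n + 1)) * iter_i j n
      = n - 2 * e * l * j * tri n + 2 * e\<^sup>2 * A - 2 * e * l * j * n
           + 4 * e\<^sup>2 * l\<^sup>2 * j\<^sup>2 * tri n + 2 * e\<^sup>2 * B * n] (mod M)" .
  qed
  also have "1 + (h * l\<^sup>2 * tri j - 2 * e ^ 3 * l ^ 3 * tri j * n)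
        + (n - 2 * e * l * j * tri n + 2 * e\<^sup>2 * A - 2 * e * l * j * n
           + 4 * e\<^sup>2 * l\<^sup>2 * j\<^sup>2 * tri n + 2 * e\<^sup>2 * B * n)
     = iter_i j (n + 1) + 2 * e\<^sup>2 * l\<^sup>2 * j\<^sup>2 * (n + 2 * tri n - n\<^sup>2)"
    unfolding iter_i_def A_def B_def tri_Suc pyr_Suc by algebra
  finally show ?thesis unfolding n by simp
qed

section \<open>Left multiplication on exponent triples\<close>

text \<open>
  The triple \<open>(j, i, t)\<close> stands for \<open>B\<^sup>j A\<^sup>i C\<^sup>t\<close>. Because of \<open>B\<^sup>h = A\<^bsup>-h\<^esup>\<close> and \<open>C\<^sup>h = A\<^bsup>M/2\<^esup>\<close> the triples
  \<open>(j, i, t)\<close>, \<open>(j + h, i + h, t)\<close> and \<open>(j, i + M/2, t + h)\<close> denote the same element. As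
  \<open>M/2 = e h\<close>, the residues in \<open>cls\<close> form a complete set of invariants for this equivalence.
\<close>

definition cls :: "int \<times> int \<times> int \<Rightarrow> int \<times> int \<times> int" where
  "cls = (\<lambda>(j, i, t). (j mod h, (i - j - e * t) mod M, t mod h))"

text \<open>
  The effect of left multiplication by \<open>A\<close>, \<open>B\<close> and \<open>C\<close> on the exponents of \<open>B\<^sup>j A\<^sup>i C\<^sup>t\<close>.
\<close>

definition step_a :: "int \<times> int \<times> int \<Rightarrow> int \<times> int \<times> int" where
  "step_a = (\<lambda>(j, i, t). (j + s j, 1 + h * l\<^sup>2 * tri j + E (j + s j) * i, t + (j + s j)))"

definition step_b :: "int \<times> int \<times> int \<Rightarrow> int \<times> int \<times> int" where
  "step_b = (\<lambda>(j, i, t). (j + 1, i, t))"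

definition step_c :: "int \<times> int \<times> int \<Rightarrow> int \<times> int \<times> int" where
  "step_c = (\<lambda>(j, i, t). (\<alpha> * j, E 1 * i, t + 1))"

lemma cls_eq_iff:
  "cls (j, i, t) = cls (j', i', t') \<longleftrightarrow>
     [j = j'] (mod h) \<and> [i - j - e * t = i' - j' - e * t'] (mod M) \<and> [t = t'] (mod h)"
  by (simp add: cls_def cong_def)

lemma h_dvd: "h dvd M" "h dvd 2 * h" by (simp_all add: power_numeral_reduce)

lemma cong_M_h: "[x = y] (mod M) \<Longrightarrow> [x = y] (mod h)"
  by (rule cong_dvd_modulus[OF _ h_dvd(1)])

lemma cong_2h_h: "[x = y] (mod 2 * h) \<Longrightarrow> [x = y] (mod h)"
  by (rule cong_dvd_modulus[OF _ h_dvd(2)])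

lemma cong_e_mult: "[t = t'] (mod 2 * h) \<Longrightarrow> [e * t = e * t'] (mod M)"
proof -
  assume "[t = t'] (mod 2 * h)"
  then obtain q where q: "t' = t + 2 * h * q" unfolding cong_iff_lin by auto
  show ?thesis by (rule cong_witness[where k = "- q"]) (use q in algebra)
qed

text \<open>
  A convenient sufficient condition; modulus \<open>2 h\<close> for \<open>t\<close> corresponds to \<open>C\<^bsup>2h\<^esup> = A\<^sup>M = 1\<close>.
\<close>

lemma cls_eqI:
  assumes "[j = j'] (mod M)" "[i = i'] (mod M)" "[t = t'] (mod 2 * h)"
  shows "cls (j, i, t) = cls (j', i', t')"
  unfolding cls_eq_iff
proof (intro conjI)
  show "[j = j'] (mod h)" using assms(1) by (rule cong_M_h)
  show "[i - j - e * t = i' - j' - e * t'] (mod M)"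
    using assms by (intro cong_diff cong_e_mult)
  show "[t = t'] (mod h)" using assms(3) by (rule cong_2h_h)
qed

lemma cls_eqE:
  assumes "cls (j, i, t) = cls (j', i', t')"
  obtains u v where "j' = j + h * u" "t' = t + h * v" "[i' = i + h * u + 2 * e ^ 3 * v] (mod M)"
proof -
  from assms have 1: "[j = j'] (mod h)" and 2: "[i - j - e * t = i' - j' - e * t'] (mod M)" and 3: "[t = t'] (mod h)"
    by (auto simp: cls_eq_iff)
  obtain u where u: "j' = j + h * u" using 1 by (auto simp: cong_iff_lin)
  obtain v where v: "t' = t + h * v" using 3 by (auto simp: cong_iff_lin)
  obtain q where q: "i' - j' - e * t' = i - j - e * t + M * q" using 2 by (auto simp: cong_iff_lin)
  have "[i' = i + h * u + 2 * e ^ 3 * v] (mod M)"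
    by (rule cong_witness[where k = q]) (use u v q in algebra)
  with u v show ?thesis by (rule that)
qed

lemma cls_shift:
  assumes "[i' = i + h * u + 2 * e ^ 3 * v] (mod M)"
  shows "cls (j, i, t) = cls (j + h * u, i', t + h * v)"
proof -
  obtain q where q: "i' = i + h * u + 2 * e ^ 3 * v + M * q"
    using cong_sym[OF assms] unfolding cong_iff_lin by auto
  have "[i - j - e * t = i' - (j + h * u) - e * (t + h * v)] (mod M)"
    by (rule cong_witness[where k = "- q"]) (use q in algebra)
  then show ?thesis by (simp add: cls_eq_iff cong_def)
qed

lemma step_b_cong: "cls x = cls y \<Longrightarrow> cls (step_b x) = cls (step_b y)"
proof -
  assume "cls x = cls y"
  obtain j i t where x: "x = (j, i, t)" by (cases x)
  obtain j' i' t' where y: "y = (j', i', t')" by (cases y)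
  from \<open>cls x = cls y\<close> obtain u v where "j' = j + h * u" "t' = t + h * v" "[i' = i + h * u + 2 * e ^ 3 * v] (mod M)"
    unfolding x y by (rule cls_eqE)
  then show ?thesis using cls_shift[of i' i u v "j + 1" t] by (simp add: x y step_b_def ac_simps)
qed

lemma step_c_cong: "cls x = cls y \<Longrightarrow> cls (step_c x) = cls (step_c y)"
proof -
  assume "cls x = cls y"
  obtain j i t where x: "x = (j, i, t)" by (cases x)
  obtain j' i' t' where y: "y = (j', i', t')" by (cases y)
  from \<open>cls x = cls y\<close> obtain u v where u: "j' = j + h * u" and v: "t' = t + h * v"
    and i: "[i' = i + h * u + 2 * e ^ 3 * v] (mod M)"
    unfolding x y by (rule cls_eqE)
  have "[E 1 * i' = E 1 * (i + h * u + 2 * e ^ 3 * v)] (mod M)" using i by (intro cong_mult cong_refl)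
  also have "[E 1 * (i + h * u + 2 * e ^ 3 * v) = E 1 * i + h * (\<alpha> * u) + 2 * e ^ 3 * v] (mod M)"
    unfolding cong_iff_dvd_diff E_def by algebra
  finally have "cls (\<alpha> * j, E 1 * i, t + 1) = cls (\<alpha> * j + h * (\<alpha> * u), E 1 * i', t + 1 + h * v)"
    by (rule cls_shift)
  also have "\<alpha> * j + h * (\<alpha> * u) = \<alpha> * j'" unfolding u by algebra
  also have "t + 1 + h * v = t' + 1" unfolding v by simp
  finally show ?thesis by (simp add: x y step_c_def)
qed

text \<open>
  Replacing \<open>j\<close> by \<open>j + h u\<close> changes \<open>j + s j\<close> by \<open>h u + (M/2) u = h (1 + e) u\<close>. This moves the
  exponents of \<open>B\<close> and of \<open>C\<close> at once, and the two resulting corrections by \<open>(M/2) u\<close> cancel.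
\<close>

lemma step_a_cong: "cls x = cls y \<Longrightarrow> cls (step_a x) = cls (step_a y)"
proof -
  assume "cls x = cls y"
  obtain j i t where x: "x = (j, i, t)" by (cases x)
  obtain j' i' t' where y: "y = (j', i', t')" by (cases y)
  obtain f where f: "e = 2 * f" by (rule e_twice)
  from \<open>cls x = cls y\<close> obtain u v where u: "j' = j + h * u" and v: "t' = t + h * v"
    and i: "[i' = i + h * u + 2 * e ^ 3 * v] (mod M)"
    unfolding x y by (rule cls_eqE)
  obtain z where z: "s j' = s j + 2 * e ^ 3 * u + M * z"
    using cong_sym[OF s_mod_h[of j u]] unfolding u cong_iff_lin by auto
  (* the new exponents of b and c exceed the old ones by h d and h (v + d) *)
  define d where "d = u + e * u + 2 * e * z"
  have w: "j' + s j' = j + s j + h * d"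
    unfolding z unfolding u d_def by algebra
  have "[1 + h * l\<^sup>2 * tri j' + E (j' + s j') * i'
      = 1 + h * l\<^sup>2 * tri j + E (j + s j) * (i + h * (u + e * v))] (mod M)"
  proof -
    have 1: "[h * l\<^sup>2 * tri j' = h * l\<^sup>2 * tri j] (mod M)" unfolding u by (rule h_tri_mod_h)
    have 2: "[E (j' + s j') = E (j + s j)] (mod M)" unfolding w by (rule E_period)
    have "i + h * u + 2 * e ^ 3 * v = i + h * (u + e * v)" by algebra
    from i[unfolded add.assoc, folded add.assoc, unfolded this]
    have 3: "[i' = i + h * (u + e * v)] (mod M)" .
    show ?thesis by (rule cong_add[OF cong_add[OF cong_refl 1] cong_mult[OF 2 3]])
  qed
  also have "[1 + h * l\<^sup>2 * tri j + E (j + s j) * (i + h * (u + e * v))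
     = 1 + h * l\<^sup>2 * tri j + (E (j + s j) * i + h * (u + e * v))] (mod M)"
    unfolding distrib_left[of "E (j + s j)"] by (intro cong_add cong_refl E_h)
  also have "[1 + h * l\<^sup>2 * tri j + (E (j + s j) * i + h * (u + e * v))
     = 1 + h * l\<^sup>2 * tri j + E (j + s j) * i + h * d + 2 * e ^ 3 * (v + d)] (mod M)"
    unfolding cong_iff_dvd_diff d_def f by algebra
  finally have "cls (j + s j, 1 + h * l\<^sup>2 * tri j + E (j + s j) * i, t + (j + s j))
    = cls (j + s j + h * d, 1 + h * l\<^sup>2 * tri j' + E (j' + s j') * i', t + (j + s j) + h * (v + d))"
    by (rule cls_shift)
  also have "t + (j + s j) + h * (v + d) = t' + (j' + s j')" unfolding w v by algebra
  finally show ?thesis by (simp add: x y step_a_def w)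
qed

lemma step_c_step_b: 
  assumes "[int n = \<alpha>] (mod M)"
  shows "cls ((step_b ^^ n) (step_c x)) = cls (step_c (step_b x))"
proof -
  obtain j i t where x: "x = (j, i, t)" by (cases x)
  have pow: "(step_b ^^ n) (j, i, t) = (j + int n, i, t)" for j i t
    by (induction n) (auto simp: step_b_def)
  have "[\<alpha> * j + int n = \<alpha> * j + \<alpha>] (mod M)" using assms by (intro cong_add cong_refl)
  then have "cls (\<alpha> * j + int n, E 1 * i, t + 1) = cls (\<alpha> * j + \<alpha>, E 1 * i, t + 1)"
    by (intro cls_eqI cong_refl)
  then show ?thesis by (simp add: x step_c_def pow) (simp add: step_b_def distrib_left)
qed

lemma step_b_period:
  assumes "[int n = 0] (mod M)"
  shows "cls ((step_b ^^ n) x) = cls x"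
proof -
  obtain j i t where x: "x = (j, i, t)" by (cases x)
  have pow: "(step_b ^^ n) (j, i, t) = (j + int n, i, t)" for j i t
    by (induction n) (auto simp: step_b_def)
  have "[j + int n = j + 0] (mod M)" using assms by (intro cong_add cong_refl)
  then show ?thesis unfolding x pow by (intro cls_eqI cong_refl) simp
qed

lemma E_mult_mod: "[t = t'] (mod h) \<Longrightarrow> [E t * i = E t' * i] (mod M)"
  by (intro cong_mult cong_refl E_cong_h)

lemma step_a_iterate:
  fixes n :: nat
  shows
  "cls ((step_a ^^ n) (j, i, t)) = cls (iter_j j (int n), iter_i j (int n) + E (iter_t j (int n)) * i, t + iter_t j (int n))"
proof (induction n)
  case 0
  have "iter_t j 0 = 0" by (simp add: iter_t_def)
  moreover have "iter_j j 0 = j" "iter_i j 0 = 0" by (simp_all add: iter_j_def iter_i_def)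
  ultimately show ?case by simp
next
  case (Suc n)
  have iter_j: "[iter_j j (int n) + s (iter_j j (int n)) = iter_j j (int n + 1)] (mod M)" by (rule iter_j_step)
  have E: "[E (iter_j j (int n) + s (iter_j j (int n))) = E (iter_j j (int n + 1))] (mod M)"
    by (rule E_cong_h[OF cong_M_h[OF iter_j]])
  have W2: "[iter_j j (int n) + s (iter_j j (int n)) = iter_j j (int n + 1)] (mod 2 * h)"
    by (rule cong_dvd_modulus[OF iter_j]) (simp add: power_numeral_reduce)
  have "cls ((step_a ^^ Suc n) (j, i, t)) = cls (step_a (iter_j j (int n), iter_i j (int n) + E (iter_t j (int n)) * i, t + iter_t j (int n)))"
    using step_a_cong[OF Suc.IH] by simp
  also have "\<dots> = cls (iter_j j (int n) + s (iter_j j (int n)),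
       1 + h * l\<^sup>2 * tri (iter_j j (int n)) + E (iter_j j (int n) + s (iter_j j (int n))) * (iter_i j (int n) + E (iter_t j (int n)) * i),
       t + iter_t j (int n) + (iter_j j (int n) + s (iter_j j (int n))))"
    by (simp add: step_a_def)
  also have "\<dots> = cls (iter_j j (int n + 1), iter_i j (int n + 1) + E (iter_t j (int n + 1)) * i, t + iter_t j (int n + 1))"
  proof (rule cls_eqI)
    have "[iter_t j (int n) + (iter_j j (int n) + s (iter_j j (int n))) = iter_t j (int n) + iter_j j (int n + 1)] (mod 2 * h)"
      using W2 by (intro cong_add cong_refl)
    also have "[iter_t j (int n) + iter_j j (int n + 1) = iter_t j (int n + 1)] (mod 2 * h)" by (rule iter_t_step)
    finally have iter_t: "[iter_t j (int n) + (iter_j j (int n) + s (iter_j j (int n))) = iter_t j (int n + 1)] (mod 2 * h)" .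
    then show "[t + iter_t j (int n) + (iter_j j (int n) + s (iter_j j (int n))) = t + iter_t j (int n + 1)] (mod 2 * h)"
      using cong_add[OF cong_refl[of t] iter_t] by (simp add: add.assoc)
    have 1: "[E (iter_j j (int n) + s (iter_j j (int n))) * E (iter_t j (int n)) = E (iter_t j (int n + 1))] (mod M)"
    proof -
      have "[E (iter_j j (int n) + s (iter_j j (int n))) * E (iter_t j (int n)) = E (iter_j j (int n) + s (iter_j j (int n)) + iter_t j (int n))] (mod M)"
        by (rule E_add)
      also have "[E (iter_j j (int n) + s (iter_j j (int n)) + iter_t j (int n)) = E (iter_t j (int n + 1))] (mod M)"
        by (rule E_cong_h[OF cong_2h_h]) (use iter_t in \<open>simp add: add.commute\<close>)
      finally show ?thesis .
    qed
    have "[1 + h * l\<^sup>2 * tri (iter_j j (int n)) + E (iter_j j (int n) + s (iter_j j (int n))) * iter_i j (int n)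
        = 1 + h * l\<^sup>2 * tri (iter_j j (int n)) + E (iter_j j (int n + 1)) * iter_i j (int n)] (mod M)"
      by (intro cong_add cong_mult cong_refl E)
    also have "[1 + h * l\<^sup>2 * tri (iter_j j (int n)) + E (iter_j j (int n + 1)) * iter_i j (int n) = iter_i j (int n + 1)] (mod M)"
      by (rule iter_i_step)
    finally have 2: "[1 + h * l\<^sup>2 * tri (iter_j j (int n)) + E (iter_j j (int n) + s (iter_j j (int n))) * iter_i j (int n) = iter_i j (int n + 1)] (mod M)" .
    show "[1 + h * l\<^sup>2 * tri (iter_j j (int n)) + E (iter_j j (int n) + s (iter_j j (int n))) * (iter_i j (int n) + E (iter_t j (int n)) * i)
       = iter_i j (int n + 1) + E (iter_t j (int n + 1)) * i] (mod M)"
      using cong_add[OF 2 cong_mult[OF 1 cong_refl[of i]]] by (simp add: algebra_simps)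
  qed (rule iter_j)
  finally show ?case by (simp add: add.commute)
qed

text \<open>
  The relation \<open>A B = B A C\<close>. Both sides agree up to the shift of the exponents of \<open>B\<close> and \<open>C\<close> by
  the multiple \<open>h d\<close> of \<open>h\<close> named in the proof.
\<close>

lemma step_a_step_b: "cls (step_b (step_a (step_c x))) = cls (step_a (step_b x))"
proof -
  obtain j i t where x: "x = (j, i, t)" by (cases x)
  obtain g where g: "l = 2 * g + 1" using odd_l by (rule oddE)
  have \<alpha>j: "\<alpha> * j = j + 2 * e * (l * j)" by algebra
  have "[s (\<alpha> * j) = s j + 2 * e\<^sup>2 * l * (2 * j - 1) * (l * j)] (mod M)"
    unfolding \<alpha>j by (rule s_shift)
  then obtain z where z: "s j + 2 * e\<^sup>2 * l * (2 * j - 1) * (l * j) = s (\<alpha> * j) + M * z"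
    unfolding cong_iff_lin by auto
  define w where "w = \<alpha> * j + s (\<alpha> * j)"
  (* z is the quotient left over by the congruence for s; M z = h (2 e z) is absorbed into the shift *)
  define d where "d = l\<^sup>2 * j + 2 * e * z"
  have w: "j + 1 + s (j + 1) = w + 1 + h * d"
    using z unfolding w_def d_def s_def tri_Suc pyr_Suc by algebra
  have "[h * l\<^sup>2 * tri (\<alpha> * j) = h * l\<^sup>2 * tri j - 2 * e ^ 3 * l\<^sup>2 * (l * j)] (mod M)"
    unfolding \<alpha>j by (rule h_tri_shift)
  then obtain y where y: "h * l\<^sup>2 * tri j - 2 * e ^ 3 * l\<^sup>2 * (l * j) = h * l\<^sup>2 * tri (\<alpha> * j) + M * y"
    unfolding cong_iff_lin by auto
  have Ew: "[E (w + 1 + h * d) = E w * E 1] (mod M)"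
    using cong_trans[OF E_period[of "w + 1" d] cong_sym[OF E_add[of w 1]]] .
  have "[1 + h * l\<^sup>2 * tri (j + 1) + E (w + 1 + h * d) * i
       = 1 + h * l\<^sup>2 * tri (j + 1) + E w * E 1 * i] (mod M)"
    by (intro cong_add cong_mult cong_refl Ew)
  also have "[1 + h * l\<^sup>2 * tri (j + 1) + E w * E 1 * i
      = 1 + h * l\<^sup>2 * tri (\<alpha> * j) + E w * (E 1 * i) + h * d + 2 * e ^ 3 * d] (mod M)"
  proof (rule cong_witness)
    show "1 + h * l\<^sup>2 * tri (j + 1) + E w * E 1 * i
      = 1 + h * l\<^sup>2 * tri (\<alpha> * j) + E w * (E 1 * i) + h * d + 2 * e ^ 3 * d
       + M * (y + g * (l\<^sup>2 * j) - z - e * z)"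
      using y unfolding tri_Suc d_def g by algebra
  qed
  finally have "cls (w + 1, 1 + h * l\<^sup>2 * tri (\<alpha> * j) + E w * (E 1 * i), t + 1 + w)
    = cls (w + 1 + h * d, 1 + h * l\<^sup>2 * tri (j + 1) + E (w + 1 + h * d) * i, t + 1 + w + h * d)"
    by (rule cls_shift)
  moreover have "step_b (step_a (step_c x)) = (w + 1, 1 + h * l\<^sup>2 * tri (\<alpha> * j) + E w * (E 1 * i), t + 1 + w)"
    by (simp add: x step_a_def step_b_def step_c_def w_def)
  moreover have "step_a (step_b x) = (w + 1 + h * d, 1 + h * l\<^sup>2 * tri (j + 1) + E (w + 1 + h * d) * i, t + 1 + w + h * d)"
    by (simp only: x step_a_def step_b_def prod.case w) (simp add: ac_simps)
  ultimately show ?thesis by simp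
qed

text \<open>
  For \<open>n\<close> congruent to \<open>\<alpha>\<close> the coefficient \<open>tet n\<close> is a multiple of \<open>e\<close>, hence even; this kills
  all cubic terms in the closed forms.
\<close>

lemma tri_tet_alpha:
  assumes n: "n = 1 + 2 * e * L"
  obtains \<tau> where "tri n = e * L * (1 + 2 * e * L)" "tet n = e * \<tau>"
proof -
  have "2 * tri n = 2 * (e * L * (1 + 2 * e * L))" unfolding tri_double n by algebra
  then have t: "tri n = e * L * (1 + 2 * e * L)" by simp
  have "6 * tet n = 2 * (tri n * (n - 2))" using tri_double[of n] unfolding tet_sextuple by algebra
  then have "3 * tet n = e * (L * (1 + 2 * e * L) * (n - 2))" unfolding t by simp
  then have "e dvd 3 * tet n" by simp
  then have "e dvd tet n" unfolding e_def by (subst (asm) power2_dvd_odd_mult) auto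
  with t that show ?thesis by blast
qed

lemma iter_j_alpha:
  assumes "n = 1 + 2 * e * L" "L = l + h * z"
  shows "[iter_j j n = j + 2 * e * l * tri j + 4 * e\<^sup>2 * l\<^sup>2 * tri j + 4 * e\<^sup>2 * l\<^sup>2 * pyr j
     + 2 * e ^ 3 * l ^ 3 * tri j * (2 * j - 1)] (mod M)"
proof -
  obtain f where f: "e = 2 * f" by (rule e_twice)
  obtain \<tau> where t: "tri n = e * L * (1 + 2 * e * L)" "tet n = e * \<tau>" using tri_tet_alpha[OF assms(1)] .
  show ?thesis unfolding cong_iff_dvd_diff iter_j_def t unfolding assms f by algebra
qed

lemma iter_t_alpha:
  assumes "n = 1 + 2 * e * L" "L = l + h * z"
  shows "[iter_t j n = (1 + 2 * e * l) * j + 2 * e * l * tri j * (1 + 3 * e * l)] (mod 2 * h)"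
proof -
  obtain f where f: "e = 2 * f" by (rule e_twice)
  obtain \<tau> where t: "tri n = e * L * (1 + 2 * e * L)" "tet n = e * \<tau>" using tri_tet_alpha[OF assms(1)] .
  show ?thesis unfolding cong_iff_dvd_diff iter_t_def tri_Suc tet_Suc t unfolding assms f by algebra
qed

lemma iter_i_alpha:
  assumes "n = 1 + 2 * e * L" "L = l + h * z"
  shows "[iter_i j n = 1 + 2 * e * l - 2 * e\<^sup>2 * l\<^sup>2 * j + 2 * e\<^sup>2 * l\<^sup>2 * tri j] (mod M)"
proof -
  obtain f where f: "e = 2 * f" by (rule e_twice)
  obtain \<tau> where t: "tri n = e * L * (1 + 2 * e * L)" "tet n = e * \<tau>" using tri_tet_alpha[OF assms(1)] .
  have j: "j\<^sup>2 = 2 * tri j + j" unfolding tri_double by algebra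
  show ?thesis unfolding cong_iff_dvd_diff iter_i_def pyr_def t unfolding j assms f by algebra
qed

text \<open>
  The relation \<open>A\<^sup>M = 1\<close>: at multiples \<open>n\<close> of \<open>M\<close> the closed forms are trivial, because \<open>2 e\<^sup>3\<close>
  divides \<open>tri n\<close> and \<open>e\<close> divides \<open>tet n\<close>.
\<close>

lemma step_a_period:
  assumes "[int n = 0] (mod M)"
  shows "cls ((step_a ^^ n) x) = cls x"
proof -
  obtain j i t where x: "x = (j, i, t)" by (cases x)
  obtain f where f: "e = 2 * f" by (rule e_twice)
  obtain z where n: "int n = M * z" using assms by (auto simp: cong_0_iff)
  have "2 * tri (int n) = 2 * (2 * e ^ 3 * z * (int n - 1))" unfolding tri_double unfolding n by algebra
  then have t: "tri (int n) = 2 * e ^ 3 * z * (int n - 1)" by simp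
  have "6 * tet (int n) = 2 * (tri (int n) * (int n - 2))"
    using tri_double[of "int n"] unfolding tet_sextuple by algebra
  then have "3 * tet (int n) = e * (2 * e\<^sup>2 * z * (int n - 1) * (int n - 2))" unfolding t by algebra
  then have "e dvd 3 * tet (int n)" by simp
  then have "e dvd tet (int n)" unfolding e_def by (subst (asm) power2_dvd_odd_mult) auto
  then obtain \<tau> where \<tau>: "tet (int n) = e * \<tau>" by blast
  have iter_j: "[iter_j j (int n) = j] (mod M)"
    unfolding cong_iff_dvd_diff iter_j_def t \<tau> unfolding n f by algebra
  have iter_i: "[iter_i j (int n) = 0] (mod M)"
    unfolding cong_iff_dvd_diff iter_i_def pyr_def t \<tau> unfolding n f by algebra
  have iter_t: "[iter_t j (int n) = 0] (mod 2 * h)"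
    unfolding cong_iff_dvd_diff iter_t_def tri_Suc tet_Suc t \<tau> unfolding n f by algebra
  have E: "[E (iter_t j (int n)) = 1] (mod M)"
    using E_cong_h[OF cong_2h_h[OF iter_t]] by simp
  have "cls ((step_a ^^ n) x) = cls (iter_j j (int n), iter_i j (int n) + E (iter_t j (int n)) * i, t + iter_t j (int n))"
    unfolding x by (rule step_a_iterate)
  also have "\<dots> = cls (j, 0 + 1 * i, t + 0)"
    using iter_j iter_i iter_t E by (intro cls_eqI cong_add cong_mult cong_refl)
  finally show ?thesis by (simp add: x)
qed

text \<open>
  The relation \<open>A C = C A\<^sup>\<alpha>\<close>, with \<open>\<alpha>\<close> replaced by a natural number \<open>n\<close> congruent to it, since
  \<open>\<alpha>\<close> may be negative. The closed forms at \<open>n\<close> reduce to the polynomials \<open>W0\<close>, \<open>I0\<close>, \<open>T0\<close>. The two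
  sides differ by shifts of the exponents of \<open>B\<close> and \<open>C\<close> by multiples of \<open>h\<close>, and the invariant
  \<open>i - j - e t\<close> of the two sides agrees because \<open>j\<^sup>2 - j = 2 tri j\<close> and \<open>l\<close> is odd.
\<close>

lemma step_a_step_c:
  assumes n: "[int n = \<alpha>] (mod M)"
  shows "cls (step_c ((step_a ^^ n) x)) = cls (step_a (step_c x))"
proof -
  obtain j i t where x: "x = (j, i, t)" by (cases x)
  obtain g where g: "l = 2 * g + 1" using odd_l by (rule oddE)
  obtain z where z: "int n = \<alpha> + M * z" using cong_sym[OF n] unfolding cong_iff_lin by auto
  define L where "L = l + h * z"
  have nL: "int n = 1 + 2 * e * L" unfolding z L_def by algebra
  note nL = nL L_def
  define W0 where "W0 = j + 2 * e * l * tri j + 4 * e\<^sup>2 * l\<^sup>2 * tri j + 4 * e\<^sup>2 * l\<^sup>2 * pyr j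
     + 2 * e ^ 3 * l ^ 3 * tri j * (2 * j - 1)"
  define T0 where "T0 = (1 + 2 * e * l) * j + 2 * e * l * tri j * (1 + 3 * e * l)"
  define I0 where "I0 = 1 + 2 * e * l - 2 * e\<^sup>2 * l\<^sup>2 * j + 2 * e\<^sup>2 * l\<^sup>2 * tri j"
  define w0 where "w0 = \<alpha> * j + s j + 2 * e\<^sup>2 * l * (2 * j - 1) * (l * j)"
  have iter_j: "[iter_j j (int n) = W0] (mod M)" unfolding W0_def by (rule iter_j_alpha[OF nL])
  have iter_t: "[iter_t j (int n) = T0] (mod 2 * h)" unfolding T0_def by (rule iter_t_alpha[OF nL])
  have iter_i: "[iter_i j (int n) = I0] (mod M)" unfolding I0_def by (rule iter_i_alpha[OF nL])
  have "[s (j + 2 * e * (l * j)) = s j + 2 * e\<^sup>2 * l * (2 * j - 1) * (l * j)] (mod M)"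
    by (rule s_shift)
  moreover have \<alpha>j: "\<alpha> * j = j + 2 * e * (l * j)" by algebra
  ultimately have "[s (\<alpha> * j) = s j + 2 * e\<^sup>2 * l * (2 * j - 1) * (l * j)] (mod M)" by simp
  then have w: "[\<alpha> * j + s (\<alpha> * j) = w0] (mod M)"
    using cong_add[OF cong_refl[of "\<alpha> * j"]] unfolding w0_def add.assoc by blast
  have p: "[h * l\<^sup>2 * tri (\<alpha> * j) = h * l\<^sup>2 * tri j - 2 * e ^ 3 * l\<^sup>2 * (l * j)] (mod M)"
    unfolding \<alpha>j by (rule h_tri_shift)
  have T0w0: "[T0 = w0] (mod h)"
    unfolding cong_iff_dvd_diff T0_def w0_def s_def by algebra
  have "cls (step_c ((step_a ^^ n) x)) = cls (step_c (iter_j j (int n), iter_i j (int n) + E (iter_t j (int n)) * i, t + iter_t j (int n)))"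
    unfolding x by (rule step_c_cong[OF step_a_iterate])
  also have "\<dots> = cls (step_c (W0, I0 + E T0 * i, t + T0))"
    using iter_j iter_i iter_t E_cong_h[OF cong_2h_h[OF iter_t]]
    by (intro step_c_cong cls_eqI cong_add cong_mult cong_refl)
  also have "\<dots> = cls (\<alpha> * W0, E 1 * (I0 + E T0 * i), t + T0 + 1)" by (simp add: step_c_def)
  also have "\<dots> = cls (w0, 1 + (h * l\<^sup>2 * tri j - 2 * e ^ 3 * l\<^sup>2 * (l * j)) + E w0 * (E 1 * i), t + 1 + w0)"
  proof (unfold cls_eq_iff, intro conjI)
    show "[\<alpha> * W0 = w0] (mod h)"
      unfolding cong_iff_dvd_diff W0_def w0_def s_def by algebra
    have "[t + 1 + T0 = t + 1 + w0] (mod h)" using T0w0 by (intro cong_add cong_refl)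
    then show "[t + T0 + 1 = t + 1 + w0] (mod h)" by (simp add: ac_simps)
    have j: "j\<^sup>2 = 2 * tri j + j" unfolding tri_double by algebra
    have EE: "[E T0 * (E 1 * i) = E w0 * (E 1 * i)] (mod M)" by (rule E_mult_mod[OF T0w0])
    have "[E 1 * I0 - \<alpha> * W0 - e * T0
        = 1 + (h * l\<^sup>2 * tri j - 2 * e ^ 3 * l\<^sup>2 * (l * j)) - w0 - e * w0
          + 4 * e\<^sup>2 * l\<^sup>2 * (j\<^sup>2 - j - 2 * tri j)] (mod M)"
    proof -
      define R where "R = (1 + 2 * e * l) * j + 2 * e * l * tri j + 8 * e\<^sup>2 * l\<^sup>2 * tri j
        + 4 * e\<^sup>2 * l\<^sup>2 * pyr j + 2 * e ^ 3 * l ^ 3 * tri j * (2 * j - 1)"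
      have "[E 1 * I0 = 1 - 2 * e\<^sup>2 * l\<^sup>2 * j + 2 * e\<^sup>2 * l\<^sup>2 * tri j] (mod M)"
        unfolding cong_iff_dvd_diff E_def I0_def by algebra
      moreover have "[\<alpha> * W0 = R] (mod M)"
        unfolding cong_iff_dvd_diff W0_def R_def by algebra
      ultimately have "[E 1 * I0 - \<alpha> * W0 - e * T0
        = 1 - 2 * e\<^sup>2 * l\<^sup>2 * j + 2 * e\<^sup>2 * l\<^sup>2 * tri j - R - e * T0] (mod M)"
        by (intro cong_diff cong_refl)
      also have "[1 - 2 * e\<^sup>2 * l\<^sup>2 * j + 2 * e\<^sup>2 * l\<^sup>2 * tri j - R - e * T0
        = 1 + (h * l\<^sup>2 * tri j - 2 * e ^ 3 * l\<^sup>2 * (l * j)) - w0 - e * w0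
          + 4 * e\<^sup>2 * l\<^sup>2 * (j\<^sup>2 - j - 2 * tri j)] (mod M)"
      proof (rule cong_witness)
        have "l ^ 3 * j = l\<^sup>2 * j + 2 * (g * l\<^sup>2 * j)" "l ^ 3 * tri j = 3 * l\<^sup>2 * tri j + 2 * ((g - 1) * l\<^sup>2 * tri j)"
          unfolding g by algebra+
        then show "1 - 2 * e\<^sup>2 * l\<^sup>2 * j + 2 * e\<^sup>2 * l\<^sup>2 * tri j - R - e * T0
        = 1 + (h * l\<^sup>2 * tri j - 2 * e ^ 3 * l\<^sup>2 * (l * j)) - w0 - e * w0
          + 4 * e\<^sup>2 * l\<^sup>2 * (j\<^sup>2 - j - 2 * tri j)
          + M * (l\<^sup>2 * pyr j + g * l\<^sup>2 * j - l ^ 3 * j * tri j + l\<^sup>2 * j\<^sup>2 + (g - 1) * l\<^sup>2 * tri j)"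
          unfolding R_def w0_def T0_def s_def by algebra
      qed
      finally show ?thesis .
    qed
    also have "j\<^sup>2 - j - 2 * tri j = 0" unfolding j by simp
    finally have "[E 1 * I0 - \<alpha> * W0 - e * T0
        = 1 + (h * l\<^sup>2 * tri j - 2 * e ^ 3 * l\<^sup>2 * (l * j)) - w0 - e * w0] (mod M)"
      by simp
    from cong_add[OF cong_add[OF this EE] cong_refl[of "- e * t - e"]]
    show "[E 1 * (I0 + E T0 * i) - \<alpha> * W0 - e * (t + T0 + 1)
       = 1 + (h * l\<^sup>2 * tri j - 2 * e ^ 3 * l\<^sup>2 * (l * j)) + E w0 * (E 1 * i) - w0 - e * (t + 1 + w0)] (mod M)"
      by (simp add: algebra_simps)
  qed
  also have "\<dots> = cls (\<alpha> * j + s (\<alpha> * j), 1 + h * l\<^sup>2 * tri (\<alpha> * j) + E (\<alpha> * j + s (\<alpha> * j)) * (E 1 * i), t + 1 + (\<alpha> * j + s (\<alpha> * j)))"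
  proof -
    have w2: "[\<alpha> * j + s (\<alpha> * j) = w0] (mod 2 * h)"
      by (rule cong_dvd_modulus[OF w]) (simp add: power_numeral_reduce)
    have v: "[1 + h * l\<^sup>2 * tri (\<alpha> * j) + E (\<alpha> * j + s (\<alpha> * j)) * (E 1 * i)
      = 1 + (h * l\<^sup>2 * tri j - 2 * e ^ 3 * l\<^sup>2 * (l * j)) + E w0 * (E 1 * i)] (mod M)"
      by (rule cong_add[OF cong_add[OF cong_refl p] E_mult_mod[OF cong_M_h[OF w]]])
    show ?thesis by (rule cls_eqI[OF w v cong_add[OF cong_refl w2], symmetric])
  qed
  also have "\<dots> = cls (step_a (step_c x))" by (simp add: x step_a_def step_c_def)
  finally show ?thesis .
qed

end

section \<open>Powers and word evaluation in groups\<close>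

context group begin

lemma conj_int_pow:
  assumes "x \<in> carrier G" "y \<in> carrier G" "g \<in> carrier G" "x \<otimes> g = g \<otimes> y"
  shows "x [^] (i::int) \<otimes> g = g \<otimes> y [^] i"
proof -
  have nat: "x [^] (n::nat) \<otimes> g = g \<otimes> y [^] n" for n
  proof (induction n)
    case (Suc n)
    have "x [^] Suc n \<otimes> g = x [^] n \<otimes> (x \<otimes> g)" using assms by (simp add: m_assoc)
    also have "\<dots> = (x [^] n \<otimes> g) \<otimes> y" using assms by (simp add: m_assoc)
    also have "\<dots> = g \<otimes> y [^] Suc n" using assms Suc by (simp add: m_assoc)
    finally show ?case .
  qed (use assms in simp)
  show ?thesis
  proof (cases i rule: int_cases2)
    case (nonneg n) then show ?thesis using nat by (simp add: int_pow_int)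
  next
    case (nonpos n)
    have "inv (x [^] n) \<otimes> g = g \<otimes> inv (y [^] n)"
    proof -
      have "inv (x [^] n) \<otimes> g = inv (x [^] n) \<otimes> (g \<otimes> y [^] n) \<otimes> inv (y [^] n)"
        using assms by (simp add: m_assoc)
      also have "\<dots> = g \<otimes> inv (y [^] n)" using assms by (simp add: nat[symmetric] inv_solve_left' m_assoc flip: m_assoc)
      finally show ?thesis .
    qed
    then show ?thesis using assms nonpos by (simp add: int_pow_neg_int)
  qed
qed

lemma conj_inv:
  assumes "x \<in> carrier G" "y \<in> carrier G" "z \<in> carrier G" "x \<otimes> y = z \<otimes> x"
  shows "inv x \<otimes> z = y \<otimes> inv x"
proof -
  have "inv x \<otimes> z = inv x \<otimes> (z \<otimes> x) \<otimes> inv x" using assms(1-3) by (simp add: m_assoc)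
  also have "\<dots> = y \<otimes> inv x" using assms(1-3) by (simp add: assms(4)[symmetric] flip: m_assoc)
  finally show ?thesis .
qed

lemma int_pow_cong:
  assumes "x \<in> carrier G" "x [^] (q::int) = \<one>" "[i = j] (mod q)"
  shows "x [^] i = x [^] j"
proof -
  obtain k where "j = i + q * k" using assms(3) by (auto simp: cong_iff_lin)
  then show ?thesis using assms(1,2) by (simp add: int_pow_mult int_pow_pow[symmetric])
qed

lemma word_eval_closed:
  "(\<And>g. f g \<in> carrier G) \<Longrightarrow> word_eval G f w \<in> carrier G"
  by (induction w) (auto simp: word_eval_def)

lemma word_eval_Cons:
  "word_eval G f (x # w) = (if snd x then f (fst x) else inv (f (fst x))) \<otimes> word_eval G f w"
  by (simp add: word_eval_def split: prod.splits)

lemma word_eval_append: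
  assumes "\<And>g. f g \<in> carrier G"
  shows "word_eval G f (u @ v) = word_eval G f u \<otimes> word_eval G f v"
proof (induction u)
  case Nil
  then show ?case using word_eval_closed[of f v] assms by (simp add: word_eval_def[of _ _ "[]"])
next
  case (Cons x u)
  then show ?case using assms by (simp add: word_eval_Cons m_assoc word_eval_closed)
qed

lemma word_eval_inv:
  assumes "\<And>g. f g \<in> carrier G"
  shows "word_eval G f (word_inv w) = inv (word_eval G f w)"
proof (induction w)
  case Nil
  then show ?case by (simp add: word_eval_def word_inv_def)
next
  case (Cons x w)
  have "word_inv (x # w) = word_inv w @ [(fst x, \<not> snd x)]"
    by (simp add: word_inv_def case_prod_unfold)
  then show ?case using Cons assms
    by (simp add: word_eval_append word_eval_Cons inv_mult_group word_eval_closed) (simp add: word_eval_def assms)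
qed

lemma word_eval_pow:
  assumes "\<And>g. f g \<in> carrier G"
  shows "word_eval G f (word_pow w k) = word_eval G f w [^] k"
proof -
  have rep: "word_eval G f (concat (replicate n w)) = word_eval G f w [^] n" for n w
  proof (induction n)
    case 0 then show ?case by (simp add: word_eval_def)
  next
    case (Suc n)
    then have "word_eval G f (concat (replicate (Suc n) w)) = word_eval G f w \<otimes> word_eval G f w [^] n"
      using assms by (simp add: word_eval_append)
    also have "\<dots> = word_eval G f w [^] Suc n"
      using assms by (intro nat_pow_Suc2[symmetric] word_eval_closed)
    finally show ?case .
  qed
  show ?thesis
  proof (cases "0 \<le> k")
    case True
    then obtain n where k: "k = int n" by (rule nonneg_int_cases)
    have "word_pow w k = concat (replicate n w)" unfolding word_pow_def k by simp
    then show ?thesis by (simp only: rep k int_pow_int)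
  next
    case False
    then obtain n where k: "k = - int n" and n: "n \<noteq> 0"
      by (cases k rule: int_cases2) auto
    have W: "word_eval G f w \<in> carrier G" by (rule word_eval_closed[OF assms])
    have "word_pow w k = concat (replicate n (word_inv w))" unfolding word_pow_def k using n by simp
    then have "word_eval G f (word_pow w k) = inv (word_eval G f w) [^] n"
      by (simp only: rep word_eval_inv[OF assms])
    also have "\<dots> = inv (word_eval G f w [^] n)" by (rule nat_pow_inv[OF W])
    also have "\<dots> = word_eval G f w [^] k" unfolding k by (rule int_pow_neg_int[OF W, symmetric])
    finally show ?thesis .
  qed
qed

end

section \<open>Consequences of the defining relations\<close>

text \<open>
  A group with two elements that satisfy the relations of \<open>J\<close>; they need not generate it. The
  relations are symmetric in \<open>a\<close> and \<open>b\<close>, and the interchange replaces \<open>c\<close> by its inverse, so every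
  statement about \<open>a\<close> has a twin about \<open>b\<close>.
\<close>

locale macdonald_group = dyadic k e l + group G for k e l and G (structure) +
  fixes a b
  assumes a_closed [simp]: "a \<in> carrier G" and b_closed [simp]: "b \<in> carrier G"
    and rel_a: "inv (inv a \<otimes> inv b \<otimes> a \<otimes> b) \<otimes> a \<otimes> (inv a \<otimes> inv b \<otimes> a \<otimes> b) = a [^] \<alpha>"
    and rel_b: "inv (inv b \<otimes> inv a \<otimes> b \<otimes> a) \<otimes> b \<otimes> (inv b \<otimes> inv a \<otimes> b \<otimes> a) = b [^] \<alpha>"
    and a_M: "a [^] M = \<one>" and b_M: "b [^] M = \<one>"
begin

definition c where "c = inv a \<otimes> inv b \<otimes> a \<otimes> b"

lemma c_closed [simp]: "c \<in> carrier G" by (simp add: c_def)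

lemma swap: "macdonald_group k e l G b a"
  by unfold_locales (simp_all add: rel_a rel_b a_M b_M)

lemma inv_c: "inv c = inv b \<otimes> inv a \<otimes> b \<otimes> a"
  by (simp add: c_def inv_mult_group m_assoc)

lemma swap_c: "macdonald_group.c G b a = inv c"
  by (simp add: macdonald_group.c_def[OF swap] inv_c)

lemma a_b: "a \<otimes> b = b \<otimes> a \<otimes> c"
  by (simp add: c_def m_assoc flip: m_assoc[of a "inv a"]) (simp flip: m_assoc)

lemma a_cong: "[i = j] (mod M) \<Longrightarrow> a [^] i = a [^] j"
  using a_M by (intro int_pow_cong[of a M]) auto

lemma b_cong: "[i = j] (mod M) \<Longrightarrow> b [^] i = b [^] j"
  using b_M by (intro int_pow_cong[of b M]) auto

lemma c_conj_a_1: "a \<otimes> c = c \<otimes> a [^] \<alpha>"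
proof -
  have "c \<otimes> (inv c \<otimes> a \<otimes> c) = c \<otimes> a [^] \<alpha>" using rel_a by (simp add: c_def)
  then show ?thesis by (simp flip: m_assoc)
qed

lemma c_pow_a: "c [^] t \<otimes> a [^] i = a [^] (E t * i) \<otimes> c [^] t" for t i :: int
proof -
  have 1: "c \<otimes> a [^] i = a [^] (E 1 * i) \<otimes> c" for i :: int
  proof -
    have "a [^] (E 1 * i) \<otimes> c = c \<otimes> (a [^] \<alpha>) [^] (E 1 * i)"
      by (rule conj_int_pow) (simp_all add: c_conj_a_1)
    also have "(a [^] \<alpha>) [^] (E 1 * i) = a [^] (E (- 1) * E 1 * i)"
      by (simp add: int_pow_pow mult.assoc)
    also have "\<dots> = a [^] (E (- 1 + 1) * i)" by (intro a_cong cong_mult cong_refl E_add)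
    finally show ?thesis by simp
  qed
  have nat: "c [^] (n::nat) \<otimes> a [^] i = a [^] (E (int n) * i) \<otimes> c [^] n" for n and i :: int
  proof (induction n arbitrary: i)
    case (Suc n)
    have "c [^] Suc n \<otimes> a [^] i = c [^] n \<otimes> (c \<otimes> a [^] i)" by (simp add: m_assoc)
    also have "\<dots> = (c [^] n \<otimes> a [^] (E 1 * i)) \<otimes> c" by (simp add: 1 m_assoc)
    also have "\<dots> = a [^] (E (int n) * (E 1 * i)) \<otimes> c [^] Suc n" unfolding Suc by (simp add: m_assoc)
    also have "a [^] (E (int n) * (E 1 * i)) = a [^] (E (int n + 1) * i)"
      unfolding mult.assoc[symmetric] by (intro a_cong cong_mult cong_refl E_add)
    finally show ?case by (simp add: add.commute)
  qed simp
  show ?thesis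
  proof (cases t rule: int_cases2)
    case (nonneg n) then show ?thesis using nat by (simp add: int_pow_int)
  next
    case (nonpos n)
    have "a [^] (E (int n) * (E t * i)) = a [^] (E (int n + t) * i)"
      unfolding mult.assoc[symmetric] by (intro a_cong cong_mult cong_refl E_add)
    then have "c [^] n \<otimes> a [^] (E t * i) = a [^] i \<otimes> c [^] n"
      using nat[of n "E t * i"] nonpos by simp
    then have "inv (c [^] n) \<otimes> a [^] i = a [^] (E t * i) \<otimes> inv (c [^] n)"
      by (intro conj_inv) simp_all
    then show ?thesis using nonpos by (simp add: int_pow_neg_int)
  qed
qed

lemma c_pow_b: "c [^] t \<otimes> b [^] i = b [^] (E (- t) * i) \<otimes> c [^] t" for t i :: int
proof -
  interpret sw: macdonald_group k e l G b a by (rule swap)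
  show ?thesis using sw.c_pow_a[of "- t" i] by (simp add: swap_c int_pow_neg int_pow_inv)
qed

text \<open>
  Both \<open>b\<^bsup>-n\<^esup> a b\<^sup>n\<close> and the claimed value satisfy the recursion \<open>F (n + 1) = F n b\<^bsup>\<lambda>n\<^esup> c\<close>, because
  \<open>b\<^sup>-\<^sup>1 a b = a c\<close> and \<open>b\<^bsup>-n\<^esup> c b\<^sup>n = b\<^bsup>\<lambda>n\<^esup> c\<close>.
\<close>

lemma a_b_pow: "a \<otimes> b [^] n = b [^] n \<otimes> a \<otimes> b [^] s n \<otimes> c [^] n" for n :: int
proof -
  define \<phi> where "\<phi> n = inv (b [^] n) \<otimes> a \<otimes> b [^] n" for n :: int
  have [simp]: "\<phi> n \<in> carrier G" for n by (simp add: \<phi>_def)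
  have \<phi>_step: "\<phi> (n + 1) = \<phi> n \<otimes> (b [^] (2 * e * l * n) \<otimes> c)" for n
  proof -
    have cb: "c \<otimes> b [^] n = b [^] n \<otimes> b [^] (2 * e * l * n) \<otimes> c"
      using c_pow_b[of 1 n] by (simp add: distrib_right int_pow_mult)
    have "a \<otimes> b [^] (n + 1) = a \<otimes> b \<otimes> b [^] n"
      using int_pow_mult[of b 1 n] by (simp add: add.commute m_assoc)
    also have "\<dots> = b \<otimes> a \<otimes> (c \<otimes> b [^] n)" by (simp add: a_b m_assoc)
    also have "\<dots> = b \<otimes> (a \<otimes> b [^] n) \<otimes> (b [^] (2 * e * l * n) \<otimes> c)" unfolding cb by (simp add: m_assoc)
    also have "a \<otimes> b [^] n = b [^] n \<otimes> \<phi> n" by (simp add: \<phi>_def m_assoc) (simp flip: m_assoc)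
    also have "b \<otimes> (b [^] n \<otimes> \<phi> n) = b [^] (n + 1) \<otimes> \<phi> n"
      using int_pow_mult[of b 1 n] by (simp add: add.commute m_assoc)
    finally show ?thesis by (simp add: \<phi>_def[of "n + 1"] m_assoc) (simp flip: m_assoc)
  qed
  define \<psi> where "\<psi> n = a \<otimes> b [^] s n \<otimes> c [^] n" for n :: int
  have [simp]: "\<psi> n \<in> carrier G" for n by (simp add: \<psi>_def)
  have \<psi>_step: "\<psi> (n + 1) = \<psi> n \<otimes> (b [^] (2 * e * l * n) \<otimes> c)" for n
  proof -
    have "\<psi> n \<otimes> (b [^] (2 * e * l * n) \<otimes> c) = a \<otimes> b [^] s n \<otimes> (c [^] n \<otimes> b [^] (2 * e * l * n)) \<otimes> c"
      by (simp add: \<psi>_def m_assoc)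
    also have "\<dots> = a \<otimes> (b [^] s n \<otimes> b [^] (E (- n) * (2 * e * l * n))) \<otimes> (c [^] n \<otimes> c)"
      unfolding c_pow_b by (simp add: m_assoc)
    also have "b [^] s n \<otimes> b [^] (E (- n) * (2 * e * l * n)) = b [^] s (n + 1)"
      unfolding int_pow_mult[OF b_closed, symmetric] by (rule b_cong[OF cong_sym[OF s_Suc]])
    also have "c [^] n \<otimes> c = c [^] (n + 1)" using int_pow_mult[of c n 1] by simp
    finally show ?thesis by (simp add: \<psi>_def)
  qed
  have "\<phi> n = \<psi> n"
  proof (induction n rule: int_induct[where k = 0])
    case base then show ?case by (simp add: \<phi>_def \<psi>_def s_def)
  next
    case (step1 i) then show ?case by (simp add: \<phi>_step \<psi>_step)
  next
    case (step2 i)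
    have "\<phi> (i - 1) \<otimes> (b [^] (2 * e * l * (i - 1)) \<otimes> c) = \<psi> (i - 1) \<otimes> (b [^] (2 * e * l * (i - 1)) \<otimes> c)"
      using step2.IH \<phi>_step[of "i - 1"] \<psi>_step[of "i - 1"] by simp
    then show ?case by (subst (asm) right_cancel) simp_all
  qed
  have "a \<otimes> b [^] n = b [^] n \<otimes> \<phi> n" by (simp add: \<phi>_def flip: m_assoc)
  also have "\<dots> = b [^] n \<otimes> \<psi> n" by (simp add: \<open>\<phi> n = \<psi> n\<close>)
  finally show ?thesis by (simp add: \<psi>_def m_assoc)
qed

lemma b_a_pow: "b \<otimes> a [^] n = a [^] n \<otimes> b \<otimes> a [^] s n \<otimes> c [^] (- n)" for n :: int
proof -
  interpret sw: macdonald_group k e l G b a by (rule swap)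
  show ?thesis using sw.a_b_pow[of n] by (simp add: swap_c int_pow_neg int_pow_inv)
qed

end

context dyadic begin

lemma s_alpha: "[s \<alpha> = h * l\<^sup>2] (mod M)"
proof -
  have a: "\<alpha> = 1 + 2 * e * l" by simp
  from tri_tet_alpha[OF a] obtain \<tau> where t: "tri \<alpha> = e * l * (1 + 2 * e * l)" "tet \<alpha> = e * \<tau>" .
  show ?thesis unfolding cong_iff_dvd_diff s_def pyr_def t by algebra
qed

lemma l_square_inverse: obtains r where "[l\<^sup>2 * r = 1] (mod 2 * e)"
proof -
  have "coprime (l\<^sup>2) (2 * e)" using odd_l by (simp add: e_def)
  then show thesis using cong_solve_coprime_int that by metis
qed

lemma s_h: "[s h = 2 * e ^ 3] (mod M)"
  using s_mod_h[of 0 1] by (simp add: s_def)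

end

context macdonald_group begin

text \<open>
  The hidden relation. Transforming \<open>a b\<^sup>\<alpha>\<close> by \<open>c\<close> gives \<open>a\<^sup>\<alpha> b\<close>. The formula for \<open>[a, b\<^sup>\<alpha>]\<close> and its
  twin for \<open>[b, a\<^sup>\<alpha>]\<close> express this element in two ways, and comparison leaves
  \<open>a\<^sup>r b\<^sup>r = 1\<close> for \<open>r = h l\<^sup>2\<close>, as \<open>s \<alpha>\<close> is congruent to \<open>h l\<^sup>2\<close>. The odd factor \<open>l\<^sup>2\<close> can be removed.
\<close>

lemma a_h_eq_b: "a [^] (h * u) = b [^] (- (h * u))" for u :: int
proof -
  have 1: "a [^] \<alpha> \<otimes> b = b \<otimes> a [^] \<alpha> \<otimes> b [^] (h * l\<^sup>2) \<otimes> c [^] \<alpha>"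
  proof -
    have "c \<otimes> b = b [^] \<alpha> \<otimes> c" using c_pow_b[of 1 1] by simp
    then have *: "inv c \<otimes> b [^] \<alpha> = b \<otimes> inv c" by (intro conj_inv) simp_all
    have "c \<otimes> a [^] \<alpha> = a \<otimes> c" by (simp add: c_conj_a_1)
    then have **: "inv c \<otimes> a = a [^] \<alpha> \<otimes> inv c" by (intro conj_inv) simp_all
    have "c \<otimes> b [^] (h * l\<^sup>2) = b [^] (h * l\<^sup>2) \<otimes> c"
      using c_pow_b[of 1 "h * l\<^sup>2"] b_cong[OF E_h[of "- 1" "l\<^sup>2"]] by simp
    then have ***: "inv c \<otimes> b [^] (h * l\<^sup>2) = b [^] (h * l\<^sup>2) \<otimes> inv c" by (intro conj_inv) simp_all
    have "a [^] \<alpha> \<otimes> b = a [^] \<alpha> \<otimes> (b \<otimes> inv c) \<otimes> c" by (simp add: m_assoc)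
    also have "\<dots> = (a [^] \<alpha> \<otimes> inv c) \<otimes> b [^] \<alpha> \<otimes> c" unfolding *[symmetric] by (simp add: m_assoc)
    also have "\<dots> = inv c \<otimes> (a \<otimes> b [^] \<alpha>) \<otimes> c" unfolding **[symmetric] by (simp add: m_assoc)
    also have "a \<otimes> b [^] \<alpha> = b [^] \<alpha> \<otimes> a \<otimes> b [^] (h * l\<^sup>2) \<otimes> c [^] \<alpha>"
      unfolding a_b_pow[of \<alpha>] b_cong[OF s_alpha] ..
    also have "inv c \<otimes> (b [^] \<alpha> \<otimes> a \<otimes> b [^] (h * l\<^sup>2) \<otimes> c [^] \<alpha>) \<otimes> c
       = (inv c \<otimes> b [^] \<alpha>) \<otimes> a \<otimes> b [^] (h * l\<^sup>2) \<otimes> c [^] \<alpha> \<otimes> c" by (simp add: m_assoc)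
    also have "\<dots> = b \<otimes> (inv c \<otimes> a) \<otimes> b [^] (h * l\<^sup>2) \<otimes> c [^] \<alpha> \<otimes> c" unfolding * by (simp add: m_assoc)
    also have "\<dots> = b \<otimes> a [^] \<alpha> \<otimes> (inv c \<otimes> b [^] (h * l\<^sup>2)) \<otimes> c [^] \<alpha> \<otimes> c" unfolding ** by (simp add: m_assoc)
    also have "\<dots> = b \<otimes> a [^] \<alpha> \<otimes> b [^] (h * l\<^sup>2) \<otimes> (inv c \<otimes> c [^] \<alpha> \<otimes> c)" unfolding *** by (simp add: m_assoc)
    also have "inv c \<otimes> c [^] \<alpha> \<otimes> c = c [^] \<alpha>"
      using int_pow_mult[of c "-1" \<alpha>] int_pow_mult[of c "2 * e * l" 1] by (simp add: int_pow_neg add.commute)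
    finally show ?thesis .
  qed
  have 2: "b \<otimes> a [^] \<alpha> = a [^] \<alpha> \<otimes> b \<otimes> a [^] (h * l\<^sup>2) \<otimes> c [^] (- \<alpha>)"
    unfolding b_a_pow[of \<alpha>] a_cong[OF s_alpha] ..
  have c_bh: "c [^] (- \<alpha>) \<otimes> b [^] (h * l\<^sup>2) = b [^] (h * l\<^sup>2) \<otimes> c [^] (- \<alpha>)"
    unfolding c_pow_b b_cong[OF E_h] ..
  have "a [^] \<alpha> \<otimes> b = a [^] \<alpha> \<otimes> b \<otimes> a [^] (h * l\<^sup>2) \<otimes> (c [^] (- \<alpha>) \<otimes> b [^] (h * l\<^sup>2)) \<otimes> c [^] \<alpha>"
    by (subst 1, subst 2) (simp add: m_assoc)
  also have "\<dots> = a [^] \<alpha> \<otimes> b \<otimes> (a [^] (h * l\<^sup>2) \<otimes> b [^] (h * l\<^sup>2))"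
  proof -
    have "c [^] (- \<alpha>) \<otimes> c [^] \<alpha> = \<one>" by (simp only: int_pow_neg[OF c_closed] l_inv int_pow_closed[OF c_closed])
    then show ?thesis unfolding c_bh by (simp add: m_assoc)
  qed
  finally have "a [^] (h * l\<^sup>2) \<otimes> b [^] (h * l\<^sup>2) = \<one>" by simp
  then have 3: "a [^] (h * l\<^sup>2) = inv (b [^] (h * l\<^sup>2))" by (intro inv_equality[symmetric]) simp_all
  obtain r where r: "[l\<^sup>2 * r = 1] (mod 2 * e)" by (rule l_square_inverse)
  have "h * (2 * e) dvd h * (l\<^sup>2 * r - 1)" using r unfolding cong_iff_dvd_diff by (rule mult_dvd_mono[OF dvd_refl])
  moreover have "h * (2 * e) = M" by algebra
  ultimately have "M dvd h * (l\<^sup>2 * r - 1) * u" by simp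
  moreover have "h * (l\<^sup>2 * r - 1) * u = h * l\<^sup>2 * (r * u) - h * u" by algebra
  ultimately have hr: "[h * l\<^sup>2 * (r * u) = h * u] (mod M)" by (simp add: cong_iff_dvd_diff)
  have "a [^] (h * u) = (a [^] (h * l\<^sup>2)) [^] (r * u)" using a_cong[OF hr] by (simp add: int_pow_pow)
  also have "\<dots> = inv (b [^] (h * l\<^sup>2 * (r * u)))" unfolding 3 by (simp add: int_pow_inv int_pow_pow)
  also have "b [^] (h * l\<^sup>2 * (r * u)) = b [^] (h * u)" by (rule b_cong[OF hr])
  finally show ?thesis by (simp add: int_pow_neg)
qed

lemma a_h_commute_a: "a [^] (h * u) \<otimes> a [^] i = a [^] i \<otimes> a [^] (h * u)" for u i :: int
  by (simp add: add.commute flip: int_pow_mult)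

lemma a_h_commute_b: "a [^] (h * u) \<otimes> b [^] i = b [^] i \<otimes> a [^] (h * u)" for u i :: int
  unfolding a_h_eq_b by (simp add: add.commute flip: int_pow_mult)

lemma a_h_commute_c: "c [^] i \<otimes> a [^] (h * u) = a [^] (h * u) \<otimes> c [^] i" for u i :: int
  unfolding c_pow_a a_cong[OF E_h] ..

text \<open>
  Since \<open>b\<^sup>h\<close> commutes with \<open>a\<close>, the formula \<open>[a, b\<^sup>h] = b\<^bsup>s h\<^esup> c\<^sup>h\<close> makes \<open>c\<^sup>h\<close> the inverse of \<open>b\<^bsup>s h\<^esup>\<close>,
  where \<open>s h\<close> is congruent to \<open>M / 2\<close>.
\<close>

lemma c_h_eq_a: "c [^] (h * v) = a [^] (2 * e ^ 3 * v)" for v :: int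
proof -
  have "b [^] h = a [^] (h * (- 1))" using a_h_eq_b[of "-1"] by simp
  then have "a \<otimes> b [^] h = b [^] h \<otimes> a" using a_h_commute_a[of "-1" 1] by simp
  moreover have "a \<otimes> b [^] h = b [^] h \<otimes> a \<otimes> (b [^] s h \<otimes> c [^] h)"
    unfolding a_b_pow[of h] by (simp add: m_assoc)
  ultimately have "b [^] s h \<otimes> c [^] h = \<one>" by simp
  then have "inv (c [^] h) = b [^] s h" by (intro inv_equality) simp_all
  also have "\<dots> = b [^] (2 * e ^ 3)" by (rule b_cong[OF s_h])
  also have "2 * e ^ 3 = - (h * (- e))" by algebra
  also have "b [^] (- (h * (- e))) = a [^] (h * (- e))" by (rule a_h_eq_b[symmetric])
  finally have "c [^] h = inv (a [^] (h * (- e)))" by (metis inv_inv c_closed int_pow_closed)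
  then have "c [^] h = a [^] (h * e)" by (simp add: int_pow_neg)
  then have "c [^] (h * v) = a [^] (h * e * v)" by (simp add: int_pow_pow[symmetric])
  also have "h * e * v = 2 * e ^ 3 * v" by algebra
  finally show ?thesis .
qed

definition N where "N = (\<lambda>(j, i, t). b [^] (j::int) \<otimes> a [^] (i::int) \<otimes> c [^] (t::int))"

lemma N_closed [simp]: "N x \<in> carrier G" by (simp add: N_def split: prod.split)

lemma N_cong: "cls x = cls y \<Longrightarrow> N x = N y"
proof -
  assume "cls x = cls y"
  obtain j i t where x: "x = (j, i, t)" by (cases x)
  obtain j' i' t' where y: "y = (j', i', t')" by (cases y)
  from \<open>cls x = cls y\<close> obtain u v where u: "j' = j + h * u" and v: "t' = t + h * v"
    and i: "[i' = i + h * u + 2 * e ^ 3 * v] (mod M)"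
    unfolding x y by (rule cls_eqE)
  have bh: "b [^] (h * u) = a [^] (h * - u)" using a_h_eq_b[of "- u"] by simp
  have v': "2 * e ^ 3 * v = h * (e * v)" by algebra
  have "N y = b [^] j \<otimes> a [^] (h * - u) \<otimes> a [^] (i + h * u + 2 * e ^ 3 * v) \<otimes> (c [^] t \<otimes> a [^] (h * (e * v)))"
    unfolding y N_def u v by (simp add: int_pow_mult bh c_h_eq_a v' a_cong[OF i] del: minus_mult_right mult_minus_right)
  also have "\<dots> = b [^] j \<otimes> (a [^] (h * - u) \<otimes> a [^] (i + h * u + 2 * e ^ 3 * v) \<otimes> a [^] (h * (e * v))) \<otimes> c [^] t"
    unfolding a_h_commute_c by (simp add: m_assoc)
  also have "a [^] (h * - u) \<otimes> a [^] (i + h * u + 2 * e ^ 3 * v) \<otimes> a [^] (h * (e * v)) = a [^] (h * - u + (i + h * u + 2 * e ^ 3 * v) + h * (e * v))"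
    by (simp only: int_pow_mult[OF a_closed])
  also have "\<dots> = a [^] i"
    by (rule a_cong, rule cong_witness[where k = v]) algebra
  finally show ?thesis by (simp add: x N_def)
qed

lemma b_N: "b \<otimes> N x = N (step_b x)"
proof -
  obtain j i t where x: "x = (j, i, t)" by (cases x)
  show ?thesis using int_pow_mult[of b 1 j] by (simp add: x N_def step_b_def add.commute flip: m_assoc)
qed

text \<open>
  Here \<open>a\<close> is moved past \<open>b\<^sup>j\<close>, which creates \<open>b\<^bsup>s j\<^esup>\<close> and \<open>c\<^sup>j\<close>, and then past \<open>b\<^bsup>s j\<^esup>\<close>, which creates
  \<open>c\<^bsup>s j\<^esup>\<close> and a central power of \<open>a\<close>.
\<close>

lemma a_N: "a \<otimes> N x = N (step_a x)"
proof -
  obtain j i t where x: "x = (j, i, t)" by (cases x)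
  have ss: "b [^] s (s j) = a [^] (h * (l\<^sup>2 * tri j))"
  proof -
    have "b [^] s (s j) = b [^] (- (h * (l\<^sup>2 * tri j)))" by (rule b_cong) (use s_of_s[of j] in \<open>simp add: mult.assoc\<close>)
    then show ?thesis by (simp add: a_h_eq_b)
  qed
  have "a \<otimes> N x = (a \<otimes> b [^] j) \<otimes> a [^] i \<otimes> c [^] t" by (simp add: x N_def m_assoc)
  also have "\<dots> = b [^] j \<otimes> (a \<otimes> b [^] s j) \<otimes> (c [^] j \<otimes> a [^] i) \<otimes> c [^] t"
    unfolding a_b_pow[of j] by (simp add: m_assoc)
  also have "\<dots> = b [^] j \<otimes> b [^] s j \<otimes> a \<otimes> a [^] (h * (l\<^sup>2 * tri j)) \<otimes> (c [^] s j \<otimes> a [^] (E j * i)) \<otimes> c [^] j \<otimes> c [^] t"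
    unfolding a_b_pow[of "s j"] ss c_pow_a[of j] by (simp add: m_assoc)
  also have "\<dots> = (b [^] j \<otimes> b [^] s j) \<otimes> (a \<otimes> a [^] (h * (l\<^sup>2 * tri j)) \<otimes> a [^] (E (s j) * (E j * i))) \<otimes> (c [^] s j \<otimes> c [^] j \<otimes> c [^] t)"
    unfolding c_pow_a by (simp add: m_assoc)
  also have "a \<otimes> a [^] (h * (l\<^sup>2 * tri j)) \<otimes> a [^] (E (s j) * (E j * i)) = a [^] (1 + h * (l\<^sup>2 * tri j) + E (s j) * (E j * i))"
    by (simp add: int_pow_mult)
  also have "\<dots> = a [^] (1 + h * l\<^sup>2 * tri j + E (j + s j) * i)"
    unfolding mult.assoc[symmetric] add.commute[of j] by (intro a_cong cong_add cong_refl cong_mult E_add)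
  also have "b [^] j \<otimes> b [^] s j = b [^] (j + s j)" by (simp add: int_pow_mult)
  also have "c [^] s j \<otimes> c [^] j \<otimes> c [^] t = c [^] (t + (j + s j))" by (simp add: ac_simps flip: int_pow_mult)
  finally show ?thesis by (simp add: x N_def step_a_def)
qed

end

context dyadic begin

lemma nat_M: "Suc (nat M - 1) = nat M" "int (nat M) = M" using e_pos by auto

end

context macdonald_group begin

lemma a_pow_N: "a [^] (n::nat) \<otimes> N x = N ((step_a ^^ n) x)"
proof (induction n arbitrary: x)
  case (Suc n)
  then show ?case by (simp add: m_assoc a_N funpow_swap1)
qed simp

lemma inv_a: "inv a = a [^] (nat M - 1)"
proof -
  have "int (Suc (nat M - 1)) = M" by (simp only: nat_M)
  then have "int (nat M - 1) = -1 + M * 1" by linarith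
  then have "[- 1 = int (nat M - 1)] (mod M)" by (simp add: cong_iff_lin)
  then have "a [^] (- 1 :: int) = a [^] int (nat M - 1)" by (rule a_cong)
  then show ?thesis by (simp add: int_pow_neg int_pow_int)
qed

lemma inv_a_N: "inv a \<otimes> N x = N ((step_a ^^ (nat M - 1)) x)"
  unfolding inv_a by (rule a_pow_N)

lemma b_pow_N: "b [^] (n::nat) \<otimes> N x = N ((step_b ^^ n) x)"
proof (induction n arbitrary: x)
  case (Suc n)
  then show ?case by (simp add: m_assoc b_N funpow_swap1)
qed simp

lemma inv_b_N: "inv b \<otimes> N x = N ((step_b ^^ (nat M - 1)) x)"
proof -
  interpret sw: macdonald_group k e l G b a by (rule swap)
  show ?thesis unfolding sw.inv_a by (rule b_pow_N)
qed

lemma N_0: "N (0, 0, 0) = \<one>" by (simp add: N_def)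

end

section \<open>A permutation model of the relations\<close>

context dyadic begin

definition X where "X = range cls"

text \<open>
  For maps \<open>f\<close> that respect \<open>cls\<close> the choice of the representative is immaterial (\<open>lift_cls\<close>).
\<close>

definition lift :: "(int \<times> int \<times> int \<Rightarrow> int \<times> int \<times> int) \<Rightarrow> int \<times> int \<times> int \<Rightarrow> int \<times> int \<times> int" where
  "lift f = (\<lambda>p\<in>X. cls (f (SOME x. cls x = p)))"

lemma lift_cls: "(\<And>x y. cls x = cls y \<Longrightarrow> cls (f x) = cls (f y)) \<Longrightarrow> lift f (cls x) = cls (f x)"
proof -
  assume f: "\<And>x y. cls x = cls y \<Longrightarrow> cls (f x) = cls (f y)"
  have "cls (SOME y. cls y = cls x) = cls x" by (rule someI[where P = "\<lambda>y. cls y = cls x", OF refl])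
  from f[OF this] show ?thesis by (simp add: lift_def X_def)
qed

abbreviation "\<A> \<equiv> lift step_a"
abbreviation "\<B> \<equiv> lift step_b"
abbreviation "P \<equiv> BijGroup X"

lemma lift_step_a: "\<A> (cls x) = cls (step_a x)" by (rule lift_cls) (rule step_a_cong)
lemma lift_step_b: "\<B> (cls x) = cls (step_b x)" by (rule lift_cls) (rule step_b_cong)

text \<open>
  A map of finite order is bijective; this spares an explicit inverse of \<open>step_a\<close>.
\<close>

lemma lift_Bij:
  assumes f: "\<And>x. lift f (cls x) = cls (f x)" and inv: "\<And>x. cls ((f ^^ Suc n) x) = cls x"
  shows "lift f \<in> Bij X"
proof -
  have pow: "(lift f ^^ i) (cls x) = cls ((f ^^ i) x)" for i x
    by (induction i) (simp_all add: f)
  have "bij_betw (lift f) X X"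
  proof (rule bij_betwI[where g = "lift f ^^ n"])
    show "lift f \<in> X \<rightarrow> X" by (auto simp: X_def f)
    show "lift f ^^ n \<in> X \<rightarrow> X" by (auto simp: X_def pow)
    fix p assume "p \<in> X"
    then obtain x where p: "p = cls x" by (auto simp: X_def)
    show "(lift f ^^ n) (lift f p) = p"
      unfolding p f pow using inv[of x] by (simp add: funpow_Suc_right del: funpow.simps)
    show "lift f ((lift f ^^ n) p) = p"
      unfolding p f pow using inv[of x] by simp
  qed
  moreover have "lift f \<in> extensional X" by (simp add: lift_def)
  ultimately show ?thesis by (simp add: Bij_def)
qed

lemma \<A>_closed: "\<A> \<in> carrier P"
proof -
  have "\<A> \<in> Bij X"
    by (rule lift_Bij[where n = "nat M - 1", OF lift_step_a], unfold nat_M(1), rule step_a_period)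
       (simp add: nat_M cong_0_iff)
  then show ?thesis by (simp add: BijGroup_def)
qed

lemma \<B>_closed: "\<B> \<in> carrier P"
proof -
  have "\<B> \<in> Bij X"
    by (rule lift_Bij[where n = "nat M - 1", OF lift_step_b], unfold nat_M(1), rule step_b_period)
       (simp add: nat_M cong_0_iff)
  then show ?thesis by (simp add: BijGroup_def)
qed

lemma P_mult: "g \<in> carrier P \<Longrightarrow> f \<in> carrier P \<Longrightarrow> p \<in> X \<Longrightarrow> (g \<otimes>\<^bsub>P\<^esub> f) p = g (f p)"
  by (simp add: BijGroup_def compose_def)

lemma P_closed: "f \<in> carrier P \<Longrightarrow> p \<in> X \<Longrightarrow> f p \<in> X"
  by (auto simp: BijGroup_def Bij_def bij_betw_def)

lemma P_eqI: "f \<in> carrier P \<Longrightarrow> g \<in> carrier P \<Longrightarrow> (\<And>x. f (cls x) = g (cls x)) \<Longrightarrow> f = g"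
  by (rule extensionalityI[where A = X]) (auto simp: BijGroup_def Bij_def X_def)

lemma P_one: "p \<in> X \<Longrightarrow> \<one>\<^bsub>P\<^esub> p = p"
  by (simp add: BijGroup_def)

lemma P_pow:
  assumes "\<And>x. F (cls x) = cls (f x)" "F \<in> carrier P"
  shows "(F [^]\<^bsub>P\<^esub> (n::nat)) (cls x) = cls ((f ^^ n) x)"
proof -
  interpret P: group P by (rule group_BijGroup)
  show ?thesis
  proof (induction n arbitrary: x)
    case 0
    have "cls x \<in> X" by (simp add: X_def)
    then show ?case by (simp add: P_one)
  next
    case (Suc n)
    have "cls x \<in> X" by (simp add: X_def)
    then have "(F [^]\<^bsub>P\<^esub> Suc n) (cls x) = (F [^]\<^bsub>P\<^esub> n) (F (cls x))"
      using assms(2) by (simp add: P_mult)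
    then show ?case by (simp add: assms(1) Suc funpow_swap1)
  qed
qed

definition "\<C> = inv\<^bsub>P\<^esub> \<A> \<otimes>\<^bsub>P\<^esub> inv\<^bsub>P\<^esub> \<B> \<otimes>\<^bsub>P\<^esub> \<A> \<otimes>\<^bsub>P\<^esub> \<B>"

text \<open>
  Cancel \<open>\<B> \<A>\<close> in \<open>\<B> \<A> \<C> = \<A> \<B> = \<B> \<A> step_c\<close>. In particular \<open>step_c\<close> also induces a
  permutation.
\<close>

lemma \<C>_cls: "\<C> (cls x) = cls (step_c x)"
proof -
  interpret P: group P by (rule group_BijGroup)
  note [simp] = \<A>_closed \<B>_closed
  have [simp]: "\<C> \<in> carrier P" by (simp add: \<C>_def)
  have X: "cls y \<in> X" for y by (simp add: X_def)
  have "(\<B> \<otimes>\<^bsub>P\<^esub> \<A>) \<otimes>\<^bsub>P\<^esub> \<C> = \<A> \<otimes>\<^bsub>P\<^esub> \<B>"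
    by (simp add: \<C>_def P.m_assoc) (simp flip: P.m_assoc)
  then have "((\<B> \<otimes>\<^bsub>P\<^esub> \<A>) \<otimes>\<^bsub>P\<^esub> \<C>) (cls x) = (\<A> \<otimes>\<^bsub>P\<^esub> \<B>) (cls x)" by simp
  then have "(\<B> \<otimes>\<^bsub>P\<^esub> \<A>) (\<C> (cls x)) = cls (step_a (step_b x))"
    using X by (simp add: P_mult lift_step_a lift_step_b)
  also have "\<dots> = (\<B> \<otimes>\<^bsub>P\<^esub> \<A>) (cls (step_c x))"
    using X by (simp add: P_mult lift_step_a lift_step_b step_a_step_b)
  finally have *: "(\<B> \<otimes>\<^bsub>P\<^esub> \<A>) (\<C> (cls x)) = (\<B> \<otimes>\<^bsub>P\<^esub> \<A>) (cls (step_c x))" .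
  have "\<B> \<otimes>\<^bsub>P\<^esub> \<A> \<in> carrier P" by simp
  then have "inj_on (\<B> \<otimes>\<^bsub>P\<^esub> \<A>) X" by (simp add: BijGroup_def Bij_def bij_betw_def)
  moreover have "\<C> (cls x) \<in> X" using P_closed[of \<C> "cls x"] X by simp
  ultimately show ?thesis using inj_onD[OF _ * _ X] by blast
qed

lemma model_relations: "macdonald_group k e l P \<A> \<B>"
proof -
  interpret P: group P by (rule group_BijGroup)
  note [simp] = \<A>_closed \<B>_closed
  have C[simp]: "\<C> \<in> carrier P" by (simp add: \<C>_def)
  have X: "cls y \<in> X" for y by (simp add: X_def)
  define n where "n = nat (\<alpha> mod M)"
  have n: "[int n = \<alpha>] (mod M)" using e_pos by (simp add: n_def)
  have aM: "\<A> [^]\<^bsub>P\<^esub> nat M = \<one>\<^bsub>P\<^esub>"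
    by (rule P_eqI) (simp_all add: P_pow[where F = \<A> and f = step_a, OF lift_step_a] P_one X step_a_period nat_M cong_0_iff)
  have bM: "\<B> [^]\<^bsub>P\<^esub> nat M = \<one>\<^bsub>P\<^esub>"
    by (rule P_eqI) (simp_all add: P_pow[where F = \<B> and f = step_b, OF lift_step_b] P_one X step_b_period nat_M cong_0_iff)
  have aM': "\<A> [^]\<^bsub>P\<^esub> M = \<one>\<^bsub>P\<^esub>" and bM': "\<B> [^]\<^bsub>P\<^esub> M = \<one>\<^bsub>P\<^esub>"
    using aM bM by (metis int_pow_int nat_M(2))+
  have A: "\<A> \<otimes>\<^bsub>P\<^esub> \<C> = \<C> \<otimes>\<^bsub>P\<^esub> \<A> [^]\<^bsub>P\<^esub> n"
    by (rule P_eqI) (simp_all add: P_mult X P_pow[where F = \<A> and f = step_a, OF lift_step_a] lift_step_a \<C>_cls step_a_step_c[OF n])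
  have B: "\<C> \<otimes>\<^bsub>P\<^esub> \<B> = \<B> [^]\<^bsub>P\<^esub> n \<otimes>\<^bsub>P\<^esub> \<C>"
    by (rule P_eqI) (simp_all add: P_mult X P_pow[where F = \<B> and f = step_b, OF lift_step_b] lift_step_b \<C>_cls step_c_step_b[OF n])
  have An: "\<A> [^]\<^bsub>P\<^esub> n = \<A> [^]\<^bsub>P\<^esub> \<alpha>" and Bn: "\<B> [^]\<^bsub>P\<^esub> n = \<B> [^]\<^bsub>P\<^esub> \<alpha>"
    using P.int_pow_cong[OF _ aM' n] P.int_pow_cong[OF _ bM' n] by (simp_all add: int_pow_int)
  have C_inv: "inv\<^bsub>P\<^esub> \<C> = inv\<^bsub>P\<^esub> \<B> \<otimes>\<^bsub>P\<^esub> inv\<^bsub>P\<^esub> \<A> \<otimes>\<^bsub>P\<^esub> \<B> \<otimes>\<^bsub>P\<^esub> \<A>"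
    by (simp add: \<C>_def P.inv_mult_group P.m_assoc)
  show ?thesis
  proof (unfold_locales, goal_cases)
    case 3
    have "inv\<^bsub>P\<^esub> \<C> \<otimes>\<^bsub>P\<^esub> (\<A> \<otimes>\<^bsub>P\<^esub> \<C>) = \<A> [^]\<^bsub>P\<^esub> \<alpha>"
      unfolding A An by (simp flip: P.m_assoc)
    then show ?case unfolding \<C>_def[symmetric] by (simp add: P.m_assoc)
  next
    case 4
    have "\<C> \<otimes>\<^bsub>P\<^esub> \<B> \<otimes>\<^bsub>P\<^esub> inv\<^bsub>P\<^esub> \<C> = \<B> [^]\<^bsub>P\<^esub> \<alpha>"
      unfolding B Bn by (simp add: P.m_assoc)
    then show ?case unfolding C_inv[symmetric] by simp
  qed (simp_all add: aM' bM')
qed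

end

section \<open>The normal form in J\<close>

lemma word_eval_presented:
  "word_eval (presented_group R) (\<lambda>g. pres_class R [(g, True)]) w = pres_class R w"
proof (induction w)
  case Nil
  then show ?case by (simp add: word_eval_def presented_group_def)
next
  case (Cons x w)
  interpret group "presented_group R" by (rule group_presented_group)
  have cl: "pres_class R v \<in> carrier (presented_group R)" for v by (simp add: presented_group_def)
  have inv: "inv\<^bsub>presented_group R\<^esub> pres_class R [(g, True)] = pres_class R [(g, False)]" for g
  proof (rule inv_equality)
    show "pres_class R [(g, False)] \<otimes>\<^bsub>presented_group R\<^esub> pres_class R [(g, True)] = \<one>\<^bsub>presented_group R\<^esub>"
      using pres_cancel[of R g False]
      by (simp add: pres_class_mult) (simp add: presented_group_def pres_class_eq_iff)
  qed (rule cl)+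
  obtain g p where x: "x = (g, p)" by (cases x)
  show ?case
    by (cases p) (simp_all add: word_eval_Cons Cons x inv pres_class_mult)
qed

context group begin

lemma word_eval_comm:
  assumes "\<And>g. f g \<in> carrier G"
  shows "word_eval G f (word_comm u v)
    = inv (word_eval G f u) \<otimes> inv (word_eval G f v) \<otimes> word_eval G f u \<otimes> word_eval G f v"
  unfolding word_comm_def using assms
  by (simp add: word_eval_append word_eval_inv word_eval_closed m_assoc)

lemma word_eval_conj:
  assumes "\<And>g. f g \<in> carrier G"
  shows "word_eval G f (word_conj u v) = inv (word_eval G f v) \<otimes> word_eval G f u \<otimes> word_eval G f v"
  unfolding word_conj_def using assms
  by (simp add: word_eval_append word_eval_inv word_eval_closed m_assoc)

end

text \<open>
  The parameters of \<open>J\<close>, with \<open>k + 1\<close> in place of \<open>m\<close>, so that \<open>2\<^bsup>m-1\<^esup>\<close> is the plain power \<open>2\<^sup>k\<close>.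
\<close>

locale J_params = fixes k :: nat and l :: int
  assumes k: "k \<ge> 1" and odd: "odd l"
begin

abbreviation "m \<equiv> Suc k"
abbreviation "e \<equiv> (2::int) ^ k"
abbreviation "JJ \<equiv> J m l"
abbreviation "a \<equiv> J_A m l"
abbreviation "b \<equiv> J_B m l"

sublocale dyadic k e l
  using k odd by unfold_locales auto

lemma powers_of_two: "(2::int) ^ m = 2 * e" "(2::int) ^ (3 * m - 1) = M"
proof -
  have "3 * m - 1 = 2 + k * 3" by simp
  then have "(2::int) ^ (3 * m - 1) = 2\<^sup>2 * e ^ 3" by (simp only: power_add power_mult)
  then show "(2::int) ^ m = 2 * e" "(2::int) ^ (3 * m - 1) = M" by simp_all
qed

lemma J_rels_eq:
  "J_rels m l =
     {(word_conj [(GenA, True)] (word_comm [(GenA, True)] [(GenB, True)]), word_pow [(GenA, True)] \<alpha>),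
      (word_conj [(GenB, True)] (word_comm [(GenB, True)] [(GenA, True)]), word_pow [(GenB, True)] \<alpha>),
      (word_pow [(GenA, True)] M, []), (word_pow [(GenB, True)] M, [])}"
  unfolding J_rels_def Let_def powers_of_two ..

text \<open>
  The universal property of \<open>J\<close>, phrased for the locale; it supplies the map to the permutation
  model, the interchange of \<open>A\<close> and \<open>B\<close>, and the automorphisms \<open>\<Psi>\<^bsub>(x,y)\<^esub>\<close>.
\<close>

lemma J_hom_exists:
  fixes G (structure)
  assumes "macdonald_group k e l G x y"
  shows "\<exists>\<phi>\<in>hom JJ G. \<phi> a = x \<and> \<phi> b = y"
proof -
  interpret G: macdonald_group k e l G x y by (rule assms)
  define f where "f = case_J_gen x y"
  have f: "f g \<in> carrier G" for g by (cases g) (simp_all add: f_def)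
  have gen: "word_eval G f [(GenA, True)] = x" "word_eval G f [(GenB, True)] = y"
    by (simp_all add: word_eval_def f_def)
  note ev = G.word_eval_comm[OF f] G.word_eval_conj[OF f] G.word_eval_pow[OF f] gen
  have nil: "word_eval G f [] = \<one>" by (simp add: word_eval_def)
  have "word_eval G f u = word_eval G f v" if "(u, v) \<in> J_rels m l" for u v
  proof -
    have "word_eval G f (word_conj [(GenA, True)] (word_comm [(GenA, True)] [(GenB, True)]))
       = word_eval G f (word_pow [(GenA, True)] \<alpha>)"
      using G.rel_a by (simp add: ev)
    moreover have "word_eval G f (word_conj [(GenB, True)] (word_comm [(GenB, True)] [(GenA, True)]))
       = word_eval G f (word_pow [(GenB, True)] \<alpha>)"
      using G.rel_b by (simp add: ev)
    moreover have "word_eval G f (word_pow [(GenA, True)] M) = word_eval G f []"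
      "word_eval G f (word_pow [(GenB, True)] M) = word_eval G f []"
      by (simp_all only: ev nil G.a_M G.b_M)
    ultimately show ?thesis
      using that unfolding J_rels_eq by blast
  qed
  from presented_group_universal[OF G.is_group f this]
  obtain \<phi> where "\<phi> \<in> hom JJ G" and \<phi>: "\<And>g. \<phi> (pres_class (J_rels m l) [(g, True)]) = f g"
    unfolding J_def by blast
  moreover have "\<phi> a = x" "\<phi> b = y" by (simp_all add: J_A_def J_B_def \<phi>) (simp_all add: f_def)
  ultimately show ?thesis by blast
qed

lemma JJ_group: "group JJ"
  unfolding J_def by (rule group_presented_group)

lemma JJ_eval: "word_eval JJ (\<lambda>g. pres_class (J_rels m l) [(g, True)]) w = pres_class (J_rels m l) w"
  unfolding J_def by (rule word_eval_presented)

sublocale macdonald_group k e l JJ a b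
proof -
  interpret G: group JJ unfolding J_def by (rule group_presented_group)
  define f where "f = (\<lambda>g. pres_class (J_rels m l) [(g, True)])"
  have f: "f g \<in> carrier JJ" for g by (simp add: f_def J_def presented_group_def)
  have gen: "word_eval JJ f [(GenA, True)] = a" "word_eval JJ f [(GenB, True)] = b"
    by (simp_all add: JJ_eval f_def J_A_def J_B_def)
  note ev = G.word_eval_comm[OF f] G.word_eval_conj[OF f] G.word_eval_pow[OF f] gen
  have nil: "word_eval JJ f [] = \<one>\<^bsub>JJ\<^esub>" by (simp add: word_eval_def)
  have ab [simp]: "a \<in> carrier JJ" "b \<in> carrier JJ"
    using f[of GenA] f[of GenB] by (simp_all add: f_def J_A_def J_B_def)
  have rel: "word_eval JJ f u = word_eval JJ f v" if "(u, v) \<in> J_rels m l" for u v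
    unfolding f_def JJ_eval pres_class_eq_iff using that by (rule pres_rel)
  show "macdonald_group k e l JJ a b"
  proof (unfold_locales, goal_cases)
    case 3
    have "word_eval JJ f (word_conj [(GenA, True)] (word_comm [(GenA, True)] [(GenB, True)]))
       = word_eval JJ f (word_pow [(GenA, True)] \<alpha>)"
      by (rule rel) (simp only: J_rels_eq insert_iff simp_thms)
    then show ?case by (simp add: ev)
  next
    case 4
    have "word_eval JJ f (word_conj [(GenB, True)] (word_comm [(GenB, True)] [(GenA, True)]))
       = word_eval JJ f (word_pow [(GenB, True)] \<alpha>)"
      by (rule rel) (simp only: J_rels_eq insert_iff simp_thms)
    then show ?case by (simp add: ev)
  next
    case 5
    have "word_eval JJ f (word_pow [(GenA, True)] M) = word_eval JJ f []"
      by (rule rel) (simp only: J_rels_eq insert_iff simp_thms)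
    then show ?case by (simp add: ev nil)
  next
    case 6
    have "word_eval JJ f (word_pow [(GenB, True)] M) = word_eval JJ f []"
      by (rule rel) (simp only: J_rels_eq insert_iff simp_thms)
    then show ?case by (simp add: ev nil)
  qed simp_all
qed

text \<open>
  The elements of the form \<open>B\<^sup>j A\<^sup>i C\<^sup>t\<close> contain \<open>1\<close> and are stable under left multiplication by the
  generators and their inverses.
\<close>

lemma JJ_carrier: "carrier JJ = range N"
proof (intro subset_antisym subsetI)
  fix x assume "x \<in> carrier JJ"
  then obtain w where "x = pres_class (J_rels m l) w" by (auto simp: J_def presented_group_def)
  moreover have "pres_class (J_rels m l) w \<in> range N"
  proof (induction w)
    case Nil
    have "pres_class (J_rels m l) [] = N (0, 0, 0)"
      unfolding N_0 by (simp add: J_def presented_group_def)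
    then show ?case by simp
  next
    case (Cons y w)
    then obtain z where z: "pres_class (J_rels m l) w = N z" by blast
    obtain g p where y: "y = (g, p)" by (cases y)
    have "pres_class (J_rels m l) (y # w) = word_eval JJ (\<lambda>g. pres_class (J_rels m l) [(g, True)]) (y # w)"
      by (rule JJ_eval[symmetric])
    also have "\<dots> = (if p then pres_class (J_rels m l) [(g, True)] else inv\<^bsub>JJ\<^esub> pres_class (J_rels m l) [(g, True)]) \<otimes>\<^bsub>JJ\<^esub> N z"
      by (simp only: word_eval_Cons y fst_conv snd_conv) (simp only: JJ_eval z)
    finally have eq: "pres_class (J_rels m l) (y # w) = \<dots>" .
    show ?case
    proof (cases g)
      case GenA
      then show ?thesis unfolding eq using a_N[of z] inv_a_N[of z]
        by (cases p) (simp_all add: J_A_def)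
    next
      case GenB
      then show ?thesis unfolding eq using b_N[of z] inv_b_N[of z]
        by (cases p) (simp_all add: J_B_def)
    qed
  qed
  ultimately show "x \<in> range N" by simp
qed auto

text \<open>
  In the permutation model the image of \<open>B\<^sup>j A\<^sup>i C\<^sup>t\<close> sends the class of \<open>(0, 0, 0)\<close> to the class of
  \<open>(j, i, t)\<close>, so the class can be read off from the group element.
\<close>

lemma N_inj: "N x = N y \<longleftrightarrow> cls x = cls y"
proof
  assume eq: "N x = N y"
  interpret Mo: macdonald_group k e l P \<A> \<B> by (rule model_relations)
  obtain \<phi> where \<phi>: "\<phi> \<in> hom JJ P" "\<phi> a = \<A>" "\<phi> b = \<B>"
    using J_hom_exists[OF model_relations] by blast
  interpret \<phi>: group_hom JJ P \<phi>
    using \<phi>(1) JJ_group by (simp add: group_hom_def group_hom_axioms_def Mo.is_group)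
  have \<phi>c: "\<phi> c = Mo.c" by (simp add: c_def Mo.c_def \<phi>)
  have \<phi>N: "\<phi> (N z) = Mo.N z" for z
    by (cases z) (simp add: N_def Mo.N_def \<phi> \<phi>c \<phi>.hom_int_pow)
  have Moc: "Mo.c = \<C>" by (simp add: Mo.c_def \<C>_def)
  have base: "Mo.N z (cls (0, 0, 0)) = cls z" for z
  proof -
    obtain j i t where z: "z = (j, i, t)" by (cases z)
    define j' i' t' where "j' = nat (j mod M)" and "i' = nat (i mod M)" and "t' = nat (t mod (2 * h))"
    have z': "cls (int j', int i', int t') = cls z"
      unfolding z j'_def i'_def t'_def using e_pos by (intro cls_eqI) (simp_all del: power_mult_numeral)
    have X: "cls y \<in> X" for y by (simp add: X_def)
    have c: "(step_c ^^ n) (0, 0, 0) = (0, 0, int n)" for n by (induction n) (auto simp: step_c_def)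
    have a: "(step_a ^^ n) (0, 0, t) = (0, int n, t)" for n t by (induction n) (auto simp: step_a_def s_def)
    have b: "(step_b ^^ n) (0, i, t) = (int n, i, t)" for n i t by (induction n) (auto simp: step_b_def)
    have C: "\<C> \<in> carrier P" using Mo.c_closed by (simp add: Moc)
    have "Mo.N z (cls (0, 0, 0)) = Mo.N (int j', int i', int t') (cls (0, 0, 0))"
      by (rule fun_cong[OF Mo.N_cong[OF z'[symmetric]]])
    also have "\<dots> = cls (int j', int i', int t')"
      by (simp add: Mo.N_def int_pow_int Moc P_mult X C
            P_pow[where F = \<A> and f = step_a, OF lift_step_a] P_pow[where F = \<B> and f = step_b, OF lift_step_b]
            P_pow[where F = \<C> and f = step_c, OF \<C>_cls] a b c)
    finally show ?thesis by (simp add: z')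
  qed
  show "cls x = cls y" using eq \<phi>N[of x] \<phi>N[of y] base[of x] base[of y] by simp
qed (rule N_cong)

end

section \<open>Elements that are central modulo the centre\<close>

lemma (in normal) center_FactGroup_iff:
  assumes "x \<in> carrier G"
  shows "H #> x \<in> center (G Mod H) \<longleftrightarrow> (\<forall>g\<in>carrier G. \<exists>z\<in>H. x \<otimes> g = z \<otimes> (g \<otimes> x))"
proof -
  have "H #> (x \<otimes> g) = H #> (g \<otimes> x) \<longleftrightarrow> (\<exists>z\<in>H. x \<otimes> g = z \<otimes> (g \<otimes> x))" if "g \<in> carrier G" for g
  proof
    assume "H #> (x \<otimes> g) = H #> (g \<otimes> x)"
    then have "x \<otimes> g \<in> H #> (g \<otimes> x)" using rcos_self[OF _ is_subgroup, of "x \<otimes> g"] assms that by simp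
    then show "\<exists>z\<in>H. x \<otimes> g = z \<otimes> (g \<otimes> x)" by (auto simp: r_coset_def)
  next
    assume "\<exists>z\<in>H. x \<otimes> g = z \<otimes> (g \<otimes> x)"
    then have "x \<otimes> g \<in> H #> (g \<otimes> x)" by (auto simp: r_coset_def)
    then show "H #> (x \<otimes> g) = H #> (g \<otimes> x)"
      using repr_independence[of "x \<otimes> g" H "g \<otimes> x"] assms that is_subgroup by simp
  qed
  then show ?thesis
    using assms by (auto simp: center_def carrier_FactGroup rcos_sum)
qed

context dyadic begin

lemma e_dvd_odd: "odd u \<Longrightarrow> e dvd u * x \<longleftrightarrow> e dvd x"
  unfolding e_def by (rule power2_dvd_odd_mult)

lemma h_dvd_odd: "odd u \<Longrightarrow> h dvd u * x \<longleftrightarrow> h dvd x"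
proof -
  assume "odd u"
  have h: "h = 2 ^ (k * 2 + 1)" by (simp add: e_def power_mult power_add)
  show ?thesis unfolding h using \<open>odd u\<close> by (rule power2_dvd_odd_mult)
qed

text \<open>
  The factor \<open>1 - e (l (t + 1))\<close> is odd because \<open>e\<close> is even, so the \<open>2\<close>-adic valuation of
  \<open>1 - E t\<close> is that of \<open>2 e t\<close>.
\<close>

lemma one_minus_E: "1 - E t = 2 * e * (l * ((1 - e * (l * (t + 1))) * t))"
  unfolding E_def by algebra

lemma odd_factor: "odd (1 - e * (l * (t + 1)))"
  using even_e by simp

lemma E_cong_1_h: "M dvd (1 - E t) - h * u \<Longrightarrow> e dvd t"
proof -
  assume "M dvd (1 - E t) - h * u"
  then obtain q where "(1 - E t) - h * u = M * q" by blast
  then have "2 * e * (l * ((1 - e * (l * (t + 1))) * t)) = 2 * e * (e * (2 * e * q + u))"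
    unfolding one_minus_E by algebra
  then have "l * ((1 - e * (l * (t + 1))) * t) = e * (2 * e * q + u)" using e_pos by simp
  then have "e dvd l * ((1 - e * (l * (t + 1))) * t)" by simp
  then show ?thesis by (simp only: e_dvd_odd[OF odd_l] e_dvd_odd[OF odd_factor])
qed

lemma E_cong_1_M: "M dvd 1 - E t \<Longrightarrow> h dvd t"
proof -
  assume "M dvd 1 - E t"
  then obtain q where "1 - E t = M * q" by blast
  then have "2 * e * (l * ((1 - e * (l * (t + 1))) * t)) = 2 * e * (h * q)"
    unfolding one_minus_E by algebra
  moreover have "2 * e \<noteq> 0" using e_pos by simp
  ultimately have "l * ((1 - e * (l * (t + 1))) * t) = h * q" by (metis mult_cancel_left)
  then have "h dvd l * ((1 - e * (l * (t + 1))) * t)" by simp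
  then show ?thesis by (simp only: h_dvd_odd[OF odd_l] h_dvd_odd[OF odd_factor])
qed

end

context macdonald_group begin

lemma c_h_eq_a_h: "c [^] (h * w) = a [^] (h * (e * w))" for w :: int
proof -
  have "2 * e ^ 3 * w = h * (e * w)" by algebra
  then show ?thesis by (simp only: c_h_eq_a)
qed

text \<open>
  The sets \<open>\<langle>a\<^sup>h\<rangle>\<close> and \<open>\<langle>a\<^sup>h, c\<^sup>e\<rangle>\<close>, which turn out to be the first two terms of the upper central
  series of \<open>J\<close>.
\<close>

definition Z1 where "Z1 = {a [^] (h * u) | u :: int. True}"
definition Z2 where "Z2 = {a [^] (h * u) \<otimes> c [^] (e * v) | u v :: int. True}"

lemma Z1_I: "a [^] (h * u) \<in> Z1" for u :: int by (auto simp: Z1_def)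
lemma Z1_E: assumes "z \<in> Z1" obtains u :: int where "z = a [^] (h * u)" using assms by (auto simp: Z1_def)

lemma Z2_I: "a [^] (h * u) \<otimes> c [^] (e * v) \<in> Z2" for u v :: int by (auto simp: Z2_def)
lemma Z2_E: assumes "x \<in> Z2" obtains u v :: int where "x = a [^] (h * u) \<otimes> c [^] (e * v)"
  using assms by (auto simp: Z2_def)

lemma Z1_closed: "z \<in> Z1 \<Longrightarrow> z \<in> carrier G" by (auto simp: Z1_def)
lemma Z2_closed: "z \<in> Z2 \<Longrightarrow> z \<in> carrier G" by (auto simp: Z2_def)

lemma Z1_subset_Z2: "Z1 \<subseteq> Z2"
proof
  fix z assume "z \<in> Z1"
  then obtain u where "z = a [^] (h * u)" by (rule Z1_E)
  then show "z \<in> Z2" using Z2_I[of u 0] by simp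
qed

lemma subgroup_Z1: "subgroup Z1 G"
proof (rule subgroupI)
  show "Z1 \<noteq> {}" using Z1_I by blast
  show "Z1 \<subseteq> carrier G" using Z1_closed by blast
next
  fix x assume "x \<in> Z1"
  then obtain u where "x = a [^] (h * u)" by (rule Z1_E)
  then have "inv x = a [^] (h * - u)" by (simp add: int_pow_neg)
  then show "inv x \<in> Z1" by (simp only: Z1_I)
next
  fix x y assume "x \<in> Z1" "y \<in> Z1"
  then obtain u v where "x = a [^] (h * u)" "y = a [^] (h * v)" by (metis Z1_E)
  then have "x \<otimes> y = a [^] (h * (u + v))" by (simp add: distrib_left int_pow_mult)
  then show "x \<otimes> y \<in> Z1" by (simp only: Z1_I)
qed

lemma Z1_commute_N: "z \<in> Z1 \<Longrightarrow> z \<otimes> N x = N x \<otimes> z"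
proof (erule Z1_E)
  fix u assume z: "z = a [^] (h * u)"
  obtain j i t where x: "x = (j, i, t)" by (cases x)
  have "z \<otimes> N x = (z \<otimes> b [^] j) \<otimes> a [^] i \<otimes> c [^] t" by (simp add: x N_def z m_assoc)
  also have "\<dots> = b [^] j \<otimes> (a [^] (h * u) \<otimes> a [^] i) \<otimes> c [^] t" unfolding z a_h_commute_b by (simp add: m_assoc)
  also have "\<dots> = b [^] j \<otimes> a [^] i \<otimes> (a [^] (h * u) \<otimes> c [^] t)" unfolding a_h_commute_a by (simp add: m_assoc)
  also have "\<dots> = N x \<otimes> z" unfolding a_h_commute_c[symmetric] by (simp add: x N_def z m_assoc)
  finally show ?thesis .
qed

lemma Z1_mult_N: "a [^] (h * u) \<otimes> N (j, i, t) = N (j, h * u + i, t)" for u :: int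
proof -
  have "a [^] (h * u) \<otimes> N (j, i, t) = (a [^] (h * u) \<otimes> b [^] j) \<otimes> a [^] i \<otimes> c [^] t"
    by (simp add: N_def m_assoc)
  then show ?thesis unfolding a_h_commute_b by (simp add: N_def int_pow_mult m_assoc)
qed

lemma E_multiple_e: obtains q where "E (e * v) = 1 + h * q"
proof
  show "E (e * v) = 1 + h * (l\<^sup>2 * (e * v * (e * v + 1)) - l * v)"
    unfolding E_def by algebra
qed

text \<open>
  Conjugation by \<open>c\<^bsup>e v\<^esup>\<close> raises \<open>a\<close> and \<open>b\<close> to powers congruent to \<open>1\<close> modulo \<open>h\<close>.
\<close>

lemma c_e_commute_N: "\<exists>z\<in>Z1. c [^] (e * v) \<otimes> N x = z \<otimes> (N x \<otimes> c [^] (e * v))" for v :: int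
proof -
  obtain j i t where x: "x = (j, i, t)" by (cases x)
  obtain q where q: "E (e * v) = 1 + h * q" by (rule E_multiple_e)
  obtain r where r: "E (e * (- v)) = 1 + h * r" by (rule E_multiple_e)
  have "c [^] (e * v) \<otimes> N x = (c [^] (e * v) \<otimes> b [^] j) \<otimes> a [^] i \<otimes> c [^] t"
    by (simp add: x N_def m_assoc)
  also have "\<dots> = b [^] (E (- (e * v)) * j) \<otimes> (c [^] (e * v) \<otimes> a [^] i) \<otimes> c [^] t"
    unfolding c_pow_b by (simp add: m_assoc)
  also have "\<dots> = b [^] (E (- (e * v)) * j) \<otimes> a [^] (E (e * v) * i) \<otimes> (c [^] (e * v) \<otimes> c [^] t)"
    unfolding c_pow_a by (simp add: m_assoc)
  also have "c [^] (e * v) \<otimes> c [^] t = c [^] t \<otimes> c [^] (e * v)"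
    by (simp add: add.commute flip: int_pow_mult)
  also have "b [^] (E (- (e * v)) * j) = b [^] (- (h * (- (r * j)))) \<otimes> b [^] j"
    using r by (simp add: algebra_simps flip: int_pow_mult)
  also have "b [^] (- (h * (- (r * j)))) = a [^] (h * (- (r * j)))" by (rule a_h_eq_b[symmetric])
  also have "E (e * v) * i = h * (q * i) + i" using q by (simp add: algebra_simps)
  also have "a [^] (h * (- (r * j))) \<otimes> b [^] j \<otimes> a [^] (h * (q * i) + i) \<otimes> (c [^] t \<otimes> c [^] (e * v))
     = a [^] (h * (- (r * j))) \<otimes> (b [^] j \<otimes> a [^] (h * (q * i))) \<otimes> a [^] i \<otimes> c [^] t \<otimes> c [^] (e * v)"
    by (simp add: int_pow_mult m_assoc del: mult_minus_right)
  also have "\<dots> = (a [^] (h * (- (r * j))) \<otimes> a [^] (h * (q * i))) \<otimes> (N x \<otimes> c [^] (e * v))"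
    unfolding a_h_commute_b[symmetric] by (simp add: x N_def m_assoc del: mult_minus_right)
  finally show ?thesis
    using subgroup.m_closed[OF subgroup_Z1 Z1_I Z1_I] by blast
qed

end

context J_params begin

lemma Z1_commute: "z \<in> Z1 \<Longrightarrow> g \<in> carrier JJ \<Longrightarrow> z \<otimes>\<^bsub>JJ\<^esub> g = g \<otimes>\<^bsub>JJ\<^esub> z"
  using Z1_commute_N by (auto simp: JJ_carrier)

lemma Z2_commute: "x \<in> Z2 \<Longrightarrow> g \<in> carrier JJ \<Longrightarrow> \<exists>z\<in>Z1. x \<otimes>\<^bsub>JJ\<^esub> g = z \<otimes>\<^bsub>JJ\<^esub> (g \<otimes>\<^bsub>JJ\<^esub> x)"
proof -
  assume x: "x \<in> Z2" and g: "g \<in> carrier JJ"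
  from x obtain u v where uv: "x = a [^]\<^bsub>JJ\<^esub> (h * u) \<otimes>\<^bsub>JJ\<^esub> c [^]\<^bsub>JJ\<^esub> (e * v)" by (rule Z2_E)
  define y where "y = a [^]\<^bsub>JJ\<^esub> (h * u)"
  define d where "d = c [^]\<^bsub>JJ\<^esub> (e * v)"
  have [simp]: "y \<in> carrier JJ" "d \<in> carrier JJ" by (simp_all add: y_def d_def)
  have y: "y \<in> Z1" unfolding y_def by (rule Z1_I)
  obtain z where z: "z \<in> Z1" "d \<otimes>\<^bsub>JJ\<^esub> g = z \<otimes>\<^bsub>JJ\<^esub> (g \<otimes>\<^bsub>JJ\<^esub> d)"
    using c_e_commute_N g unfolding JJ_carrier d_def by blast
  have [simp]: "z \<in> carrier JJ" using z Z1_closed by blast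
  have "x \<otimes>\<^bsub>JJ\<^esub> g = y \<otimes>\<^bsub>JJ\<^esub> (z \<otimes>\<^bsub>JJ\<^esub> (g \<otimes>\<^bsub>JJ\<^esub> d))"
    using g by (simp add: uv y_def[symmetric] d_def[symmetric] m_assoc z(2))
  also have "\<dots> = z \<otimes>\<^bsub>JJ\<^esub> ((y \<otimes>\<^bsub>JJ\<^esub> g) \<otimes>\<^bsub>JJ\<^esub> d)"
    using g Z1_commute[OF y, of z] by (simp flip: m_assoc)
  also have "\<dots> = z \<otimes>\<^bsub>JJ\<^esub> (g \<otimes>\<^bsub>JJ\<^esub> x)"
    using g unfolding Z1_commute[OF y g] by (simp add: uv y_def[symmetric] d_def[symmetric] m_assoc)
  finally show ?thesis using z(1) by blast
qed

lemma subgroup_generated: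
  assumes "subgroup H JJ" "a \<in> H" "b \<in> H"
  shows "H = carrier JJ"
proof -
  interpret H: subgroup H JJ by (rule assms)
  have pow: "x [^]\<^bsub>JJ\<^esub> (n::int) \<in> H" if "x \<in> H" for x n
    using subgroup_int_pow_closed[OF assms(1) that] .
  have "c \<in> H" unfolding c_def using assms by simp
  then have "N x \<in> H" for x
    using assms pow by (cases x) (simp add: N_def)
  then show ?thesis using H.subset by (auto simp: JJ_carrier)
qed

lemma a_pow_eq_iff: "a [^]\<^bsub>JJ\<^esub> (i::int) = a [^]\<^bsub>JJ\<^esub> i' \<longleftrightarrow> [i = i'] (mod M)"
proof
  assume "a [^]\<^bsub>JJ\<^esub> i = a [^]\<^bsub>JJ\<^esub> i'"
  then have "N (0, i, 0) = N (0, i', 0)" by (simp add: N_def)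
  then show "[i = i'] (mod M)" unfolding N_inj cls_eq_iff by simp
qed (rule a_cong)

text \<open>
  Comparing the classes of \<open>A x\<close> and \<open>z x A\<close> shows that \<open>h\<close> divides \<open>s j\<close> (exponents of \<open>B\<close>) as well
  as \<open>j + s j\<close> (exponents of \<open>C\<close>).
\<close>

lemma commute_mod_Z1_a:
  assumes "a \<otimes>\<^bsub>JJ\<^esub> N (j, i, t) = a [^]\<^bsub>JJ\<^esub> (h * u) \<otimes>\<^bsub>JJ\<^esub> (N (j, i, t) \<otimes>\<^bsub>JJ\<^esub> a)"
  shows "h dvd j"
proof -
  have "c [^]\<^bsub>JJ\<^esub> t \<otimes>\<^bsub>JJ\<^esub> a = a [^]\<^bsub>JJ\<^esub> E t \<otimes>\<^bsub>JJ\<^esub> c [^]\<^bsub>JJ\<^esub> t" using c_pow_a[of t 1] by simp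
  then have "N (j, i, t) \<otimes>\<^bsub>JJ\<^esub> a = N (j, i + E t, t)"
    by (simp add: N_def m_assoc int_pow_mult)
  then have "N (step_a (j, i, t)) = N (j, h * u + (i + E t), t)"
    using assms by (simp add: a_N Z1_mult_N)
  then have "[j + s j = j] (mod h)" "[t + (j + s j) = t] (mod h)"
    by (simp_all add: N_inj step_a_def cls_eq_iff)
  then have "h dvd s j" "h dvd j + s j" by (simp_all add: cong_iff_dvd_diff)
  then show ?thesis by (simp add: dvd_add_left_iff)
qed

lemma swap_hom: obtains \<theta> where "\<theta> \<in> hom JJ JJ" "\<theta> a = b" "\<theta> b = a"
  using J_hom_exists[OF swap] by blast

text \<open>
  The previous lemma allows \<open>j = 0\<close>. Applying it to the image of \<open>x = A\<^sup>i C\<^sup>t\<close> under the interchange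
  of \<open>A\<close> and \<open>B\<close> shows that \<open>h\<close> divides \<open>i\<close>. What remains is a condition on \<open>C\<^sup>t\<close>, which is read
  off from the exponent \<open>E t\<close> of \<open>C\<^sup>t A C\<^bsup>-t\<^esup>\<close>.
\<close>

lemma commute_mod_Z1:
  assumes x: "x \<in> carrier JJ"
    and xa: "a \<otimes>\<^bsub>JJ\<^esub> x = a [^]\<^bsub>JJ\<^esub> (h * u) \<otimes>\<^bsub>JJ\<^esub> (x \<otimes>\<^bsub>JJ\<^esub> a)"
    and xb: "b \<otimes>\<^bsub>JJ\<^esub> x = a [^]\<^bsub>JJ\<^esub> (h * v) \<otimes>\<^bsub>JJ\<^esub> (x \<otimes>\<^bsub>JJ\<^esub> b)"
  shows "x \<in> Z2" and "[h * u = 0] (mod M) \<Longrightarrow> x \<in> Z1"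
proof -
  obtain j i t where jit: "x = N (j, i, t)" using x unfolding JJ_carrier by (metis imageE prod_cases3)
  have "h dvd j" using xa unfolding jit by (rule commute_mod_Z1_a)
  then obtain q where q: "j = h * q" by blast
  (* b^(h q) = a^(- h q) *)
  define i' where "i' = i - h * q"
  have "cls (0, i', t) = cls (0 + h * q, i, t + h * 0)" by (rule cls_shift) (simp add: i'_def)
  then have "N (0, i', t) = N (h * q, i, t)" by (intro N_cong) simp
  then have x1: "x = a [^]\<^bsub>JJ\<^esub> i' \<otimes>\<^bsub>JJ\<^esub> c [^]\<^bsub>JJ\<^esub> t" unfolding jit q by (simp add: N_def)
  obtain \<theta> where \<theta>: "\<theta> \<in> hom JJ JJ" "\<theta> a = b" "\<theta> b = a" by (rule swap_hom)
  interpret \<theta>: group_hom JJ JJ \<theta>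
    using \<theta>(1) JJ_group by (simp add: group_hom_def group_hom_axioms_def)
  have "\<theta> c = inv\<^bsub>JJ\<^esub> c" unfolding inv_c by (simp add: c_def \<theta>)
  then have \<theta>x: "\<theta> x = N (i', 0, - t)"
    by (simp add: x1 N_def \<theta> \<theta>.hom_int_pow int_pow_neg int_pow_inv)
  have "a \<otimes>\<^bsub>JJ\<^esub> \<theta> x = \<theta> (b \<otimes>\<^bsub>JJ\<^esub> x)" using x by (simp add: \<theta>)
  also have "\<dots> = b [^]\<^bsub>JJ\<^esub> (h * v) \<otimes>\<^bsub>JJ\<^esub> (\<theta> x \<otimes>\<^bsub>JJ\<^esub> a)" unfolding xb using x by (simp add: \<theta> \<theta>.hom_int_pow)
  also have "b [^]\<^bsub>JJ\<^esub> (h * v) = a [^]\<^bsub>JJ\<^esub> (h * - v)" using a_h_eq_b[of "- v"] by simp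
  finally have "h dvd i'" unfolding \<theta>x by (rule commute_mod_Z1_a)
  then obtain r where r: "i' = h * r" by blast
  have "c [^]\<^bsub>JJ\<^esub> t \<otimes>\<^bsub>JJ\<^esub> a = a [^]\<^bsub>JJ\<^esub> E t \<otimes>\<^bsub>JJ\<^esub> c [^]\<^bsub>JJ\<^esub> t" using c_pow_a[of t 1] by simp
  then have xa': "x \<otimes>\<^bsub>JJ\<^esub> a = a [^]\<^bsub>JJ\<^esub> (i' + E t) \<otimes>\<^bsub>JJ\<^esub> c [^]\<^bsub>JJ\<^esub> t"
    by (simp add: x1 m_assoc int_pow_mult)
  have "a [^]\<^bsub>JJ\<^esub> (1 + i') \<otimes>\<^bsub>JJ\<^esub> c [^]\<^bsub>JJ\<^esub> t = a [^]\<^bsub>JJ\<^esub> (h * u + (i' + E t)) \<otimes>\<^bsub>JJ\<^esub> c [^]\<^bsub>JJ\<^esub> t"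
    using xa unfolding xa' by (simp add: x1 int_pow_mult m_assoc)
  then have "a [^]\<^bsub>JJ\<^esub> (1 + i') = a [^]\<^bsub>JJ\<^esub> (h * u + (i' + E t))" by simp
  then have "M dvd (1 + i') - (h * u + (i' + E t))" unfolding a_pow_eq_iff cong_iff_dvd_diff .
  moreover have "(1 + i') - (h * u + (i' + E t)) = (1 - E t) - h * u" by simp
  ultimately have main: "M dvd (1 - E t) - h * u" by simp
  then have "e dvd t" by (rule E_cong_1_h)
  then show "x \<in> Z2" unfolding x1 r using Z2_I by (metis dvdE)
  assume "[h * u = 0] (mod M)"
  then have "M dvd h * u" by (simp add: cong_0_iff)
  from dvd_add[OF main this] have "M dvd 1 - E t" by simp
  then have "h dvd t" by (rule E_cong_1_M)
  then obtain w where "t = h * w" by blast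
  then have "x = a [^]\<^bsub>JJ\<^esub> (h * (r + e * w))"
    unfolding x1 r by (simp only: c_h_eq_a_h distrib_left int_pow_mult[OF a_closed])
  then show "x \<in> Z1" by (simp only: Z1_I)
qed

end

section \<open>Generators modified by elements of the second centre\<close>

context dyadic begin

lemma E_multiple_e_mod_M: "[E (e * (v * n)) = 1 + (2 * e ^ 3 * l\<^sup>2 * v - h * l * v) * n] (mod M)"
proof -
  obtain f where f: "e = 2 * f" by (rule e_twice)
  show ?thesis
    by (rule cong_witness[where k = "f * l\<^sup>2 * v\<^sup>2 * n\<^sup>2"]) (unfold E_def, use f in algebra)
qed

text \<open>
  The exponent of \<open>a\<close> in \<open>(a x)\<^sup>n\<close> for \<open>x = a\<^bsup>h u\<^esup> c\<^bsup>e v\<^esup>\<close>.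
\<close>

definition pow_exp :: "int \<Rightarrow> int \<Rightarrow> int \<Rightarrow> int" where
  "pow_exp u v n = n + h * u * n + (2 * e ^ 3 * l\<^sup>2 * v - h * l * v) * tri n"

lemma pow_exp_Suc: "[pow_exp u v (n + 1) = pow_exp u v n + E (e * (v * n)) * (1 + h * u)] (mod M)"
proof -
  have "[E (e * (v * n)) * (1 + h * u) = (1 + (2 * e ^ 3 * l\<^sup>2 * v - h * l * v) * n) * (1 + h * u)] (mod M)"
    by (intro cong_mult cong_refl E_multiple_e_mod_M)
  also have "[(1 + (2 * e ^ 3 * l\<^sup>2 * v - h * l * v) * n) * (1 + h * u) = pow_exp u v (n + 1) - pow_exp u v n] (mod M)"
    unfolding cong_iff_dvd_diff pow_exp_def tri_Suc by algebra
  finally have "[pow_exp u v n + E (e * (v * n)) * (1 + h * u) = pow_exp u v n + (pow_exp u v (n + 1) - pow_exp u v n)] (mod M)"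
    by (intro cong_add cong_refl)
  then show ?thesis by (simp add: cong_sym_eq)
qed

lemma pow_exp_alpha: "[pow_exp u v \<alpha> = \<alpha> + h * u - 2 * e ^ 3 * l * v] (mod M)"
proof -
  obtain f where f: "e = 2 * f" by (rule e_twice)
  obtain g where g: "l = 2 * g + 1" using odd_l by (rule oddE)
  have "2 * tri \<alpha> = 2 * (e * l * \<alpha>)" unfolding tri_double by algebra
  then have t: "tri \<alpha> = e * l * \<alpha>" by simp
  have "[pow_exp u v \<alpha> = \<alpha> + h * u - 2 * e ^ 3 * l\<^sup>2 * v] (mod M)"
    by (rule cong_witness[where k = "u * l - e * l ^ 3 * v + f * l ^ 3 * v + e\<^sup>2 * l ^ 4 * v"])
       (unfold pow_exp_def t, use f in algebra)
  also have "[\<alpha> + h * u - 2 * e ^ 3 * l\<^sup>2 * v = \<alpha> + h * u - 2 * e ^ 3 * l * v] (mod M)"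
    unfolding cong_iff_dvd_diff g by algebra
  finally show ?thesis .
qed

lemma pow_exp_h: "[pow_exp u v (h * r) = h * r] (mod M)"
proof -
  obtain f where f: "e = 2 * f" by (rule e_twice)
  have "2 * tri (h * r) = 2 * (e\<^sup>2 * r * (h * r - 1))" unfolding tri_double by algebra
  then have t: "tri (h * r) = e\<^sup>2 * r * (h * r - 1)" by simp
  show ?thesis unfolding cong_iff_dvd_diff pow_exp_def t unfolding f by algebra
qed

end

text \<open>
  An integer power is determined by its recursion; the formula for \<open>(a x)\<^sup>n\<close> is needed for
  negative \<open>n\<close> too, since \<open>\<alpha>\<close> may be negative.
\<close>

lemma (in group) int_pow_eqI:
  assumes "y \<in> carrier G" "\<And>n::int. F n \<in> carrier G" "F 0 = \<one>" "\<And>n. F (n + 1) = F n \<otimes> y"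
  shows "y [^] (n::int) = F n"
proof (induction n rule: int_induct[where k = 0])
  case base then show ?case using assms by simp
next
  case (step1 i)
  then show ?case using assms int_pow_mult[of y i 1] by simp
next
  case (step2 i)
  have "y [^] (i - 1) \<otimes> y = y [^] i" using assms(1) int_pow_mult[of y "i - 1" 1] by simp
  also have "\<dots> = F (i - 1) \<otimes> y" using step2.IH assms(4)[of "i - 1"] by simp
  finally show ?case using assms(1,2) by simp
qed

context macdonald_group begin

lemma swap_Z2: "macdonald_group.Z2 e G b a = Z2"
proof -
  interpret sw: macdonald_group k e l G b a by (rule swap)
  show ?thesis
  proof (intro subset_antisym subsetI)
    fix x assume "x \<in> sw.Z2"
    then obtain u v where "x = b [^] (h * u) \<otimes> (inv c) [^] (e * v)" unfolding swap_c[symmetric] by (rule sw.Z2_E)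
    then have "x = a [^] (h * - u) \<otimes> c [^] (e * - v)" using a_h_eq_b[of "- u"] by (simp add: int_pow_inv int_pow_neg)
    then show "x \<in> Z2" by (simp only: Z2_I)
  next
    fix x assume "x \<in> Z2"
    then obtain u v where "x = a [^] (h * u) \<otimes> c [^] (e * v)" by (rule Z2_E)
    then have "x = b [^] (h * - u) \<otimes> (inv c) [^] (e * - v)" using a_h_eq_b[of u] by (simp add: int_pow_inv int_pow_neg)
    then show "x \<in> sw.Z2" unfolding swap_c[symmetric] by (simp only: sw.Z2_I)
  qed
qed

lemma Z2_c: "x \<in> Z2 \<Longrightarrow> x \<otimes> c = c \<otimes> x"
proof (erule Z2_E)
  fix u v assume x: "x = a [^] (h * u) \<otimes> c [^] (e * v)"
  have c: "c [^] (e * v) \<otimes> c = c \<otimes> c [^] (e * v)"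
    using int_pow_mult[of c "e * v" 1] int_pow_mult[of c 1 "e * v"] by (simp add: add.commute)
  have "x \<otimes> c = (a [^] (h * u) \<otimes> c) \<otimes> c [^] (e * v)" by (simp add: x m_assoc c)
  also have "a [^] (h * u) \<otimes> c = c \<otimes> a [^] (h * u)" using a_h_commute_c[of 1 u] by simp
  finally show ?thesis by (simp add: x m_assoc)
qed

lemma Z2_mult:
  "a [^] (h * u) \<otimes> c [^] (e * v) \<otimes> (a [^] (h * u') \<otimes> c [^] (e * v'))
    = a [^] (h * (u + u')) \<otimes> c [^] (e * (v + v'))" for u v u' v' :: int
proof -
  have "a [^] (h * u) \<otimes> c [^] (e * v) \<otimes> (a [^] (h * u') \<otimes> c [^] (e * v'))
   = a [^] (h * u) \<otimes> (c [^] (e * v) \<otimes> a [^] (h * u')) \<otimes> c [^] (e * v')" by (simp add: m_assoc)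
  then show ?thesis unfolding a_h_commute_c by (simp add: int_pow_mult m_assoc distrib_left)
qed

lemma Z2_commutative: "x \<in> Z2 \<Longrightarrow> y \<in> Z2 \<Longrightarrow> x \<otimes> y = y \<otimes> x"
  by (elim Z2_E) (simp only: Z2_mult add.commute)

lemma pow_a_Z2:
  assumes x: "x = a [^] (h * u) \<otimes> c [^] (e * v)"
  shows "(a \<otimes> x) [^] (n::int) = a [^] pow_exp u v n \<otimes> c [^] (e * (v * n))"
proof (rule int_pow_eqI)
  show "a [^] pow_exp u v 0 \<otimes> c [^] (e * (v * 0)) = \<one>" by (simp add: pow_exp_def)
  fix n :: int
  have ax: "a \<otimes> x = a [^] (1 + h * u) \<otimes> c [^] (e * v)" by (simp add: x int_pow_mult m_assoc)
  have "a [^] pow_exp u v n \<otimes> c [^] (e * (v * n)) \<otimes> (a \<otimes> x)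
     = a [^] pow_exp u v n \<otimes> (c [^] (e * (v * n)) \<otimes> a [^] (1 + h * u)) \<otimes> c [^] (e * v)"
    unfolding ax by (simp add: m_assoc)
  also have "\<dots> = (a [^] pow_exp u v n \<otimes> a [^] (E (e * (v * n)) * (1 + h * u))) \<otimes> (c [^] (e * (v * n)) \<otimes> c [^] (e * v))"
    unfolding c_pow_a by (simp add: m_assoc)
  also have "c [^] (e * (v * n)) \<otimes> c [^] (e * v) = c [^] (e * (v * (n + 1)))"
    by (simp add: distrib_left flip: int_pow_mult)
  also have "a [^] pow_exp u v n \<otimes> a [^] (E (e * (v * n)) * (1 + h * u)) = a [^] (pow_exp u v (n + 1))"
    unfolding int_pow_mult[OF a_closed, symmetric] by (rule a_cong[OF cong_sym[OF pow_exp_Suc]])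
  finally show "a [^] pow_exp u v (n + 1) \<otimes> c [^] (e * (v * (n + 1))) = a [^] pow_exp u v n \<otimes> c [^] (e * (v * n)) \<otimes> (a \<otimes> x)" ..
qed (simp_all add: x)

text \<open>
  The exponent of \<open>a\<close> in \<open>(a x)\<^sup>\<alpha>\<close> deviates from that of \<open>a\<^sup>\<alpha> x\<close> by \<open>(M/2) l v\<close>, which is a trace of
  the commutator \<open>[x, a]\<close>. The excess \<open>c\<^bsup>e v \<lambda>\<^esup> = c\<^bsup>h l v\<^esup> = a\<^bsup>(M/2) l v\<^esup>\<close> compensates for it.
\<close>

lemma a_Z2_pow_alpha:
  assumes "x \<in> Z2"
  shows "(a \<otimes> x) [^] \<alpha> = inv c \<otimes> (a \<otimes> x) \<otimes> c"
proof -
  from assms obtain u v where x: "x = a [^] (h * u) \<otimes> c [^] (e * v)" by (rule Z2_E)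
  have "e * (v * \<alpha>) = h * (l * v) + e * v" by algebra
  then have "c [^] (e * (v * \<alpha>)) = a [^] (h * (e * (l * v))) \<otimes> c [^] (e * v)"
    by (simp only: int_pow_mult[OF c_closed] c_h_eq_a_h)
  then have "(a \<otimes> x) [^] \<alpha> = a [^] (\<alpha> + h * u - 2 * e ^ 3 * l * v) \<otimes> (a [^] (h * (e * (l * v))) \<otimes> c [^] (e * v))"
    unfolding pow_a_Z2[OF x] a_cong[OF pow_exp_alpha] by simp
  also have "\<dots> = a [^] ((\<alpha> + h * u - 2 * e ^ 3 * l * v) + h * (e * (l * v))) \<otimes> c [^] (e * v)"
    unfolding int_pow_mult[OF a_closed] by (simp add: m_assoc)
  also have "(\<alpha> + h * u - 2 * e ^ 3 * l * v) + h * (e * (l * v)) = \<alpha> + h * u" by algebra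
  also have "a [^] (\<alpha> + h * u) \<otimes> c [^] (e * v) = a [^] \<alpha> \<otimes> x"
    unfolding int_pow_mult[OF a_closed] x by (simp add: m_assoc)
  finally have 1: "(a \<otimes> x) [^] \<alpha> = a [^] \<alpha> \<otimes> x" .
  have [simp]: "x \<in> carrier G" using assms by (rule Z2_closed)
  have "inv c \<otimes> (a \<otimes> x) \<otimes> c = inv c \<otimes> (a \<otimes> c) \<otimes> x" using Z2_c[OF assms] by (simp add: m_assoc)
  also have "\<dots> = a [^] \<alpha> \<otimes> x" unfolding c_conj_a_1 by (simp flip: m_assoc)
  finally show ?thesis using 1 by simp
qed

lemma a_Z2_pow_h:
  fixes r :: int
  assumes "x \<in> Z2"
  shows "(a \<otimes> x) [^] (h * r) = a [^] (h * r)"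
proof -
  from assms obtain u v where x: "x = a [^] (h * u) \<otimes> c [^] (e * v)" by (rule Z2_E)
  obtain f where f: "e = 2 * f" by (rule e_twice)
  have "e * (v * (h * r)) = h * (e * (v * r))" by algebra
  then have "c [^] (e * (v * (h * r))) = a [^] (h * (e * (e * (v * r))))" by (simp only: c_h_eq_a_h)
  also have "\<dots> = a [^] (0::int)"
    by (rule a_cong, rule cong_witness[where k = "f * v * r"]) (use f in algebra)
  finally show ?thesis unfolding pow_a_Z2[OF x] a_cong[OF pow_exp_h] by simp
qed

lemma a_Z2_M: "x \<in> Z2 \<Longrightarrow> (a \<otimes> x) [^] M = \<one>"
proof -
  assume "x \<in> Z2"
  moreover have "M = h * (2 * e)" by algebra
  ultimately show ?thesis using a_Z2_pow_h[of x "2 * e"] a_M by simp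
qed

text \<open>
  Bilinearity of commutators modulo the centre: \<open>[a x, b y] = [a, b] [x, b] [a, y]\<close> with the last two
  factors in \<open>Z1\<close>, because \<open>x\<close> and \<open>y\<close> commute with each other and with \<open>c\<close>.
\<close>

lemma commutator_Z2:
  assumes comm: "\<And>x g. x \<in> Z2 \<Longrightarrow> g \<in> carrier G \<Longrightarrow> \<exists>z\<in>Z1. x \<otimes> g = z \<otimes> (g \<otimes> x)"
    and cent: "\<And>z g. z \<in> Z1 \<Longrightarrow> g \<in> carrier G \<Longrightarrow> z \<otimes> g = g \<otimes> z"
    and x: "x \<in> Z2" and y: "y \<in> Z2"
  shows "\<exists>z\<in>Z1. inv (a \<otimes> x) \<otimes> inv (b \<otimes> y) \<otimes> (a \<otimes> x) \<otimes> (b \<otimes> y) = c \<otimes> z"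
proof -
  have [simp]: "x \<in> carrier G" "y \<in> carrier G" using x y Z2_closed by auto
  obtain z where z: "z \<in> Z1" "x \<otimes> b = z \<otimes> (b \<otimes> x)" using comm[OF x b_closed] by blast
  obtain w where w: "w \<in> Z1" "y \<otimes> a = w \<otimes> (a \<otimes> y)" using comm[OF y a_closed] by blast
  have [simp]: "z \<in> carrier G" "w \<in> carrier G" using z w Z1_closed by auto
  define d where "d = b \<otimes> a \<otimes> x \<otimes> y"
  have [simp]: "d \<in> carrier G" by (simp add: d_def)
  have "(a \<otimes> x) \<otimes> (b \<otimes> y) = a \<otimes> (x \<otimes> b) \<otimes> y" by (simp add: m_assoc)
  also have "\<dots> = (a \<otimes> z) \<otimes> b \<otimes> x \<otimes> y" unfolding z by (simp add: m_assoc)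
  also have "\<dots> = z \<otimes> (a \<otimes> b) \<otimes> x \<otimes> y" unfolding cent[OF z(1) a_closed, symmetric] by (simp add: m_assoc)
  also have "\<dots> = z \<otimes> (b \<otimes> a \<otimes> (c \<otimes> x) \<otimes> y)" unfolding a_b by (simp add: m_assoc)
  also have "\<dots> = z \<otimes> (b \<otimes> a \<otimes> x \<otimes> (c \<otimes> y))" unfolding Z2_c[OF x, symmetric] by (simp add: m_assoc)
  also have "\<dots> = z \<otimes> (d \<otimes> c)" unfolding Z2_c[OF y, symmetric] by (simp add: d_def m_assoc)
  finally have 1: "(a \<otimes> x) \<otimes> (b \<otimes> y) = z \<otimes> (d \<otimes> c)" .
  have "(b \<otimes> y) \<otimes> (a \<otimes> x) = b \<otimes> (y \<otimes> a) \<otimes> x" by (simp add: m_assoc)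
  also have "\<dots> = (b \<otimes> w) \<otimes> a \<otimes> (y \<otimes> x)" unfolding w by (simp add: m_assoc)
  also have "\<dots> = w \<otimes> d" unfolding cent[OF w(1) b_closed, symmetric] using Z2_commutative[OF x y] by (simp add: d_def m_assoc)
  finally have 2: "(b \<otimes> y) \<otimes> (a \<otimes> x) = w \<otimes> d" .
  have "inv (a \<otimes> x) \<otimes> inv (b \<otimes> y) \<otimes> (a \<otimes> x) \<otimes> (b \<otimes> y)
     = inv ((b \<otimes> y) \<otimes> (a \<otimes> x)) \<otimes> ((a \<otimes> x) \<otimes> (b \<otimes> y))"
    by (simp add: inv_mult_group m_assoc)
  also have "\<dots> = inv (w \<otimes> d) \<otimes> (z \<otimes> (d \<otimes> c))" unfolding 1 2 ..
  also have "\<dots> = inv d \<otimes> inv w \<otimes> ((d \<otimes> c) \<otimes> z)"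
    using cent[OF z(1), of "d \<otimes> c"] by (simp add: inv_mult_group)
  also have "inv w \<otimes> ((d \<otimes> c) \<otimes> z) = d \<otimes> c \<otimes> (inv w \<otimes> z)"
    using cent[OF subgroup.m_inv_closed[OF subgroup_Z1 w(1)], of "d \<otimes> c"] by (simp flip: m_assoc)
  then have "inv d \<otimes> inv w \<otimes> ((d \<otimes> c) \<otimes> z) = c \<otimes> (inv w \<otimes> z)"
    by (simp add: m_assoc) (simp flip: m_assoc)
  finally show ?thesis
    using subgroup.m_closed[OF subgroup_Z1 subgroup.m_inv_closed[OF subgroup_Z1 w(1)] z(1)] by blast
qed

lemma relations_mod_Z2:
  assumes comm: "\<And>x g. x \<in> Z2 \<Longrightarrow> g \<in> carrier G \<Longrightarrow> \<exists>z\<in>Z1. x \<otimes> g = z \<otimes> (g \<otimes> x)"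
    and cent: "\<And>z g. z \<in> Z1 \<Longrightarrow> g \<in> carrier G \<Longrightarrow> z \<otimes> g = g \<otimes> z"
    and x: "x \<in> Z2" and y: "y \<in> Z2"
  shows "macdonald_group k e l G (a \<otimes> x) (b \<otimes> y)"
proof -
  interpret sw: macdonald_group k e l G b a by (rule swap)
  have y': "y \<in> sw.Z2" using y by (simp add: swap_Z2)
  have [simp]: "x \<in> carrier G" "y \<in> carrier G" using x y Z2_closed by auto
  obtain z where z: "z \<in> Z1" and C: "inv (a \<otimes> x) \<otimes> inv (b \<otimes> y) \<otimes> (a \<otimes> x) \<otimes> (b \<otimes> y) = c \<otimes> z"
    using commutator_Z2[OF assms] by blast
  have [simp]: "z \<in> carrier G" using z Z1_closed by auto
  have C': "inv (b \<otimes> y) \<otimes> inv (a \<otimes> x) \<otimes> (b \<otimes> y) \<otimes> (a \<otimes> x) = inv (c \<otimes> z)"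
    unfolding C[symmetric] by (simp add: inv_mult_group m_assoc)
  have conj: "inv (d \<otimes> w) \<otimes> g \<otimes> (d \<otimes> w) = inv d \<otimes> g \<otimes> d"
    if "w \<in> Z1" "d \<in> carrier G" "g \<in> carrier G" for d w g
  proof -
    have [simp]: "w \<in> carrier G" using that Z1_closed by auto
    have "inv (d \<otimes> w) \<otimes> g \<otimes> (d \<otimes> w) = inv w \<otimes> ((inv d \<otimes> g \<otimes> d) \<otimes> w)"
      using that by (simp add: inv_mult_group m_assoc)
    also have "\<dots> = inv d \<otimes> g \<otimes> d"
      using that cent[OF \<open>w \<in> Z1\<close>, of "inv d \<otimes> g \<otimes> d", symmetric] by (simp flip: m_assoc)
    finally show ?thesis .
  qed
  have iz: "inv z \<in> Z1" using z by (rule subgroup.m_inv_closed[OF subgroup_Z1])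
  have icz: "inv (c \<otimes> z) = inv c \<otimes> inv z"
    using cent[OF iz, of "inv c"] by (simp add: inv_mult_group)
  show ?thesis
  proof (unfold_locales, goal_cases)
    case 3
    show ?case unfolding C using conj[OF z, of c "a \<otimes> x"] a_Z2_pow_alpha[OF x] by simp
  next
    case 4
    show ?case unfolding C' icz using conj[OF iz, of "inv c" "b \<otimes> y"] sw.a_Z2_pow_alpha[OF y'] by (simp add: swap_c)
  next
    case 5 show ?case by (rule a_Z2_M[OF x])
  next
    case 6 show ?case by (rule sw.a_Z2_M[OF y'])
  qed simp_all
qed

end

section \<open>Automorphisms that are trivial modulo a normal subgroup\<close>

context group begin

lemma AutoGroup_carrier: "carrier (AutoGroup G) = auto G"
  by (simp add: AutoGroup_def)

lemma AutoGroup_mult: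
  "\<phi> \<in> auto G \<Longrightarrow> \<psi> \<in> auto G \<Longrightarrow> g \<in> carrier G \<Longrightarrow> (\<phi> \<otimes>\<^bsub>AutoGroup G\<^esub> \<psi>) g = \<phi> (\<psi> g)"
  by (simp add: AutoGroup_def BijGroup_def auto_def compose_def)

lemma AutoGroup_one: "g \<in> carrier G \<Longrightarrow> \<one>\<^bsub>AutoGroup G\<^esub> g = g"
  by (simp add: AutoGroup_def BijGroup_def)

lemma auto_closed: "\<phi> \<in> auto G \<Longrightarrow> g \<in> carrier G \<Longrightarrow> \<phi> g \<in> carrier G"
  by (auto simp: auto_def hom_def)

lemma auto_mult: "\<phi> \<in> auto G \<Longrightarrow> g \<in> carrier G \<Longrightarrow> g' \<in> carrier G \<Longrightarrow> \<phi> (g \<otimes> g') = \<phi> g \<otimes> \<phi> g'"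
  by (auto simp: auto_def hom_def)

lemma auto_eqI:
  assumes "\<phi> \<in> auto G" "\<psi> \<in> auto G" "\<And>g. g \<in> carrier G \<Longrightarrow> \<phi> g = \<psi> g"
  shows "\<phi> = \<psi>"
  using assms by (intro extensionalityI[where A = "carrier G"]) (auto simp: auto_def Bij_def)

lemma auto_surj: "\<phi> \<in> auto G \<Longrightarrow> g \<in> carrier G \<Longrightarrow> \<exists>g'\<in>carrier G. g = \<phi> g'"
  by (auto simp: auto_def Bij_def bij_betw_def)

lemma auto_inv:
  assumes "\<phi> \<in> auto G"
  shows "inv\<^bsub>AutoGroup G\<^esub> \<phi> \<in> auto G"
    and "g \<in> carrier G \<Longrightarrow> \<phi> ((inv\<^bsub>AutoGroup G\<^esub> \<phi>) g) = g"
proof -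
  interpret A: group "AutoGroup G" by (rule AutoGroup)
  show inv: "inv\<^bsub>AutoGroup G\<^esub> \<phi> \<in> auto G"
    using A.inv_closed[of \<phi>] assms by (simp add: AutoGroup_carrier)
  assume "g \<in> carrier G"
  then show "\<phi> ((inv\<^bsub>AutoGroup G\<^esub> \<phi>) g) = g"
    using A.r_inv[of \<phi>] assms inv AutoGroup_mult[of \<phi> "inv\<^bsub>AutoGroup G\<^esub> \<phi>" g] AutoGroup_one[of g]
    by (simp add: AutoGroup_carrier)
qed

text \<open>
  For normal \<open>H\<close> these are the automorphisms that induce the identity on \<open>G / H\<close>.
\<close>

definition near_id :: "'a set \<Rightarrow> ('a \<Rightarrow> 'a) set" where
  "near_id H = {\<phi> \<in> auto G. \<forall>g\<in>carrier G. \<phi> g \<in> H #> g}"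

lemma near_idI: "\<phi> \<in> auto G \<Longrightarrow> (\<And>g. g \<in> carrier G \<Longrightarrow> \<phi> g \<in> H #> g) \<Longrightarrow> \<phi> \<in> near_id H"
  by (simp add: near_id_def)

lemma near_id_auto: "\<phi> \<in> near_id H \<Longrightarrow> \<phi> \<in> auto G"
  by (simp add: near_id_def)

lemma near_id_coset: "\<phi> \<in> near_id H \<Longrightarrow> g \<in> carrier G \<Longrightarrow> \<phi> g \<in> H #> g"
  by (simp add: near_id_def)

end

context normal begin

lemma coset_trans: "x \<in> H #> y \<Longrightarrow> y \<in> H #> z \<Longrightarrow> z \<in> carrier G \<Longrightarrow> x \<in> H #> z"
  using repr_independence[of y H z] is_subgroup by auto

lemma coset_sym: "x \<in> H #> y \<Longrightarrow> y \<in> carrier G \<Longrightarrow> y \<in> H #> x"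
  using repr_independence[of x H y] is_subgroup rcos_self[OF _ is_subgroup, of y] by auto

lemma near_id_image_coset:
  assumes \<phi>: "\<phi> \<in> near_id H" and C: "C \<in> carrier (G Mod H)"
  shows "\<phi> ` C = C"
proof -
  obtain g where g: "g \<in> carrier G" and Cg: "C = H #> g" using C by (auto simp: carrier_FactGroup)
  have sub: "H #> g \<subseteq> carrier G" using g by (simp add: r_coset_subset_G subset)
  show ?thesis unfolding Cg
  proof (intro subset_antisym subsetI)
    fix x assume "x \<in> \<phi> ` (H #> g)"
    then obtain y where y: "y \<in> H #> g" "x = \<phi> y" by blast
    then have "x \<in> H #> y" using near_id_coset[OF \<phi>, of y] sub by blast
    then show "x \<in> H #> g" using y(1) g by (rule coset_trans)
  next
    fix x assume x: "x \<in> H #> g"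
    then obtain y where y: "y \<in> carrier G" "x = \<phi> y" using auto_surj[OF near_id_auto[OF \<phi>], of x] sub by blast
    then have "x \<in> H #> y" using near_id_coset[OF \<phi>, of y] by simp
    then have "y \<in> H #> x" using y(1) by (rule coset_sym)
    then have "y \<in> H #> g" using x g by (rule coset_trans)
    then show "x \<in> \<phi> ` (H #> g)" using y(2) by blast
  qed
qed

lemma kernel_induced_auto:
  "kernel (AutoGroup G) (AutoGroup (G Mod H)) (induced_auto G H) = near_id H"
proof (intro subset_antisym subsetI)
  fix \<phi> assume "\<phi> \<in> kernel (AutoGroup G) (AutoGroup (G Mod H)) (induced_auto G H)"
  then have \<phi>: "\<phi> \<in> auto G" and eq: "induced_auto G H \<phi> = (\<lambda>C\<in>carrier (G Mod H). C)"
    by (auto simp: kernel_def AutoGroup_def BijGroup_def)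
  show "\<phi> \<in> near_id H"
  proof (rule near_idI[OF \<phi>])
    fix g assume g: "g \<in> carrier G"
    then have C: "H #> g \<in> carrier (G Mod H)" by (auto simp: carrier_FactGroup)
    have "\<phi> ` (H #> g) = H #> g" using fun_cong[OF eq, of "H #> g"] C by (simp add: induced_auto_def)
    moreover have "g \<in> H #> g" using g is_subgroup by (rule rcos_self)
    ultimately show "\<phi> g \<in> H #> g" by blast
  qed
next
  fix \<phi> assume \<phi>: "\<phi> \<in> near_id H"
  then have "induced_auto G H \<phi> = (\<lambda>C\<in>carrier (G Mod H). C)"
    unfolding induced_auto_def by (intro restrict_ext) (rule near_id_image_coset)
  then show "\<phi> \<in> kernel (AutoGroup G) (AutoGroup (G Mod H)) (induced_auto G H)"
    using near_id_auto[OF \<phi>] by (simp add: kernel_def AutoGroup_def BijGroup_def)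
qed

lemma subgroup_near_id: "subgroup (near_id H) (AutoGroup G)"
proof -
  interpret A: group "AutoGroup G" by (rule AutoGroup)
  show ?thesis
  proof (rule A.subgroupI)
    show "near_id H \<subseteq> carrier (AutoGroup G)" by (auto simp: AutoGroup_carrier near_id_auto)
    have "\<one>\<^bsub>AutoGroup G\<^esub> \<in> near_id H"
      using A.one_closed by (intro near_idI) (simp_all add: AutoGroup_carrier AutoGroup_one rcos_self is_subgroup)
    then show "near_id H \<noteq> {}" by blast
  next
    fix \<phi> assume \<phi>: "\<phi> \<in> near_id H"
    note \<phi>' = near_id_auto[OF \<phi>]
    show "inv\<^bsub>AutoGroup G\<^esub> \<phi> \<in> near_id H"
    proof (rule near_idI)
      show "inv\<^bsub>AutoGroup G\<^esub> \<phi> \<in> auto G" by (rule auto_inv(1)[OF \<phi>'])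
      fix g assume g: "g \<in> carrier G"
      have cl: "(inv\<^bsub>AutoGroup G\<^esub> \<phi>) g \<in> carrier G" using auto_closed[OF auto_inv(1)[OF \<phi>'] g] .
      show "(inv\<^bsub>AutoGroup G\<^esub> \<phi>) g \<in> H #> g"
        using near_id_coset[OF \<phi> cl] cl unfolding auto_inv(2)[OF \<phi>' g] by (rule coset_sym)
    qed
  next
    fix \<phi> \<psi> assume \<phi>: "\<phi> \<in> near_id H" and \<psi>: "\<psi> \<in> near_id H"
    show "\<phi> \<otimes>\<^bsub>AutoGroup G\<^esub> \<psi> \<in> near_id H"
    proof (rule near_idI)
      show "\<phi> \<otimes>\<^bsub>AutoGroup G\<^esub> \<psi> \<in> auto G"
        using A.m_closed[of \<phi> \<psi>] \<phi> \<psi> by (simp add: AutoGroup_carrier near_id_auto)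
      fix g assume g: "g \<in> carrier G"
      have "\<phi> (\<psi> g) \<in> H #> \<psi> g" using \<phi> auto_closed[OF near_id_auto[OF \<psi>] g] by (rule near_id_coset)
      then have "\<phi> (\<psi> g) \<in> H #> g" using near_id_coset[OF \<psi> g] g by (rule coset_trans)
      then show "(\<phi> \<otimes>\<^bsub>AutoGroup G\<^esub> \<psi>) g \<in> H #> g"
        using \<phi> \<psi> g by (simp add: AutoGroup_mult near_id_auto)
    qed
  qed
qed

end

lemma (in group) near_id_mono: "H \<subseteq> H' \<Longrightarrow> near_id H \<subseteq> near_id H'"
  unfolding near_id_def r_coset_def by blast

text \<open>
  If the automorphisms trivial modulo \<open>H'\<close> fix \<open>H\<close> pointwise, then they normalise the group of
  those trivial modulo \<open>H\<close>, and cosets are determined by the action modulo \<open>H\<close>: replacing \<open>g\<close> by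
  \<open>\<psi> g\<close> turns \<open>\<phi> \<psi>\<^sup>-\<^sup>1 g \<in> H g\<close> into \<open>\<phi> g \<in> H (\<psi> g)\<close>.
\<close>

lemma (in group) near_id_quotient:
  assumes H: "H \<lhd> G" and H': "H' \<lhd> G" and sub: "H \<subseteq> H'"
    and fix_H: "\<And>\<phi> z. \<phi> \<in> near_id H' \<Longrightarrow> z \<in> H \<Longrightarrow> \<phi> z = z"
  defines "T \<equiv> (AutoGroup G)\<lparr>carrier := near_id H'\<rparr>"
  shows "near_id H \<lhd> T"
    and "\<phi> \<in> near_id H' \<Longrightarrow> \<psi> \<in> near_id H' \<Longrightarrow>
      near_id H #>\<^bsub>T\<^esub> \<phi> = near_id H #>\<^bsub>T\<^esub> \<psi> \<longleftrightarrow> (\<forall>g\<in>carrier G. \<phi> g \<in> H #> \<psi> g)"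
proof -
  interpret A: group "AutoGroup G" by (rule AutoGroup)
  interpret H: normal H G by (rule H)
  interpret H': normal H' G by (rule H')
  have T: "group T" unfolding T_def by (rule A.subgroup_imp_group[OF H'.subgroup_near_id])
  interpret T: group T by (rule T)
  have Tc: "carrier T = near_id H'" by (simp add: T_def)
  have Tm: "\<phi> \<otimes>\<^bsub>T\<^esub> \<psi> = \<phi> \<otimes>\<^bsub>AutoGroup G\<^esub> \<psi>" for \<phi> \<psi> by (simp add: T_def)
  have Tmul: "(\<phi> \<otimes>\<^bsub>T\<^esub> \<psi>) g = \<phi> (\<psi> g)" if "\<phi> \<in> near_id H'" "\<psi> \<in> near_id H'" "g \<in> carrier G" for \<phi> \<psi> g
    using that by (simp add: Tm AutoGroup_mult near_id_auto)
  have Tinv: "inv\<^bsub>T\<^esub> \<phi> = inv\<^bsub>AutoGroup G\<^esub> \<phi>" if "\<phi> \<in> near_id H'" for \<phi>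
    unfolding T_def using that by (intro A.m_inv_consistent[OF H'.subgroup_near_id])
  have inv_r: "\<phi> ((inv\<^bsub>T\<^esub> \<phi>) g) = g" if "\<phi> \<in> near_id H'" "g \<in> carrier G" for \<phi> g
    unfolding Tinv[OF that(1)] using auto_inv(2)[OF near_id_auto[OF that(1)] that(2)] .
  have inv_l: "(inv\<^bsub>T\<^esub> \<phi>) (\<phi> g) = g" if "\<phi> \<in> near_id H'" "g \<in> carrier G" for \<phi> g
  proof -
    have "inv\<^bsub>T\<^esub> \<phi> \<otimes>\<^bsub>T\<^esub> \<phi> = \<one>\<^bsub>AutoGroup G\<^esub>" using T.l_inv[of \<phi>] that Tc by (simp add: T_def)
    moreover have "inv\<^bsub>T\<^esub> \<phi> \<in> near_id H'" using T.inv_closed[of \<phi>] that Tc by simp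
    ultimately show ?thesis using Tmul[of "inv\<^bsub>T\<^esub> \<phi>" \<phi> g] that by (simp add: AutoGroup_one)
  qed
  have invT: "inv\<^bsub>T\<^esub> \<phi> \<in> near_id H'" if "\<phi> \<in> near_id H'" for \<phi>
    using T.inv_closed[of \<phi>] that Tc by simp
  have cl: "\<phi> g \<in> carrier G" if "\<phi> \<in> near_id H'" "g \<in> carrier G" for \<phi> g
    using that by (simp add: auto_closed near_id_auto)
  have KT: "near_id H \<subseteq> near_id H'" using sub by (rule near_id_mono)
  have subK: "subgroup (near_id H) T"
    unfolding T_def using A.subgroup_incl[OF H.subgroup_near_id H'.subgroup_near_id KT] .
  show "near_id H \<lhd> T"
    unfolding T.normal_inv_iff Tc
  proof (intro conjI ballI subK)
    fix \<psi> \<phi> assume \<psi>: "\<psi> \<in> near_id H'" and \<phi>: "\<phi> \<in> near_id H"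
    have \<phi>T: "\<phi> \<in> near_id H'" using \<phi> KT by blast
    have mem: "\<psi> \<otimes>\<^bsub>T\<^esub> \<phi> \<in> near_id H'" "\<psi> \<otimes>\<^bsub>T\<^esub> \<phi> \<otimes>\<^bsub>T\<^esub> inv\<^bsub>T\<^esub> \<psi> \<in> near_id H'"
      using \<psi> \<phi>T T.m_closed T.inv_closed unfolding Tc by auto
    show "\<psi> \<otimes>\<^bsub>T\<^esub> \<phi> \<otimes>\<^bsub>T\<^esub> inv\<^bsub>T\<^esub> \<psi> \<in> near_id H"
    proof (rule near_idI)
      show "\<psi> \<otimes>\<^bsub>T\<^esub> \<phi> \<otimes>\<^bsub>T\<^esub> inv\<^bsub>T\<^esub> \<psi> \<in> auto G" using mem(2) by (rule near_id_auto)
      fix g assume g: "g \<in> carrier G"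
      define y where "y = (inv\<^bsub>T\<^esub> \<psi>) g"
      have y: "y \<in> carrier G" unfolding y_def using invT[OF \<psi>] g by (rule cl)
      obtain z where z: "z \<in> H" "\<phi> y = z \<otimes> y" using near_id_coset[OF \<phi> y] by (auto simp: r_coset_def)
      have "(\<psi> \<otimes>\<^bsub>T\<^esub> \<phi> \<otimes>\<^bsub>T\<^esub> inv\<^bsub>T\<^esub> \<psi>) g = \<psi> (\<phi> y)"
        using Tmul[OF mem(1) invT[OF \<psi>] g] Tmul[OF \<psi> \<phi>T y] by (simp add: y_def)
      also have "\<dots> = \<psi> z \<otimes> \<psi> y"
        unfolding z(2) using near_id_auto[OF \<psi>] z(1) y by (intro auto_mult) (auto dest: H.mem_carrier)
      also have "\<dots> = z \<otimes> g" unfolding fix_H[OF \<psi> z(1)] y_def inv_r[OF \<psi> g] ..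
      finally show "(\<psi> \<otimes>\<^bsub>T\<^esub> \<phi> \<otimes>\<^bsub>T\<^esub> inv\<^bsub>T\<^esub> \<psi>) g \<in> H #> g" using z(1) by (auto simp: r_coset_def)
    qed
  qed
  assume \<phi>: "\<phi> \<in> near_id H'" and \<psi>: "\<psi> \<in> near_id H'"
  interpret K: subgroup "near_id H" T by (rule subK)
  have mem: "\<phi> \<otimes>\<^bsub>T\<^esub> inv\<^bsub>T\<^esub> \<psi> \<in> near_id H'" using \<phi> \<psi> T.m_closed T.inv_closed unfolding Tc by auto
  have "near_id H #>\<^bsub>T\<^esub> \<phi> = near_id H #>\<^bsub>T\<^esub> \<psi> \<longleftrightarrow> \<phi> \<in> near_id H #>\<^bsub>T\<^esub> \<psi>"
    using T.rcos_self[OF _ subK, of \<phi>] T.repr_independence[OF _ _ subK, of \<phi> \<psi>] \<phi> \<psi> unfolding Tc by auto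
  also have "\<dots> \<longleftrightarrow> \<phi> \<otimes>\<^bsub>T\<^esub> inv\<^bsub>T\<^esub> \<psi> \<in> near_id H"
    by (rule K.rcos_module[OF T]) (simp_all add: Tc \<phi> \<psi>)
  also have "\<dots> \<longleftrightarrow> (\<forall>g\<in>carrier G. \<phi> g \<in> H #> \<psi> g)"
  proof
    assume *: "\<phi> \<otimes>\<^bsub>T\<^esub> inv\<^bsub>T\<^esub> \<psi> \<in> near_id H"
    show "\<forall>g\<in>carrier G. \<phi> g \<in> H #> \<psi> g"
    proof
      fix g assume g: "g \<in> carrier G"
      have "(\<phi> \<otimes>\<^bsub>T\<^esub> inv\<^bsub>T\<^esub> \<psi>) (\<psi> g) \<in> H #> \<psi> g" using * cl[OF \<psi> g] by (rule near_id_coset)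
      then show "\<phi> g \<in> H #> \<psi> g"
        unfolding Tmul[OF \<phi> invT[OF \<psi>] cl[OF \<psi> g]] inv_l[OF \<psi> g] .
    qed
  next
    assume *: "\<forall>g\<in>carrier G. \<phi> g \<in> H #> \<psi> g"
    show "\<phi> \<otimes>\<^bsub>T\<^esub> inv\<^bsub>T\<^esub> \<psi> \<in> near_id H"
    proof (rule near_idI)
      show "\<phi> \<otimes>\<^bsub>T\<^esub> inv\<^bsub>T\<^esub> \<psi> \<in> auto G" using mem by (rule near_id_auto)
      fix g assume g: "g \<in> carrier G"
      have y: "(inv\<^bsub>T\<^esub> \<psi>) g \<in> carrier G" using invT[OF \<psi>] g by (rule cl)
      show "(\<phi> \<otimes>\<^bsub>T\<^esub> inv\<^bsub>T\<^esub> \<psi>) g \<in> H #> g"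
        unfolding Tmul[OF \<phi> invT[OF \<psi>] g] using *[rule_format, OF y] unfolding inv_r[OF \<psi> g] .
    qed
  qed
  finally show "near_id H #>\<^bsub>T\<^esub> \<phi> = near_id H #>\<^bsub>T\<^esub> \<psi> \<longleftrightarrow> (\<forall>g\<in>carrier G. \<phi> g \<in> H #> \<psi> g)" .
qed

section \<open>The first two terms of the upper central series\<close>

context dyadic begin

lemma M_eq: "M = h * (2 * e)" by algebra

lemma h_eq: "h = e * (2 * e)" by algebra

end

context macdonald_group begin

lemma subgroup_Z2: "subgroup Z2 G"
proof (rule subgroupI)
  show "Z2 \<noteq> {}" using Z2_I by blast
  show "Z2 \<subseteq> carrier G" using Z2_closed by blast
next
  fix x assume "x \<in> Z2"
  then obtain u v where x: "x = a [^] (h * u) \<otimes> c [^] (e * v)" by (rule Z2_E)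
  have "a [^] (h * - u) \<otimes> c [^] (e * - v) \<otimes> x = \<one>" unfolding x Z2_mult by simp
  then have "inv x = a [^] (h * - u) \<otimes> c [^] (e * - v)" by (rule inv_equality) (simp_all add: x)
  then show "inv x \<in> Z2" by (simp only: Z2_I)
next
  fix x y assume "x \<in> Z2" "y \<in> Z2"
  then obtain u v u' v' where "x = a [^] (h * u) \<otimes> c [^] (e * v)" "y = a [^] (h * u') \<otimes> c [^] (e * v')"
    by (metis Z2_E)
  then show "x \<otimes> y \<in> Z2" by (simp only: Z2_mult Z2_I)
qed

end

context J_params begin

lemma normal_Z1: "Z1 \<lhd> JJ"
  unfolding normal_inv_iff
proof (intro conjI ballI subgroup_Z1)
  fix g z assume g: "g \<in> carrier JJ" and z: "z \<in> Z1"
  have "g \<otimes>\<^bsub>JJ\<^esub> z \<otimes>\<^bsub>JJ\<^esub> inv\<^bsub>JJ\<^esub> g = z"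
    using g Z1_closed[OF z] unfolding Z1_commute[OF z g, symmetric] by (simp add: m_assoc)
  then show "g \<otimes>\<^bsub>JJ\<^esub> z \<otimes>\<^bsub>JJ\<^esub> inv\<^bsub>JJ\<^esub> g \<in> Z1" using z by simp
qed

lemma normal_Z2: "Z2 \<lhd> JJ"
  unfolding normal_inv_iff
proof (intro conjI ballI subgroup_Z2)
  fix g x assume g: "g \<in> carrier JJ" and x: "x \<in> Z2"
  have [simp]: "x \<in> carrier JJ" using x by (rule Z2_closed)
  obtain z where z: "z \<in> Z1" "x \<otimes>\<^bsub>JJ\<^esub> g = z \<otimes>\<^bsub>JJ\<^esub> (g \<otimes>\<^bsub>JJ\<^esub> x)" using Z2_commute[OF x g] by blast
  have [simp]: "z \<in> carrier JJ" using z(1) by (rule Z1_closed)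
  have "inv\<^bsub>JJ\<^esub> z \<otimes>\<^bsub>JJ\<^esub> x = inv\<^bsub>JJ\<^esub> z \<otimes>\<^bsub>JJ\<^esub> (x \<otimes>\<^bsub>JJ\<^esub> g) \<otimes>\<^bsub>JJ\<^esub> inv\<^bsub>JJ\<^esub> g" using g by (simp add: m_assoc)
  also have "\<dots> = g \<otimes>\<^bsub>JJ\<^esub> x \<otimes>\<^bsub>JJ\<^esub> inv\<^bsub>JJ\<^esub> g" unfolding z(2) using g by (simp flip: m_assoc)
  finally show "g \<otimes>\<^bsub>JJ\<^esub> x \<otimes>\<^bsub>JJ\<^esub> inv\<^bsub>JJ\<^esub> g \<in> Z2"
    using subgroup.m_closed[OF subgroup_Z2 subgroup.m_inv_closed[OF subgroup_Z2] x, of z] z(1) Z1_subset_Z2 by auto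
qed

lemma upper_central_1: "upper_central JJ 1 = Z1"
proof -
  interpret N: normal "{\<one>\<^bsub>JJ\<^esub>}" JJ by (rule one_is_normal)
  have U: "upper_central JJ 1 = {x \<in> carrier JJ. \<forall>g\<in>carrier JJ. x \<otimes>\<^bsub>JJ\<^esub> g = g \<otimes>\<^bsub>JJ\<^esub> x}"
    using N.center_FactGroup_iff by auto
  show ?thesis unfolding U
  proof (intro subset_antisym subsetI)
    fix x assume "x \<in> {x \<in> carrier JJ. \<forall>g\<in>carrier JJ. x \<otimes>\<^bsub>JJ\<^esub> g = g \<otimes>\<^bsub>JJ\<^esub> x}"
    then have x: "x \<in> carrier JJ" "x \<otimes>\<^bsub>JJ\<^esub> a = a \<otimes>\<^bsub>JJ\<^esub> x" "x \<otimes>\<^bsub>JJ\<^esub> b = b \<otimes>\<^bsub>JJ\<^esub> x" by auto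
    then show "x \<in> Z1" using commute_mod_Z1(2)[of x 0 0] by simp
  next
    fix x assume "x \<in> Z1"
    then show "x \<in> {x \<in> carrier JJ. \<forall>g\<in>carrier JJ. x \<otimes>\<^bsub>JJ\<^esub> g = g \<otimes>\<^bsub>JJ\<^esub> x}"
      using Z1_closed Z1_commute by auto
  qed
qed

lemma upper_central_2: "upper_central JJ 2 = Z2"
proof -
  interpret N: normal Z1 JJ by (rule normal_Z1)
  have "upper_central JJ 2 = {x \<in> carrier JJ. Z1 #>\<^bsub>JJ\<^esub> x \<in> center (JJ Mod Z1)}"
    using upper_central_1 by (simp add: numeral_2_eq_2)
  then have U: "upper_central JJ 2 = {x \<in> carrier JJ. \<forall>g\<in>carrier JJ. \<exists>z\<in>Z1. x \<otimes>\<^bsub>JJ\<^esub> g = z \<otimes>\<^bsub>JJ\<^esub> (g \<otimes>\<^bsub>JJ\<^esub> x)}"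
    using N.center_FactGroup_iff by auto
  show ?thesis unfolding U
  proof (intro subset_antisym subsetI)
    fix x assume "x \<in> {x \<in> carrier JJ. \<forall>g\<in>carrier JJ. \<exists>z\<in>Z1. x \<otimes>\<^bsub>JJ\<^esub> g = z \<otimes>\<^bsub>JJ\<^esub> (g \<otimes>\<^bsub>JJ\<^esub> x)}"
    then have x: "x \<in> carrier JJ" and *: "\<And>g. g \<in> carrier JJ \<Longrightarrow> \<exists>z\<in>Z1. x \<otimes>\<^bsub>JJ\<^esub> g = z \<otimes>\<^bsub>JJ\<^esub> (g \<otimes>\<^bsub>JJ\<^esub> x)" by auto
    have "\<exists>u. g \<otimes>\<^bsub>JJ\<^esub> x = a [^]\<^bsub>JJ\<^esub> (h * u) \<otimes>\<^bsub>JJ\<^esub> (x \<otimes>\<^bsub>JJ\<^esub> g)" if g: "g \<in> carrier JJ" for g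
    proof -
      obtain z where z: "z \<in> Z1" "x \<otimes>\<^bsub>JJ\<^esub> g = z \<otimes>\<^bsub>JJ\<^esub> (g \<otimes>\<^bsub>JJ\<^esub> x)" using *[OF g] by blast
      have "inv\<^bsub>JJ\<^esub> z \<otimes>\<^bsub>JJ\<^esub> (x \<otimes>\<^bsub>JJ\<^esub> g) = g \<otimes>\<^bsub>JJ\<^esub> x"
        unfolding z(2) using g x Z1_closed[OF z(1)] by (simp flip: m_assoc)
      moreover have "inv\<^bsub>JJ\<^esub> z \<in> Z1" using z(1) by (rule subgroup.m_inv_closed[OF subgroup_Z1])
      ultimately show ?thesis by (metis Z1_E)
    qed
    then obtain u v where "a \<otimes>\<^bsub>JJ\<^esub> x = a [^]\<^bsub>JJ\<^esub> (h * u) \<otimes>\<^bsub>JJ\<^esub> (x \<otimes>\<^bsub>JJ\<^esub> a)"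
      "b \<otimes>\<^bsub>JJ\<^esub> x = a [^]\<^bsub>JJ\<^esub> (h * v) \<otimes>\<^bsub>JJ\<^esub> (x \<otimes>\<^bsub>JJ\<^esub> b)" by (meson a_closed b_closed)
    then show "x \<in> Z2" by (rule commute_mod_Z1(1)[OF x])
  next
    fix x assume "x \<in> Z2"
    then show "x \<in> {x \<in> carrier JJ. \<forall>g\<in>carrier JJ. \<exists>z\<in>Z1. x \<otimes>\<^bsub>JJ\<^esub> g = z \<otimes>\<^bsub>JJ\<^esub> (g \<otimes>\<^bsub>JJ\<^esub> x)}"
      using Z2_closed Z2_commute by auto
  qed
qed

text \<open>
  The exponents \<open>0 \<le> u, v < 2 e\<close> represent each element \<open>A\<^bsup>h u\<^esup> C\<^bsup>e v\<^esup>\<close> once: \<open>A\<^sup>h\<close> has order \<open>2 e\<close> and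
  \<open>C\<^bsup>2 e e\<^esup> = C\<^sup>h\<close> is a power of \<open>A\<^sup>h\<close>.
\<close>

lemma card_Z2: "card Z2 = 2 ^ (2 * m)"
proof -
  define F where "F = (\<lambda>(u, v). a [^]\<^bsub>JJ\<^esub> (h * u) \<otimes>\<^bsub>JJ\<^esub> c [^]\<^bsub>JJ\<^esub> (e * v))"
  define D where "D = {0..<2 * e} \<times> {0..<2 * e}"
  have FN: "F (u, v) = N (0, h * u, e * v)" for u v by (simp add: F_def N_def)
  have "bij_betw F D Z2"
  proof (rule bij_betw_imageI)
    show "inj_on F D"
    proof (rule inj_onI, clarsimp simp: D_def)
      fix u v u' v' assume u: "0 \<le> u" "u < 2 * e" and v: "0 \<le> v" "v < 2 * e"
        and u': "0 \<le> u'" "u' < 2 * e" and v': "0 \<le> v'" "v' < 2 * e" and "F (u, v) = F (u', v')"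
      then have *: "[h * u - e * (e * v) = h * u' - e * (e * v')] (mod M)" "[e * v = e * v'] (mod h)"
        unfolding FN N_inj cls_eq_iff by auto
      from *(2) have "e * (2 * e) dvd e * (v - v')"
        by (simp add: cong_iff_dvd_diff right_diff_distrib power2_eq_square mult.left_commute)
      then have "2 * e dvd v - v'" using e_pos by (simp only: dvd_mult_cancel_left) simp
      then have "v = v'" using v v' by (auto simp: cong_iff_dvd_diff[symmetric] intro: cong_less_imp_eq_int)
      with *(1) have "M dvd h * (u - u')" by (simp add: cong_iff_dvd_diff right_diff_distrib)
      moreover note M_eq
      ultimately have "2 * e dvd u - u'" using e_pos by (simp only: dvd_mult_cancel_left) simp
      then have "u = u'" using u u' by (auto simp: cong_iff_dvd_diff[symmetric] intro: cong_less_imp_eq_int)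
      with \<open>v = v'\<close> show "u = u' \<and> v = v'" by simp
    qed
    show "F ` D = Z2"
    proof (intro subset_antisym subsetI)
      fix x assume "x \<in> F ` D" then show "x \<in> Z2" by (auto simp: F_def Z2_I)
    next
      fix x assume "x \<in> Z2"
      then obtain u v where x: "x = a [^]\<^bsub>JJ\<^esub> (h * u) \<otimes>\<^bsub>JJ\<^esub> c [^]\<^bsub>JJ\<^esub> (e * v)" by (rule Z2_E)
      define q where "q = v div (2 * e)"
      define v' where "v' = v mod (2 * e)"
      (* c^(2 e e q) = c^(h q) = a^(h e q) *)
  define u' where "u' = (u + e * q) mod (2 * e)"
      have v: "v = 2 * e * q + v'" by (simp add: q_def v'_def)
      have "e * v = h * q + e * v'" unfolding v h_eq by (simp add: distrib_left)
      then have "c [^]\<^bsub>JJ\<^esub> (e * v) = a [^]\<^bsub>JJ\<^esub> (h * (e * q)) \<otimes>\<^bsub>JJ\<^esub> c [^]\<^bsub>JJ\<^esub> (e * v')"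
        by (simp only: int_pow_mult[OF c_closed] c_h_eq_a_h)
      then have "x = a [^]\<^bsub>JJ\<^esub> (h * (u + e * q)) \<otimes>\<^bsub>JJ\<^esub> c [^]\<^bsub>JJ\<^esub> (e * v')"
        unfolding x by (simp add: distrib_left int_pow_mult m_assoc)
      also have "a [^]\<^bsub>JJ\<^esub> (h * (u + e * q)) = a [^]\<^bsub>JJ\<^esub> (h * u')"
      proof (rule a_cong)
        obtain r where "u + e * q = u' + 2 * e * r" unfolding u'_def by (metis add.commute mult_div_mod_eq)
        then show "[h * (u + e * q) = h * u'] (mod M)"
          by (intro cong_witness[where k = r]) (simp add: M_eq distrib_left mult.assoc)
      qed
      finally have "x = F (u', v')" by (simp add: F_def)
      moreover have "(u', v') \<in> D" using e_pos by (simp add: D_def u'_def v'_def)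
      ultimately show "x \<in> F ` D" by blast
    qed
  qed
  then have "card Z2 = card D" by (rule bij_betw_same_card[symmetric])
  also have "\<dots> = nat (2 * e) * nat (2 * e)" by (simp add: D_def)
  also have "nat (2 * e) = 2 ^ m" by (simp add: nat_mult_distrib nat_power_eq)
  also have "(2::nat) ^ m * 2 ^ m = 2 ^ (2 * m)" by (simp only: mult_2[of m] power_add)
  finally show ?thesis .
qed

lemma finite_JJ: "finite (carrier JJ)"
proof -
  have "finite ({0..<h} \<times> {0..<M} \<times> {0..<h})" by simp
  moreover have "cls x \<in> {0..<h} \<times> {0..<M} \<times> {0..<h}" for x
    using e_pos by (cases x) (simp add: cls_def)
  ultimately have fin: "finite (range cls)" by (meson finite_subset image_subsetI)
  have "N x \<in> (\<lambda>p. N (SOME y. cls y = p)) ` range cls" for x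
  proof (rule image_eqI[where x = "cls x"])
    have "cls (SOME y. cls y = cls x) = cls x" by (rule someI[where P = "\<lambda>y. cls y = cls x", OF refl])
    then show "N x = N (SOME y. cls y = cls x)" by (simp add: N_inj)
  qed simp
  then have "range N \<subseteq> (\<lambda>p. N (SOME y. cls y = p)) ` range cls" by blast
  then show ?thesis unfolding JJ_carrier using fin finite_surj by blast
qed

section \<open>The 2-central automorphisms\<close>

text \<open>
  Two endomorphisms agree modulo \<open>H\<close> as soon as they do so on \<open>A\<close> and \<open>B\<close>. It is used with the
  trivial subgroup, with \<open>Z1\<close> and with \<open>Z2\<close>.
\<close>

lemma hom_agree:
  assumes "\<phi> \<in> hom JJ JJ" and normal: "H \<lhd> JJ"
    and a: "\<phi> a \<in> H #>\<^bsub>JJ\<^esub> \<psi> a" and b: "\<phi> b \<in> H #>\<^bsub>JJ\<^esub> \<psi> b"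
    and "\<psi> \<in> hom JJ JJ" and g: "g \<in> carrier JJ"
  shows "\<phi> g \<in> H #>\<^bsub>JJ\<^esub> \<psi> g"
proof -
  interpret \<phi>: group_hom JJ JJ \<phi> using assms(1) JJ_group by (simp add: group_hom_def group_hom_axioms_def)
  interpret \<psi>: group_hom JJ JJ \<psi> using assms(5) JJ_group by (simp add: group_hom_def group_hom_axioms_def)
  interpret H: normal H JJ by (rule normal)
  define S where "S = {g \<in> carrier JJ. H #>\<^bsub>JJ\<^esub> \<phi> g = H #>\<^bsub>JJ\<^esub> \<psi> g}"
  have iff: "x \<in> H #>\<^bsub>JJ\<^esub> y \<longleftrightarrow> H #>\<^bsub>JJ\<^esub> x = H #>\<^bsub>JJ\<^esub> y" if "x \<in> carrier JJ" "y \<in> carrier JJ" for x y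
    using repr_independence[OF _ _ H.is_subgroup, of x y] rcos_self[OF _ H.is_subgroup, of x] that by auto
  have "subgroup S JJ"
  proof (rule subgroupI)
    show "S \<subseteq> carrier JJ" by (auto simp: S_def)
    have "\<one>\<^bsub>JJ\<^esub> \<in> S" by (simp add: S_def)
    then show "S \<noteq> {}" by blast
  next
    fix x assume "x \<in> S"
    then show "inv\<^bsub>JJ\<^esub> x \<in> S"
      by (simp add: S_def) (metis H.rcos_inv \<phi>.hom_closed \<psi>.hom_closed)
  next
    fix x y assume "x \<in> S" "y \<in> S"
    then show "x \<otimes>\<^bsub>JJ\<^esub> y \<in> S"
      by (simp add: S_def) (metis H.rcos_sum \<phi>.hom_closed \<psi>.hom_closed)
  qed
  then have "S = carrier JJ" by (rule subgroup_generated) (use a b in \<open>simp_all add: S_def iff\<close>)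
  then show ?thesis using g by (auto simp: S_def iff)
qed

lemma hom_eqI:
  assumes "\<phi> \<in> hom JJ JJ" "\<psi> \<in> hom JJ JJ" "\<phi> a = \<psi> a" "\<phi> b = \<psi> b" "g \<in> carrier JJ"
  shows "\<phi> g = \<psi> g"
proof -
  have cl: "\<psi> x \<in> carrier JJ" if "x \<in> carrier JJ" for x using assms(2) that by (auto simp: hom_def)
  have one: "{\<one>\<^bsub>JJ\<^esub>} #>\<^bsub>JJ\<^esub> \<psi> x = {\<psi> x}" if "x \<in> carrier JJ" for x using cl[OF that] by (simp add: r_coset_def)
  have "\<phi> g \<in> {\<one>\<^bsub>JJ\<^esub>} #>\<^bsub>JJ\<^esub> \<psi> g"
    by (rule hom_agree[OF assms(1) one_is_normal _ _ assms(2) assms(5)])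
       (simp_all only: one a_closed b_closed assms(3,4) singletonI)
  then show ?thesis using assms(5) by (simp add: one)
qed

text \<open>
  The endomorphism comes from the presentation. It fixes \<open>Z1\<close> because \<open>(A x)\<^bsup>h u\<^esup> = A\<^bsup>h u\<^esup>\<close>, and it
  multiplies \<open>C\<close>, hence all of \<open>Z2\<close>, by elements of \<open>Z1\<close> only. An element of its kernel therefore
  lies in \<open>Z2\<close>, then in \<open>Z1\<close>, and is trivial; finiteness gives surjectivity.
\<close>

lemma Psi_exists:
  assumes x: "x \<in> Z2" and y: "y \<in> Z2"
  shows "\<exists>\<phi>\<in>near_id Z2. \<phi> a = a \<otimes>\<^bsub>JJ\<^esub> x \<and> \<phi> b = b \<otimes>\<^bsub>JJ\<^esub> y \<and> (\<forall>z\<in>Z1. \<phi> z = z) \<and> (\<forall>w\<in>Z2. \<phi> w \<in> Z1 #>\<^bsub>JJ\<^esub> w)"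
proof -
  have cl [simp]: "x \<in> carrier JJ" "y \<in> carrier JJ" using x y Z2_closed by auto
  interpret N1: normal Z1 JJ by (rule normal_Z1)
  interpret N2: normal Z2 JJ by (rule normal_Z2)
  have "macdonald_group k e l JJ (a \<otimes>\<^bsub>JJ\<^esub> x) (b \<otimes>\<^bsub>JJ\<^esub> y)"
    by (rule relations_mod_Z2[OF Z2_commute Z1_commute x y])
  from J_hom_exists[OF this] obtain \<phi>0 where \<phi>0: "\<phi>0 \<in> hom JJ JJ" "\<phi>0 a = a \<otimes>\<^bsub>JJ\<^esub> x" "\<phi>0 b = b \<otimes>\<^bsub>JJ\<^esub> y" by blast
  define \<phi> where "\<phi> = restrict \<phi>0 (carrier JJ)"
  have \<phi>: "\<phi> \<in> hom JJ JJ" "\<phi> a = a \<otimes>\<^bsub>JJ\<^esub> x" "\<phi> b = b \<otimes>\<^bsub>JJ\<^esub> y"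
    using \<phi>0 by (auto simp: \<phi>_def hom_def)
  interpret \<phi>: group_hom JJ JJ \<phi> using \<phi>(1) JJ_group by (simp add: group_hom_def group_hom_axioms_def)
  have fix1: "\<phi> z = z" if zZ: "z \<in> Z1" for z
  proof -
    obtain u where "z = a [^]\<^bsub>JJ\<^esub> (h * u)" using zZ by (rule Z1_E)
    then show ?thesis by (simp add: \<phi>.hom_int_pow \<phi> a_Z2_pow_h[OF x])
  qed
  obtain z0 where z0: "z0 \<in> Z1" and "inv\<^bsub>JJ\<^esub> (a \<otimes>\<^bsub>JJ\<^esub> x) \<otimes>\<^bsub>JJ\<^esub> inv\<^bsub>JJ\<^esub> (b \<otimes>\<^bsub>JJ\<^esub> y) \<otimes>\<^bsub>JJ\<^esub> (a \<otimes>\<^bsub>JJ\<^esub> x) \<otimes>\<^bsub>JJ\<^esub> (b \<otimes>\<^bsub>JJ\<^esub> y) = c \<otimes>\<^bsub>JJ\<^esub> z0"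
    using commutator_Z2[OF Z2_commute Z1_commute x y] by blast
  then have \<phi>c: "\<phi> c = c \<otimes>\<^bsub>JJ\<^esub> z0" by (simp add: c_def \<phi>)
  have z0c [simp]: "z0 \<in> carrier JJ" using z0 by (rule Z1_closed)
  have fix2: "\<phi> w \<in> Z1 #>\<^bsub>JJ\<^esub> w" if wZ: "w \<in> Z2" for w
  proof -
    obtain u v where w: "w = a [^]\<^bsub>JJ\<^esub> (h * u) \<otimes>\<^bsub>JJ\<^esub> c [^]\<^bsub>JJ\<^esub> (e * v)" using wZ by (rule Z2_E)
    have zp: "z0 [^]\<^bsub>JJ\<^esub> (e * v) \<in> Z1" using subgroup_int_pow_closed[OF subgroup_Z1 z0] .
    have "\<phi> w = a [^]\<^bsub>JJ\<^esub> (h * u) \<otimes>\<^bsub>JJ\<^esub> (c \<otimes>\<^bsub>JJ\<^esub> z0) [^]\<^bsub>JJ\<^esub> (e * v)"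
      using fix1[OF Z1_I[of u]] by (simp add: w \<phi>.hom_int_pow \<phi>c)
    also have "(c \<otimes>\<^bsub>JJ\<^esub> z0) [^]\<^bsub>JJ\<^esub> (e * v) = c [^]\<^bsub>JJ\<^esub> (e * v) \<otimes>\<^bsub>JJ\<^esub> z0 [^]\<^bsub>JJ\<^esub> (e * v)"
      by (intro int_pow_mult_distrib Z1_commute[OF z0, symmetric]) simp_all
    also have "a [^]\<^bsub>JJ\<^esub> (h * u) \<otimes>\<^bsub>JJ\<^esub> (c [^]\<^bsub>JJ\<^esub> (e * v) \<otimes>\<^bsub>JJ\<^esub> z0 [^]\<^bsub>JJ\<^esub> (e * v)) = w \<otimes>\<^bsub>JJ\<^esub> z0 [^]\<^bsub>JJ\<^esub> (e * v)"
      by (simp add: w m_assoc)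
    also have "\<dots> = z0 [^]\<^bsub>JJ\<^esub> (e * v) \<otimes>\<^bsub>JJ\<^esub> w" using Z1_commute[OF zp Z2_closed[OF wZ]] by simp
    finally show ?thesis using zp by (auto simp: r_coset_def)
  qed
  have id: "(\<lambda>g. g) \<in> hom JJ JJ" by (simp add: hom_def)
  have coset: "g \<otimes>\<^bsub>JJ\<^esub> w \<in> Z2 #>\<^bsub>JJ\<^esub> g" if "g \<in> carrier JJ" "w \<in> Z2" for g w
    using N2.coset_eq that by (auto simp: l_coset_def)
  have near: "\<phi> g \<in> Z2 #>\<^bsub>JJ\<^esub> g" if "g \<in> carrier JJ" for g
    by (rule hom_agree[OF \<phi>(1) normal_Z2 _ _ id that])
       (simp_all add: \<phi> coset x y)
  have "\<phi> g = \<one>\<^bsub>JJ\<^esub> \<Longrightarrow> g = \<one>\<^bsub>JJ\<^esub>" if g: "g \<in> carrier JJ" for g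
  proof -
    assume 1: "\<phi> g = \<one>\<^bsub>JJ\<^esub>"
    have "g \<in> Z2 #>\<^bsub>JJ\<^esub> \<one>\<^bsub>JJ\<^esub>" using N2.coset_sym[OF near[OF g] g] unfolding 1 .
    then have "g \<in> Z2" using N2.subset by simp
    then have "\<phi> g \<in> Z1 #>\<^bsub>JJ\<^esub> g" by (rule fix2)
    then have "g \<in> Z1 #>\<^bsub>JJ\<^esub> \<one>\<^bsub>JJ\<^esub>" using N1.coset_sym[of "\<phi> g" g] g unfolding 1 by simp
    then have "g \<in> Z1" using N1.subset by simp
    then show "g = \<one>\<^bsub>JJ\<^esub>" using fix1 1 by simp
  qed
  then have "inj_on \<phi> (carrier JJ)"
    by (auto simp: \<phi>.inj_on_one_iff)
  moreover from this have "\<phi> ` carrier JJ = carrier JJ"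
    by (intro endo_inj_surj finite_JJ) auto
  ultimately have "\<phi> \<in> auto JJ"
    using \<phi>(1) by (simp add: auto_def Bij_def bij_betw_def) (simp add: \<phi>_def)
  then have "\<phi> \<in> near_id Z2" using near by (rule near_idI)
  with \<phi> fix1 fix2 show ?thesis by blast
qed

lemma auto_agree:
  assumes "\<phi> \<in> auto JJ" "\<psi> \<in> auto JJ" "\<phi> a = \<psi> a" "\<phi> b = \<psi> b"
  shows "\<phi> = \<psi>"
proof (rule auto_eqI[OF assms(1,2)])
  fix g assume "g \<in> carrier JJ"
  moreover have "\<phi> \<in> hom JJ JJ" "\<psi> \<in> hom JJ JJ" using assms(1,2) by (simp_all add: auto_def)
  ultimately show "\<phi> g = \<psi> g" by (intro hom_eqI[OF _ _ assms(3,4)])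
qed

lemma Psi_ex1:
  assumes "x \<in> Z2" "y \<in> Z2"
  shows "\<exists>!\<phi>. \<phi> \<in> auto JJ \<and> \<phi> a = a \<otimes>\<^bsub>JJ\<^esub> x \<and> \<phi> b = b \<otimes>\<^bsub>JJ\<^esub> y"
proof -
  obtain \<phi> where "\<phi> \<in> near_id Z2" "\<phi> a = a \<otimes>\<^bsub>JJ\<^esub> x" "\<phi> b = b \<otimes>\<^bsub>JJ\<^esub> y" using Psi_exists[OF assms] by blast
  then show ?thesis using near_id_auto auto_agree by (intro ex1I[of _ \<phi>]) auto
qed

lemma Psi_eqI:
  assumes "x \<in> Z2" "y \<in> Z2" "\<phi> \<in> auto JJ" "\<phi> a = a \<otimes>\<^bsub>JJ\<^esub> x" "\<phi> b = b \<otimes>\<^bsub>JJ\<^esub> y"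
  shows "Psi m l x y = \<phi>"
  unfolding Psi_def by (rule the1_equality[OF Psi_ex1[OF assms(1,2)]]) (simp add: assms)

lemma Psi:
  assumes "x \<in> Z2" "y \<in> Z2"
  shows "Psi m l x y \<in> near_id Z2" "Psi m l x y a = a \<otimes>\<^bsub>JJ\<^esub> x" "Psi m l x y b = b \<otimes>\<^bsub>JJ\<^esub> y"
    "\<And>z. z \<in> Z1 \<Longrightarrow> Psi m l x y z = z" "\<And>w. w \<in> Z2 \<Longrightarrow> Psi m l x y w \<in> Z1 #>\<^bsub>JJ\<^esub> w"
proof -
  obtain \<phi> where near: "\<phi> \<in> near_id Z2" and \<phi>: "\<phi> a = a \<otimes>\<^bsub>JJ\<^esub> x \<and> \<phi> b = b \<otimes>\<^bsub>JJ\<^esub> y \<and>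
    (\<forall>z\<in>Z1. \<phi> z = z) \<and> (\<forall>w\<in>Z2. \<phi> w \<in> Z1 #>\<^bsub>JJ\<^esub> w)" by (rule bexE[OF Psi_exists[OF assms]])
  have "Psi m l x y = \<phi>"
    by (rule Psi_eqI[OF assms near_id_auto[OF near]]) (simp_all add: \<phi>)
  then show "Psi m l x y \<in> near_id Z2" "Psi m l x y a = a \<otimes>\<^bsub>JJ\<^esub> x" "Psi m l x y b = b \<otimes>\<^bsub>JJ\<^esub> y"
    "\<And>z. z \<in> Z1 \<Longrightarrow> Psi m l x y z = z" "\<And>w. w \<in> Z2 \<Longrightarrow> Psi m l x y w \<in> Z1 #>\<^bsub>JJ\<^esub> w"
    using near \<phi> by simp_all
qed

lemma near_id_Psi:
  assumes \<phi>: "\<phi> \<in> near_id Z2"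
  obtains x y where "x \<in> Z2" "y \<in> Z2" "\<phi> = Psi m l x y"
proof -
  interpret N2: normal Z2 JJ by (rule normal_Z2)
  have "\<exists>x\<in>Z2. \<phi> g = g \<otimes>\<^bsub>JJ\<^esub> x" if "g \<in> carrier JJ" for g
    using near_id_coset[OF \<phi> that] N2.coset_eq that by (auto simp: l_coset_def)
  then obtain x y where "x \<in> Z2" "y \<in> Z2" "\<phi> a = a \<otimes>\<^bsub>JJ\<^esub> x" "\<phi> b = b \<otimes>\<^bsub>JJ\<^esub> y"
    by (meson a_closed b_closed)
  then show thesis using that Psi_eqI[of x y \<phi>] near_id_auto[OF \<phi>] by metis
qed

lemma card_near_id_Z2: "card (near_id Z2) = 2 ^ (4 * m)"
proof -
  have "bij_betw (\<lambda>(x, y). Psi m l x y) (Z2 \<times> Z2) (near_id Z2)"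
  proof (rule bij_betw_imageI)
    show "inj_on (\<lambda>(x, y). Psi m l x y) (Z2 \<times> Z2)"
    proof (rule inj_onI, clarsimp)
      fix x y x' y' assume xy: "x \<in> Z2" "y \<in> Z2" "x' \<in> Z2" "y' \<in> Z2" and eq: "Psi m l x y = Psi m l x' y'"
      then have "a \<otimes>\<^bsub>JJ\<^esub> x = a \<otimes>\<^bsub>JJ\<^esub> x'" "b \<otimes>\<^bsub>JJ\<^esub> y = b \<otimes>\<^bsub>JJ\<^esub> y'" by (metis Psi(2), metis Psi(3))
      then show "x = x' \<and> y = y'" using xy Z2_closed by simp
    qed
    show "(\<lambda>(x, y). Psi m l x y) ` (Z2 \<times> Z2) = near_id Z2"
    proof (intro subset_antisym subsetI)
      fix \<phi> assume "\<phi> \<in> near_id Z2"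
      then obtain x y where "x \<in> Z2" "y \<in> Z2" "\<phi> = Psi m l x y" by (rule near_id_Psi)
      then show "\<phi> \<in> (\<lambda>(x, y). Psi m l x y) ` (Z2 \<times> Z2)" by auto
    qed (auto simp: Psi(1))
  qed
  then have "card (near_id Z2) = card (Z2 \<times> Z2)" by (rule bij_betw_same_card[symmetric])
  also have "\<dots> = 2 ^ (2 * m) * 2 ^ (2 * m)" by (simp only: card_cartesian_product card_Z2)
  also have "\<dots> = 2 ^ (2 * m + 2 * m)" by (simp only: power_add)
  also have "2 * m + 2 * m = 4 * m" by simp
  finally show ?thesis .
qed

lemma central_auto_1: "central_auto JJ 1 = near_id Z1"
  unfolding central_auto_def upper_central_1 by (rule normal.kernel_induced_auto[OF normal_Z1])

lemma central_auto_2: "central_auto JJ 2 = near_id Z2"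
  unfolding central_auto_def upper_central_2 by (rule normal.kernel_induced_auto[OF normal_Z2])

abbreviation "Aut2_group \<equiv> (AutoGroup JJ)\<lparr>carrier := near_id Z2\<rparr>"
abbreviation "Z2_group \<equiv> JJ\<lparr>carrier := Z2\<rparr>"

lemma central_auto_group_2: "central_auto_group JJ 2 = Aut2_group"
  by (simp add: central_auto_group_def central_auto_2)

lemma upper_central_group_2: "upper_central_group JJ 2 = Z2_group"
  by (simp add: upper_central_group_def upper_central_2)

lemma near_id_fixes_Z1: "\<phi> \<in> near_id Z2 \<Longrightarrow> z \<in> Z1 \<Longrightarrow> \<phi> z = z"
  by (metis near_id_Psi Psi(4))

lemma normal_near_id_Z1: "near_id Z1 \<lhd> Aut2_group"
  by (rule near_id_quotient(1)[where H = Z1 and H' = Z2])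
     (rule normal_Z1 normal_Z2 Z1_subset_Z2 near_id_fixes_Z1 | assumption)+

lemma same_coset_iff:
  assumes "\<phi> \<in> near_id Z2" "\<psi> \<in> near_id Z2"
  shows "near_id Z1 #>\<^bsub>Aut2_group\<^esub> \<phi> = near_id Z1 #>\<^bsub>Aut2_group\<^esub> \<psi>
    \<longleftrightarrow> (\<forall>g\<in>carrier JJ. \<phi> g \<in> Z1 #>\<^bsub>JJ\<^esub> \<psi> g)"
  by (rule near_id_quotient(2)[where H = Z1 and H' = Z2])
     (rule normal_Z1 normal_Z2 Z1_subset_Z2 near_id_fixes_Z1 assms | assumption)+

lemma group_Aut2: "group Aut2_group"
  by (rule group.subgroup_imp_group[OF AutoGroup normal.subgroup_near_id[OF normal_Z2]])

lemma comm_group_Z2: "comm_group Z2_group"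
  using subgroup_imp_group[OF subgroup_Z2] by (rule group.group_comm_groupI) (simp add: Z2_commutative)

lemma normal_Z1_in_Z2: "Z1 \<lhd> Z2_group"
  using subgroup_incl[OF subgroup_Z1 subgroup_Z2 Z1_subset_Z2]
  by (simp add: comm_group.normal_iff_subgroup[OF comm_group_Z2])

definition \<Gamma> where "\<Gamma> = (\<lambda>(x, y). near_id Z1 #>\<^bsub>Aut2_group\<^esub> Psi m l x y)"

lemma near_id_hom: "\<phi> \<in> near_id Z2 \<Longrightarrow> \<phi> \<in> hom JJ JJ"
  using near_id_auto by (auto simp: auto_def)

text \<open>
  On the generator \<open>A\<close> the composite takes the value \<open>A x \<phi>(x')\<close>, where \<open>\<phi>(x')\<close> is \<open>x'\<close> up to a
  factor in \<open>Z1\<close>; similarly for \<open>B\<close>.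
\<close>

lemma Psi_mult:
  assumes xy: "x \<in> Z2" "y \<in> Z2" "x' \<in> Z2" "y' \<in> Z2"
  shows "near_id Z1 #>\<^bsub>Aut2_group\<^esub> Psi m l (x \<otimes>\<^bsub>JJ\<^esub> x') (y \<otimes>\<^bsub>JJ\<^esub> y')
     = near_id Z1 #>\<^bsub>Aut2_group\<^esub> (Psi m l x y \<otimes>\<^bsub>Aut2_group\<^esub> Psi m l x' y')"
proof -
  interpret Aut2_group: group Aut2_group by (rule group_Aut2)
  interpret N1: normal Z1 JJ by (rule normal_Z1)
  have xy2: "x \<otimes>\<^bsub>JJ\<^esub> x' \<in> Z2" "y \<otimes>\<^bsub>JJ\<^esub> y' \<in> Z2"
    using xy subgroup.m_closed[OF subgroup_Z2] by auto
  have [simp]: "x \<in> carrier JJ" "y \<in> carrier JJ" "x' \<in> carrier JJ" "y' \<in> carrier JJ"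
    using xy Z2_closed by auto
  define \<phi> where "\<phi> = Psi m l x y"
  define \<psi> where "\<psi> = Psi m l x' y'"
  note \<phi> = Psi[OF xy(1,2), folded \<phi>_def]
  note \<psi> = Psi[OF xy(3,4), folded \<psi>_def]
  have comp: "(\<phi> \<otimes>\<^bsub>Aut2_group\<^esub> \<psi>) g = \<phi> (\<psi> g)" if "g \<in> carrier JJ" for g
    using AutoGroup_mult[OF near_id_auto[OF \<phi>(1)] near_id_auto[OF \<psi>(1)] that] by simp
  have mem: "\<phi> \<otimes>\<^bsub>Aut2_group\<^esub> \<psi> \<in> near_id Z2" using Aut2_group.m_closed[of \<phi> \<psi>] \<phi>(1) \<psi>(1) by simp
  have key: "g \<otimes>\<^bsub>JJ\<^esub> (u \<otimes>\<^bsub>JJ\<^esub> u') \<in> Z1 #>\<^bsub>JJ\<^esub> \<phi> (g \<otimes>\<^bsub>JJ\<^esub> u')"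
    if g: "g \<in> carrier JJ" and u: "u \<in> carrier JJ" and u': "u' \<in> Z2" and "\<phi> g = g \<otimes>\<^bsub>JJ\<^esub> u" for g u u'
  proof -
    have [simp]: "u' \<in> carrier JJ" using u' by (rule Z2_closed)
    obtain z where z: "z \<in> Z1" "\<phi> u' = z \<otimes>\<^bsub>JJ\<^esub> u'" using \<phi>(5)[OF u'] by (auto simp: r_coset_def)
    have [simp]: "z \<in> carrier JJ" using z(1) by (rule Z1_closed)
    have "\<phi> (g \<otimes>\<^bsub>JJ\<^esub> u') = g \<otimes>\<^bsub>JJ\<^esub> u \<otimes>\<^bsub>JJ\<^esub> (z \<otimes>\<^bsub>JJ\<^esub> u')"
      using auto_mult[OF near_id_auto[OF \<phi>(1)] g, of u'] that(4) z(2) by simp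
    also have "\<dots> = (g \<otimes>\<^bsub>JJ\<^esub> u) \<otimes>\<^bsub>JJ\<^esub> z \<otimes>\<^bsub>JJ\<^esub> u'" using g u by (simp add: m_assoc)
    also have "\<dots> = z \<otimes>\<^bsub>JJ\<^esub> (g \<otimes>\<^bsub>JJ\<^esub> (u \<otimes>\<^bsub>JJ\<^esub> u'))"
      using g u Z1_commute[OF z(1), of "g \<otimes>\<^bsub>JJ\<^esub> u", symmetric] by (simp add: m_assoc)
    finally have "\<phi> (g \<otimes>\<^bsub>JJ\<^esub> u') \<in> Z1 #>\<^bsub>JJ\<^esub> (g \<otimes>\<^bsub>JJ\<^esub> (u \<otimes>\<^bsub>JJ\<^esub> u'))" using z(1) by (auto simp: r_coset_def)
    then show ?thesis by (rule N1.coset_sym) (simp add: g u)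
  qed
  have "\<forall>g\<in>carrier JJ. Psi m l (x \<otimes>\<^bsub>JJ\<^esub> x') (y \<otimes>\<^bsub>JJ\<^esub> y') g \<in> Z1 #>\<^bsub>JJ\<^esub> (\<phi> \<otimes>\<^bsub>Aut2_group\<^esub> \<psi>) g"
  proof
    fix g assume g: "g \<in> carrier JJ"
    show "Psi m l (x \<otimes>\<^bsub>JJ\<^esub> x') (y \<otimes>\<^bsub>JJ\<^esub> y') g \<in> Z1 #>\<^bsub>JJ\<^esub> (\<phi> \<otimes>\<^bsub>Aut2_group\<^esub> \<psi>) g"
    proof (rule hom_agree[OF near_id_hom[OF Psi(1)[OF xy2]] normal_Z1 _ _ near_id_hom[OF mem] g])
      show "Psi m l (x \<otimes>\<^bsub>JJ\<^esub> x') (y \<otimes>\<^bsub>JJ\<^esub> y') a \<in> Z1 #>\<^bsub>JJ\<^esub> (\<phi> \<otimes>\<^bsub>Aut2_group\<^esub> \<psi>) a"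
        unfolding comp[OF a_closed] Psi(2)[OF xy2] \<psi>(2) using key[OF a_closed _ xy(3) \<phi>(2)] by simp
      show "Psi m l (x \<otimes>\<^bsub>JJ\<^esub> x') (y \<otimes>\<^bsub>JJ\<^esub> y') b \<in> Z1 #>\<^bsub>JJ\<^esub> (\<phi> \<otimes>\<^bsub>Aut2_group\<^esub> \<psi>) b"
        unfolding comp[OF b_closed] Psi(3)[OF xy2] \<psi>(3) using key[OF b_closed _ xy(4) \<phi>(3)] by simp
    qed
  qed
  then show ?thesis
    unfolding \<phi>_def[symmetric] \<psi>_def[symmetric] using same_coset_iff[OF Psi(1)[OF xy2] mem] by blast
qed

lemma \<Gamma>_epi: "\<Gamma> \<in> epi (Z2_group \<times>\<times> Z2_group) (Aut2_group Mod near_id Z1)"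
proof -
  interpret K: normal "near_id Z1" Aut2_group by (rule normal_near_id_Z1)
  have "\<Gamma> \<in> hom (Z2_group \<times>\<times> Z2_group) (Aut2_group Mod near_id Z1)"
  proof (rule homI)
    fix p assume "p \<in> carrier (Z2_group \<times>\<times> Z2_group)"
    then obtain x y where "p = (x, y)" "x \<in> Z2" "y \<in> Z2" by (auto simp: DirProd_def)
    then show "\<Gamma> p \<in> carrier (Aut2_group Mod near_id Z1)"
      using Psi(1)[of x y] by (auto simp: \<Gamma>_def carrier_FactGroup)
  next
    fix p q assume "p \<in> carrier (Z2_group \<times>\<times> Z2_group)" "q \<in> carrier (Z2_group \<times>\<times> Z2_group)"
    then obtain x y x' y' where pq: "p = (x, y)" "q = (x', y')" and xy: "x \<in> Z2" "y \<in> Z2" "x' \<in> Z2" "y' \<in> Z2"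
      by (auto simp: DirProd_def)
    have "\<Gamma> p \<otimes>\<^bsub>Aut2_group Mod near_id Z1\<^esub> \<Gamma> q = near_id Z1 #>\<^bsub>Aut2_group\<^esub> (Psi m l x y \<otimes>\<^bsub>Aut2_group\<^esub> Psi m l x' y')"
      using K.rcos_sum[of "Psi m l x y" "Psi m l x' y'"] Psi(1) xy by (simp add: pq \<Gamma>_def)
    then show "\<Gamma> (p \<otimes>\<^bsub>Z2_group \<times>\<times> Z2_group\<^esub> q) = \<Gamma> p \<otimes>\<^bsub>Aut2_group Mod near_id Z1\<^esub> \<Gamma> q"
      using Psi_mult[OF xy] by (simp add: pq \<Gamma>_def)
  qed
  moreover have "carrier (Aut2_group Mod near_id Z1) \<subseteq> \<Gamma> ` carrier (Z2_group \<times>\<times> Z2_group)"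
  proof
    fix C assume "C \<in> carrier (Aut2_group Mod near_id Z1)"
    then obtain \<phi> where \<phi>: "\<phi> \<in> near_id Z2" "C = near_id Z1 #>\<^bsub>Aut2_group\<^esub> \<phi>" by (auto simp: carrier_FactGroup)
    obtain x y where "x \<in> Z2" "y \<in> Z2" "\<phi> = Psi m l x y" using \<phi>(1) by (rule near_id_Psi)
    then show "C \<in> \<Gamma> ` carrier (Z2_group \<times>\<times> Z2_group)"
      by (intro image_eqI[where x = "(x, y)"]) (simp_all add: \<phi>(2) \<Gamma>_def DirProd_def)
  qed
  ultimately show ?thesis by (simp add: epi_iff_subset)
qed

text \<open>
  This identifies the kernel of \<open>(x, y) \<mapsto> \<Psi>\<^bsub>(x,y)\<^esub> Aut\<^sub>1(J)\<close>; triviality modulo \<open>Z1\<close> can be tested on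
  the generators.
\<close>

lemma Psi_near_id_Z1:
  assumes xy: "x \<in> Z2" "y \<in> Z2"
  shows "Psi m l x y \<in> near_id Z1 \<longleftrightarrow> x \<in> Z1 \<and> y \<in> Z1"
proof
  assume *: "Psi m l x y \<in> near_id Z1"
  interpret N1: normal Z1 JJ by (rule normal_Z1)
  have "u \<in> Z1" if "g \<in> carrier JJ" "u \<in> Z2" "Psi m l x y g = g \<otimes>\<^bsub>JJ\<^esub> u" for g u
  proof -
    have "g \<otimes>\<^bsub>JJ\<^esub> u \<in> g <#\<^bsub>JJ\<^esub> Z1" using near_id_coset[OF * that(1)] that(3) N1.coset_eq that(1) by auto
    then obtain z where z: "z \<in> Z1" "g \<otimes>\<^bsub>JJ\<^esub> u = g \<otimes>\<^bsub>JJ\<^esub> z" by (auto simp: l_coset_def)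
    then have "u = z" using that(1) Z2_closed[OF that(2)] Z1_closed[OF z(1)] by simp
    then show "u \<in> Z1" using z(1) by simp
  qed
  then show "x \<in> Z1 \<and> y \<in> Z1" using xy Psi(2,3)[OF xy] a_closed b_closed by blast
next
  assume z: "x \<in> Z1 \<and> y \<in> Z1"
  interpret N1: normal Z1 JJ by (rule normal_Z1)
  have id: "(\<lambda>g. g) \<in> hom JJ JJ" by (simp add: hom_def)
  have coset: "g \<otimes>\<^bsub>JJ\<^esub> w \<in> Z1 #>\<^bsub>JJ\<^esub> g" if "g \<in> carrier JJ" "w \<in> Z1" for g w
    using N1.coset_eq that by (auto simp: l_coset_def)
  show "Psi m l x y \<in> near_id Z1"
  proof (rule near_idI)
    show "Psi m l x y \<in> auto JJ" using Psi(1)[OF xy] by (rule near_id_auto)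
    fix g assume g: "g \<in> carrier JJ"
    show "Psi m l x y g \<in> Z1 #>\<^bsub>JJ\<^esub> g"
      by (rule hom_agree[OF near_id_hom[OF Psi(1)[OF xy]] normal_Z1 _ _ id g])
         (simp_all add: Psi[OF xy] coset z)
  qed
qed

lemma \<Gamma>_kernel: "kernel (Z2_group \<times>\<times> Z2_group) (Aut2_group Mod near_id Z1) \<Gamma> = Z1 \<times> Z1"
proof -
  interpret Aut2_group: group Aut2_group by (rule group_Aut2)
  interpret K: normal "near_id Z1" Aut2_group by (rule normal_near_id_Z1)
  have "\<Gamma> (x, y) = near_id Z1 \<longleftrightarrow> x \<in> Z1 \<and> y \<in> Z1" if xy: "x \<in> Z2" "y \<in> Z2" for x y
  proof -
    have "\<Gamma> (x, y) = near_id Z1 \<longleftrightarrow> Psi m l x y \<in> near_id Z1"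
      using Aut2_group.rcos_self[OF _ K.is_subgroup, of "Psi m l x y"] K.rcos_const[OF group_Aut2, of "Psi m l x y"] Psi(1)[OF xy]
      by (auto simp: \<Gamma>_def)
    then show ?thesis by (simp add: Psi_near_id_Z1[OF xy])
  qed
  then show ?thesis using Z1_subset_Z2 by (auto simp: kernel_def DirProd_def)
qed

lemma quotient_iso: "Aut2_group Mod near_id Z1 \<cong> (Z2_group Mod Z1) \<times>\<times> (Z2_group Mod Z1)"
proof -
  interpret Z2_group: comm_group Z2_group by (rule comm_group_Z2)
  interpret K: normal "near_id Z1" Aut2_group by (rule normal_near_id_Z1)
  have SS: "group (Z2_group \<times>\<times> Z2_group)" by (rule DirProd_group) (rule Z2_group.is_group)+
  have Aut2_group: "group (Aut2_group Mod near_id Z1)" by (rule K.factorgroup_is_group)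
  interpret \<Gamma>: group_hom "Z2_group \<times>\<times> Z2_group" "Aut2_group Mod near_id Z1" \<Gamma>
    using \<Gamma>_epi SS Aut2_group by (simp add: group_hom_def group_hom_axioms_def epi_def)
  have "\<Gamma> ` carrier (Z2_group \<times>\<times> Z2_group) = carrier (Aut2_group Mod near_id Z1)" using \<Gamma>_epi by (simp add: epi_def)
  then have "Z2_group \<times>\<times> Z2_group Mod (Z1 \<times> Z1) \<cong> Aut2_group Mod near_id Z1" using \<Gamma>.FactGroup_iso by (simp add: \<Gamma>_kernel)
  moreover have "group (Z2_group \<times>\<times> Z2_group Mod (Z1 \<times> Z1))"
    by (rule normal.factorgroup_is_group[OF Z2_group.DirProd_normal[OF Z2_group.is_group normal_Z1_in_Z2 normal_Z1_in_Z2]])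
  ultimately have "Aut2_group Mod near_id Z1 \<cong> Z2_group \<times>\<times> Z2_group Mod (Z1 \<times> Z1)" by (rule group.iso_sym[rotated])
  also have "Z2_group \<times>\<times> Z2_group Mod (Z1 \<times> Z1) \<cong> (Z2_group Mod Z1) \<times>\<times> (Z2_group Mod Z1)"
    by (rule Z2_group.FactGroup_DirProd_multiplication_iso_2[OF Z2_group.is_group normal_Z1_in_Z2 normal_Z1_in_Z2])
  finally show ?thesis .
qed

lemma Psi_image_coset:
  assumes xy: "x \<in> Z2" "y \<in> Z2" and C: "C \<in> carrier (Z2_group Mod Z1)"
  shows "Psi m l x y ` C = C"
proof -
  obtain w where w: "w \<in> Z2" and Cw: "C = Z1 #>\<^bsub>JJ\<^esub> w" using C by (auto simp: carrier_FactGroup r_coset_def)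
  have [simp]: "w \<in> carrier JJ" using w by (rule Z2_closed)
  have "Psi m l x y (z \<otimes>\<^bsub>JJ\<^esub> w) = z \<otimes>\<^bsub>JJ\<^esub> Psi m l x y w" if "z \<in> Z1" for z
    using auto_mult[OF near_id_auto[OF Psi(1)[OF xy]] Z1_closed[OF that], of w] Psi(4)[OF xy that] by simp
  then have "Psi m l x y ` C = Z1 #>\<^bsub>JJ\<^esub> Psi m l x y w"
    unfolding Cw r_coset_def by (auto simp: image_iff)
  also have "\<dots> = C" unfolding Cw
    using Psi(5)[OF xy w] by (intro repr_independence[symmetric] subgroup_Z1) auto
  finally show ?thesis .
qed

end

theorem proposition7p2:
  fixes m :: nat and l :: int
  assumes "m > 1" and "odd l"
  defines "Z1 \<equiv> upper_central (J m l) 1"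
    and "Z2 \<equiv> upper_central (J m l) 2"
    and "Aut1 \<equiv> central_auto (J m l) 1"
    and "Aut2 \<equiv> central_auto (J m l) 2"
    and "Z2G \<equiv> upper_central_group (J m l) 2"
    and "Aut2G \<equiv> central_auto_group (J m l) 2"
  shows
    "(\<forall>x\<in>Z2. \<forall>y\<in>Z2.
        (\<exists>!\<phi>. \<phi> \<in> auto (J m l) \<and>
           \<phi> (J_A m l) = J_A m l \<otimes>\<^bsub>J m l\<^esub> x \<and> \<phi> (J_B m l) = J_B m l \<otimes>\<^bsub>J m l\<^esub> y) \<and>
        Psi m l x y \<in> Aut2 \<and>
        (\<forall>z\<in>Z1. Psi m l x y z = z) \<and>
        (\<forall>C\<in>carrier (Z2G Mod Z1). Psi m l x y ` C = C)) \<and>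
     card Aut2 = 2 ^ (4 * m) \<and>
     (\<lambda>(x, y). Aut1 #>\<^bsub>Aut2G\<^esub> Psi m l x y) \<in> epi (Z2G \<times>\<times> Z2G) (Aut2G Mod Aut1) \<and>
     kernel (Z2G \<times>\<times> Z2G) (Aut2G Mod Aut1) (\<lambda>(x, y). Aut1 #>\<^bsub>Aut2G\<^esub> Psi m l x y) = Z1 \<times> Z1 \<and>
     Aut2G Mod Aut1 \<cong> (Z2G Mod Z1) \<times>\<times> (Z2G Mod Z1)"
proof -
  obtain k where m: "m = Suc k" and "k \<ge> 1" using \<open>m > 1\<close> by (cases m) auto
  then interpret J: J_params k l using \<open>odd l\<close> by unfold_locales auto
  have eqs: "Z1 = J.Z1" "Z2 = J.Z2" "Aut1 = J.near_id J.Z1" "Aut2 = J.near_id J.Z2"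
    "Z2G = J.Z2_group" "Aut2G = J.Aut2_group"
    unfolding Z1_def Z2_def Aut1_def Aut2_def Z2G_def Aut2G_def m
    by (rule J.upper_central_1 J.upper_central_2 J.central_auto_1 J.central_auto_2
        J.upper_central_group_2 J.central_auto_group_2)+
  show ?thesis
    unfolding eqs unfolding m
  proof (intro conjI ballI)
    fix x y assume xy: "x \<in> J.Z2" "y \<in> J.Z2"
    show "\<exists>!\<phi>. \<phi> \<in> auto (J (Suc k) l) \<and>
           \<phi> (J_A (Suc k) l) = J_A (Suc k) l \<otimes>\<^bsub>J (Suc k) l\<^esub> x \<and> \<phi> (J_B (Suc k) l) = J_B (Suc k) l \<otimes>\<^bsub>J (Suc k) l\<^esub> y"
      using xy by (rule J.Psi_ex1)
    show "Psi (Suc k) l x y \<in> J.near_id J.Z2" using xy by (rule J.Psi(1))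
    show "Psi (Suc k) l x y z = z" if "z \<in> J.Z1" for z using xy that by (rule J.Psi(4))
    show "Psi (Suc k) l x y ` C = C" if "C \<in> carrier (J.Z2_group Mod J.Z1)" for C
      using xy that by (rule J.Psi_image_coset)
  next
    show "card (J.near_id J.Z2) = 2 ^ (4 * Suc k)" by (rule J.card_near_id_Z2)
    show "(\<lambda>(x, y). J.near_id J.Z1 #>\<^bsub>J.Aut2_group\<^esub> Psi (Suc k) l x y) \<in> epi (J.Z2_group \<times>\<times> J.Z2_group) (J.Aut2_group Mod J.near_id J.Z1)"
      using J.\<Gamma>_epi unfolding J.\<Gamma>_def .
    show "kernel (J.Z2_group \<times>\<times> J.Z2_group) (J.Aut2_group Mod J.near_id J.Z1) (\<lambda>(x, y). J.near_id J.Z1 #>\<^bsub>J.Aut2_group\<^esub> Psi (Suc k) l x y) = J.Z1 \<times> J.Z1"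
      using J.\<Gamma>_kernel unfolding J.\<Gamma>_def .
    show "J.Aut2_group Mod J.near_id J.Z1 \<cong> (J.Z2_group Mod J.Z1) \<times>\<times> (J.Z2_group Mod J.Z1)" by (rule J.quotient_iso)
  qed
qed

end
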